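(* Suppose that $V$ satisfies (V) with $V_{loc}\equiv0$, $K$ satisfies (K), and $f$ satisfies (F1)--(F5) (conditions listed in the context). Let $(\mu_n)$ be a sequence with $0\le\mu_n<\mu^*$ and $\mu_n\to0$. If, for each $n$, $u_n$ is a ground state solution of $$(-\Delta)^{\alpha/2}u+\Big(V(x)-\frac{\mu_n}{|x|^\alpha}\Big)u=f(x,u)-K(x)|u|^{q-2}u\quad\text{on }\mathbb{R}^N\setminus\{0\},$$ then there is a sequence $(z_n)\subset\mathbb{Z}^N$ such that $$u_n(\cdot-z_n)\to u_0\quad\text{in }H^{\alpha/2}(\mathbb{R}^N),$$ where $u_0$ is a ground state solution of the same equation with $\mu_n$ replaced by $\mu=0$.
   Context: Setting: $\alpha\in(0,2)$, $N\ge 1$ is an integer with $N>\alpha$, $2^*_\alpha:=\frac{2N}{N-\alpha}$, and all functions are real-valued. The operator $(-\Delta)^{\alpha/2}$ is the fractional Laplacian, i.e. the Fourier multiplier with symbol $|\xi|^\alpha$. $H^{\alpha/2}(\mathbb{R}^N)$ is the space of $u\in L^2(\mathbb{R}^N)$ with $\iint_{\mathbb{R}^N\times\mathbb{R}^N}\frac{|u(x)-u(y)|^2}{|x-y|^{N+\alpha}}\,dx\,dy<\infty$, with its usual Hilbert structure. Constants: $$c_{N,\alpha}:=\frac{2^\alpha\,\Gamma\left(\frac{N+\alpha}{2}\right)}{2\pi^{N/2}\,|\Gamma(-\alpha/2)|},\qquad \mu^*:=2^\alpha\left(\frac{\Gamma\left(\frac{N+\alpha}{4}\right)}{\Gamma\left(\frac{N-\alpha}{4}\right)}\right)^2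 .$$ Conditions on $f:\mathbb{R}^N\times\mathbb{R}\to\mathbb{R}$, with $F(x,u):=\int_0^u f(x,s)\,ds$: (F1) $f$ is measurable, $\mathbb{Z}^N$-periodic in $x$ and continuous in $u\in\mathbb{R}$ for a.e. $x$; there are $c>0$ and $2<q<p<2^*_\alpha$ such that $|f(x,u)|\le c(1+|u|^{p-1})$ for all $u\in\mathbb{R}$, $x\in\mathbb{R}^N$ (this $q$ is the exponent appearing in the equation). (F2) $f(x,u)=o(|u|)$ uniformly in $x$ as $|u|\to0^+$. (F3) $F(x,u)/|u|^q\to\infty$ uniformly in $x$ as $|u|\to\infty$. (F4) $u\mapsto f(x,u)/|u|^{q-1}$ is increasing on $(-\infty,0)$ and on $(0,\infty)$. (F5) For a.e. $x$ the function $f(x,\cdot)$ is of class $C^1$, and there are $2<r\le p$ and $b,c>0$ such that $f(x,u)u-2F(x,u)\ge b|u|^r$ and $|f'_u(x,u)|\le c(1+|u|^{p-2})$ for all $u\in\mathbb{R}$ and a.e. $x\in\mathbb{R}^N$ (with $p$ as in (F1)). Condition (K): $K\in L^\infty(\mathbb{R}^N)$ is $\mathbb{Z}^N$-periodic and $K(x)\ge0$ for a.e. $x\in\mathbb{R}^N$. Condition (V): $V\in L^\infty(\mathbb{R}^N)$ is a sum $V=V_{loc}+V_{per}$, where $V_{per}\in L^\infty(\mathbb{R}^N)$ is $\mathbb{Z}^N$-periodic, $V_{loc}(x)\to0$ as $|x|\to\infty$, $V_{loc}\in L^s(\mathbb{R}^N)$ for some $s\ge\frac N\alpha$, and $\operatorname{ess\,inf}_{x\in\mathbb{R}^N}V(x)>0$.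 For given $\mu$ the energy functional $\mathcal{J}:H^{\alpha/2}(\mathbb{R}^N)\to\mathbb{R}$ (of class $C^1$; its critical points are the weak solutions of the equation) is $$\mathcal{J}(u)=\frac{c_{N,\alpha}}2\iint_{\mathbb{R}^N\times\mathbb{R}^N}\frac{|u(x)-u(y)|^2}{|x-y|^{N+\alpha}}\,dx\,dy+\frac12\int_{\mathbb{R}^N}V(x)|u|^2\,dx-\frac12\int_{\mathbb{R}^N}\frac{\mu}{|x|^\alpha}|u|^2\,dx-\int_{\mathbb{R}^N}\Big(F(x,u)-\frac1qK(x)|u|^q\Big)dx ,$$ and its Nehari manifold is $\mathcal{N}:=\{u\in H^{\alpha/2}(\mathbb{R}^N)\setminus\{0\}:\ \mathcal{J}'(u)(u)=0\}$. A ground state solution is a critical point $u\in\mathcal{N}$ of $\mathcal{J}$ with $\mathcal{J}(u)=\inf_{\mathcal{N}}\mathcal{J}$.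
   Formalization: The convergence u_n(·-z_n) → u_0 is asserted along a subsequence; for the whole sequence it is false: with V=1, K=0, f=|u|^{p-2}u, μ_n=0 and a ground state w, the sequence u_n=(-1)^n w admits no such (z_n). *)

theory Defs
  imports "HOL-Probability.Probability"
begin

text \<open>
  The space \<open>\<real>\<^sup>N\<close> is \<^typ>\<open>real^'n\<close> with \<open>N = CARD('n)\<close>. Elements of the function spaces below are
  Lebesgue measurable representatives; equality of classes is equality a.e.
\<close>

definition int_lattice :: "(real^'n) set" where
  "int_lattice = {z. \<forall>i. z $ i \<in> \<int>}"

definition Linfty :: "(real^'n \<Rightarrow> real) set" where
  "Linfty = {g \<in> borel_measurable lebesgue. \<exists>C. AE x in lebesgue. \<bar>g x\<bar> \<le> C}"

definition essinf :: "(real^'n \<Rightarrow> real) \<Rightarrow> ereal" where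
  "essinf g = - esssup lebesgue (\<lambda>x. - ereal (g x))"

definition ae_periodic :: "(real^'n \<Rightarrow> real) \<Rightarrow> bool" where
  "ae_periodic g \<longleftrightarrow> (\<forall>z\<in>int_lattice. AE x in lebesgue. g (x + z) = g x)"

definition crit_exp :: "nat \<Rightarrow> real \<Rightarrow> real" where
  "crit_exp N \<alpha> = 2 * real N / (real N - \<alpha>)"

definition frac_const :: "nat \<Rightarrow> real \<Rightarrow> real" where
  "frac_const N \<alpha> = 2 powr \<alpha> * Gamma ((real N + \<alpha>) / 2)
     / (2 * pi powr (real N / 2) * \<bar>Gamma (- \<alpha> / 2)\<bar>)"

definition mu_star :: "nat \<Rightarrow> real \<Rightarrow> real" where
  "mu_star N \<alpha> = 2 powr \<alpha> * (Gamma ((real N + \<alpha>) / 4) / Gamma ((real N - \<alpha>) / 4))\<^sup>2"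


subsection \<open>The space \<open>H\<^bsup>\<alpha>/2\<^esup>(\<real>\<^sup>N)\<close>\<close>

text \<open>
  Double integrals are taken with respect to Lebesgue measure on the Euclidean space
  \<open>\<real>\<^sup>N \<times> \<real>\<^sup>N\<close> (the completed product measure). On the null set \<open>x = y\<close> the kernel is \<open>0 / 0 = 0\<close>.
\<close>

definition gagliardo_kernel :: "real \<Rightarrow> (real^'n \<Rightarrow> real) \<Rightarrow> (real^'n) \<times> (real^'n) \<Rightarrow> real" where
  "gagliardo_kernel \<alpha> u = (\<lambda>(x, y). \<bar>u x - u y\<bar>\<^sup>2 / norm (x - y) powr (real CARD('n) + \<alpha>))"

definition gagliardo :: "real \<Rightarrow> (real^'n \<Rightarrow> real) \<Rightarrow> real" where
  "gagliardo \<alpha> u = integral\<^sup>L lebesgue (gagliardo_kernel \<alpha> u)"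

definition frac_sobolev :: "real \<Rightarrow> (real^'n \<Rightarrow> real) set" where
  "frac_sobolev \<alpha> = {u \<in> borel_measurable lebesgue.
     integrable lebesgue (\<lambda>x. \<bar>u x\<bar>\<^sup>2) \<and> integrable lebesgue (gagliardo_kernel \<alpha> u)}"

definition frac_sobolev_norm :: "real \<Rightarrow> (real^'n \<Rightarrow> real) \<Rightarrow> real" where
  "frac_sobolev_norm \<alpha> u = sqrt ((\<integral>x. \<bar>u x\<bar>\<^sup>2 \<partial>lebesgue) + gagliardo \<alpha> u)"

text \<open>\<open>L\<close> is the Frechet derivative at \<open>u\<close> of the functional \<open>J\<close> on \<open>H\<^bsup>\<alpha>/2\<^esup>\<close>.\<close>

definition has_frechet_derivative ::
  "real \<Rightarrow> ((real^'n \<Rightarrow> real) \<Rightarrow> real) \<Rightarrow> ((real^'n \<Rightarrow> real) \<Rightarrow> real) \<Rightarrow> (real^'n \<Rightarrow> real) \<Rightarrow> bool" where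
  "has_frechet_derivative \<alpha> J L u \<longleftrightarrow>
     (\<forall>v\<in>frac_sobolev \<alpha>. \<forall>w\<in>frac_sobolev \<alpha>. L (\<lambda>x. v x + w x) = L v + L w) \<and>
     (\<forall>a. \<forall>v\<in>frac_sobolev \<alpha>. L (\<lambda>x. a * v x) = a * L v) \<and>
     (\<exists>C. \<forall>v\<in>frac_sobolev \<alpha>. \<bar>L v\<bar> \<le> C * frac_sobolev_norm \<alpha> v) \<and>
     (\<forall>\<epsilon>>0. \<exists>\<delta>>0. \<forall>h\<in>frac_sobolev \<alpha>. frac_sobolev_norm \<alpha> h < \<delta> \<longrightarrow>
        \<bar>J (\<lambda>x. u x + h x) - J u - L h\<bar> \<le> \<epsilon> * frac_sobolev_norm \<alpha> h)"


subsection \<open>Assumptions on the nonlinearity and on the potentials\<close>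

definition primitive :: "(real^'n \<Rightarrow> real \<Rightarrow> real) \<Rightarrow> real^'n \<Rightarrow> real \<Rightarrow> real" where
  "primitive f x u = (LBINT s=ereal 0..ereal u. f x s)"

definition cond_F1 :: "real \<Rightarrow> real \<Rightarrow> real \<Rightarrow> (real^'n \<Rightarrow> real \<Rightarrow> real) \<Rightarrow> bool" where
  "cond_F1 \<alpha> q p f \<longleftrightarrow>
     (\<lambda>(x, u). f x u) \<in> borel_measurable lebesgue \<and>
     (\<forall>z\<in>int_lattice. \<forall>x u. f (x + z) u = f x u) \<and>
     (AE x in lebesgue. continuous_on UNIV (f x)) \<and>
     2 < q \<and> q < p \<and> p < crit_exp CARD('n) \<alpha> \<and>
     (\<exists>c>0. \<forall>x u. \<bar>f x u\<bar> \<le> c * (1 + \<bar>u\<bar> powr (p - 1)))"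

definition cond_F2 :: "(real^'n \<Rightarrow> real \<Rightarrow> real) \<Rightarrow> bool" where
  "cond_F2 f \<longleftrightarrow> uniform_limit UNIV (\<lambda>u x. f x u / \<bar>u\<bar>) (\<lambda>x. 0) (at 0)"

definition cond_F3 :: "real \<Rightarrow> (real^'n \<Rightarrow> real \<Rightarrow> real) \<Rightarrow> bool" where
  "cond_F3 q f \<longleftrightarrow> (\<forall>M. \<forall>\<^sub>F u in at_infinity. \<forall>x. M \<le> primitive f x u / \<bar>u\<bar> powr q)"

definition cond_F4 :: "real \<Rightarrow> (real^'n \<Rightarrow> real \<Rightarrow> real) \<Rightarrow> bool" where
  "cond_F4 q f \<longleftrightarrow> (\<forall>x. mono_on {..<0} (\<lambda>u. f x u / \<bar>u\<bar> powr (q - 1)) \<and>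
                        mono_on {0<..} (\<lambda>u. f x u / \<bar>u\<bar> powr (q - 1)))"

definition cond_F5 :: "real \<Rightarrow> (real^'n \<Rightarrow> real \<Rightarrow> real) \<Rightarrow> bool" where
  "cond_F5 p f \<longleftrightarrow>
     (AE x in lebesgue. f x C1_differentiable_on UNIV) \<and>
     (\<exists>r b c. 2 < r \<and> r \<le> p \<and> 0 < b \<and> 0 < c \<and>
        (AE x in lebesgue. \<forall>u. f x u * u - 2 * primitive f x u \<ge> b * \<bar>u\<bar> powr r \<and>
                               \<bar>deriv (f x) u\<bar> \<le> c * (1 + \<bar>u\<bar> powr (p - 2))))"

definition cond_K :: "(real^'n \<Rightarrow> real) \<Rightarrow> bool" where
  "cond_K K \<longleftrightarrow> K \<in> Linfty \<and> ae_periodic K \<and> (AE x in lebesgue. 0 \<le> K x)"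

text \<open>The localized part is an explicit argument, so that it can be prescribed.\<close>

definition cond_V :: "real \<Rightarrow> (real^'n \<Rightarrow> real) \<Rightarrow> (real^'n \<Rightarrow> real) \<Rightarrow> bool" where
  "cond_V \<alpha> V Vloc \<longleftrightarrow>
     V \<in> Linfty \<and>
     (\<exists>Vper\<in>Linfty. ae_periodic Vper \<and> (AE x in lebesgue. V x = Vloc x + Vper x)) \<and>
     (Vloc \<longlongrightarrow> 0) at_infinity \<and>
     Vloc \<in> borel_measurable lebesgue \<and>
     (\<exists>s \<ge> real CARD('n) / \<alpha>. integrable lebesgue (\<lambda>x. \<bar>Vloc x\<bar> powr s)) \<and>
     essinf V > 0"


subsection \<open>Energy functional, Nehari manifold and ground states\<close>

definition energy ::
  "real \<Rightarrow> (real^'n \<Rightarrow> real) \<Rightarrow> real \<Rightarrow> (real^'n \<Rightarrow> real \<Rightarrow> real) \<Rightarrow> (real^'n \<Rightarrow> real) \<Rightarrow> real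
    \<Rightarrow> (real^'n \<Rightarrow> real) \<Rightarrow> real" where
  "energy \<alpha> V \<mu> f K q u =
     frac_const CARD('n) \<alpha> / 2 * gagliardo \<alpha> u
     + 1 / 2 * (\<integral>x. V x * \<bar>u x\<bar>\<^sup>2 \<partial>lebesgue)
     - 1 / 2 * (\<integral>x. \<mu> / norm x powr \<alpha> * \<bar>u x\<bar>\<^sup>2 \<partial>lebesgue)
     - (\<integral>x. primitive f x (u x) - 1 / q * K x * \<bar>u x\<bar> powr q \<partial>lebesgue)"

definition nehari ::
  "real \<Rightarrow> (real^'n \<Rightarrow> real) \<Rightarrow> real \<Rightarrow> (real^'n \<Rightarrow> real \<Rightarrow> real) \<Rightarrow> (real^'n \<Rightarrow> real) \<Rightarrow> real
    \<Rightarrow> (real^'n \<Rightarrow> real) set" where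
  "nehari \<alpha> V \<mu> f K q = {u \<in> frac_sobolev \<alpha>. \<not> (AE x in lebesgue. u x = 0) \<and>
     (\<exists>L. has_frechet_derivative \<alpha> (energy \<alpha> V \<mu> f K q) L u \<and> L u = 0)}"

text \<open>
  A ground state solution of
  \<open>(-\<Delta>)\<^bsup>\<alpha>/2\<^esup> u + (V(x) - \<mu> / |x|\<^sup>\<alpha>) u = f(x,u) - K(x) |u|\<^bsup>q-2\<^esup> u\<close>: a critical point of the energy
  that attains the infimum over the Nehari manifold. The infimum is taken in the extended reals,
  because the infimum of a set of reals is unspecified when the set is unbounded below.
\<close>

definition ground_state ::
  "real \<Rightarrow> (real^'n \<Rightarrow> real) \<Rightarrow> real \<Rightarrow> (real^'n \<Rightarrow> real \<Rightarrow> real) \<Rightarrow> (real^'n \<Rightarrow> real) \<Rightarrow> real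
    \<Rightarrow> (real^'n \<Rightarrow> real) \<Rightarrow> bool" where
  "ground_state \<alpha> V \<mu> f K q u \<longleftrightarrow>
     u \<in> nehari \<alpha> V \<mu> f K q \<and>
     has_frechet_derivative \<alpha> (energy \<alpha> V \<mu> f K q) (\<lambda>v. 0) u \<and>
     ereal (energy \<alpha> V \<mu> f K q u) = (INF v\<in>nehari \<alpha> V \<mu> f K q. ereal (energy \<alpha> V \<mu> f K q v))"

end

theory Submission
  imports Defs
begin

text \<open>
  The parameter \<open>\<mu>\<close> enters the energy only through the Hardy term \<open>-\<mu>/2 \<integral> u\<^sup>2/|x|\<^sup>\<alpha>\<close>, which is
  \<open>O(\<mu>)\<close> on bounded subsets of \<open>H\<^bsup>\<alpha>/2\<^esup>\<close> by a fractional Hardy inequality with some constant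
  (\<open>hardy_inequality\<close>). It also breaks the invariance under lattice translations, but along the
  sequence it tends to zero, so ground states converge up to translations to one of the periodic
  limit problem.

  The monotonicity of \<open>f(x,u)/|u|\<^bsup>q-1\<^esup>\<close> gives an Ambrosetti-Rabinowitz inequality with exponent \<open>q\<close>,
  and the \<open>K\<close>-term is neutral in it because it is \<open>q\<close>-homogeneous. On the Nehari manifold the energy
  therefore equals \<open>(1/2 - 1/q)\<close> times the quadratic form plus the integral of a nonnegative function
  (\<open>J_on_nehari\<close>, \<open>ar_defect_nonneg\<close>). The same monotonicity makes the energy of a Nehari function
  maximal along its ray (\<open>J_ray_le\<close>). If \<open>v\<close> lies on the Nehari manifold for \<open>\<mu> = 0\<close>, its ray
  meets the one for \<open>\<mu>\<^sub>n\<close> in some \<open>t v\<close> (\<open>nehari_projection\<close>), and the value of the energy there for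
  \<open>\<mu>\<^sub>n\<close> is at most its value for \<open>\<mu> = 0\<close>, hence at most that at \<open>v\<close>. So the ground level for \<open>\<mu>\<^sub>n\<close>
  is bounded by the energy of every competitor of the limit problem (\<open>ground_level_le\<close>).

  The ground states are bounded by the energy identity, and their \<open>L\<^sup>p\<close> norms stay away from zero
  (\<open>nehari_lower_bound\<close>), so by Lions' lemma (\<open>concentration_on_unit_ball\<close>) lattice translates of them
  keep a fixed \<open>L\<^sup>2\<close> mass in a fixed ball. By compactness (\<open>bounded_AE_convergent_subsequence\<close>) a
  subsequence of the translates converges almost everywhere to some \<open>u0 \<noteq> 0\<close>. Passing to the limit in
  the equation, \<open>u0\<close> is critical for \<open>\<mu> = 0\<close>. Both summands of the energy identity are lower
  semicontinuous along the sequence, so the energy of \<open>u0\<close> is at most the limit of the ground levels,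
  which is at most the energy of any competitor: \<open>u0\<close> is a ground state. Comparison with \<open>u0\<close> itself
  then forces the quadratic forms to converge, and together with weak convergence this is convergence
  in norm (\<open>ground_states_converge\<close>).

  The function space theory rests on one pointwise estimate: \<open>|u(x)|\<close> is at most the average of
  \<open>|u(x) - u(y)|\<close> plus the average of \<open>|u(y)|\<close> over \<open>y\<close> in a ball near \<open>x\<close>, and the first average is
  controlled by the density of the Gagliardo energy at \<open>x\<close>. Optimizing the radius yields an embedding
  \<open>L\<^sup>a \<rightarrow> L\<^sup>b\<close> with a larger exponent whose constant becomes small with the local mass
  (\<open>embedding_step\<close>); iterating it gives both the subcritical Sobolev embedding and Lions' lemma.
  Averages over balls far from the origin give the Hardy inequality, and averages over countably many
  small balls give compactness. Weak convergence is replaced throughout by almost everywhere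
  convergence of bounded sequences (\<open>almost_dominated_convergence\<close>).
\<close>

section \<open>Square-integrable functions and passage to the limit\<close>

lemma integrable_mult_of_squares:
  fixes f g :: "'a \<Rightarrow> real"
  assumes [measurable]: "f \<in> borel_measurable M" "g \<in> borel_measurable M"
    and "integrable M (\<lambda>x. (f x)\<^sup>2)" "integrable M (\<lambda>x. (g x)\<^sup>2)"
  shows "integrable M (\<lambda>x. f x * g x)"
proof (rule Bochner_Integration.integrable_bound)
  show "integrable M (\<lambda>x. (f x)\<^sup>2 + (g x)\<^sup>2)"
    using assms by auto
  have "\<bar>a * b\<bar> \<le> a\<^sup>2 + b\<^sup>2" for a b :: real
  proof -
    have "0 \<le> (\<bar>a\<bar> - \<bar>b\<bar>)\<^sup>2 + a\<^sup>2 + b\<^sup>2" by simp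
    then show ?thesis by (simp add: power2_diff abs_mult)
  qed
  then show "AE x in M. norm (f x * g x) \<le> norm ((f x)\<^sup>2 + (g x)\<^sup>2)"
    by (intro AE_I2) simp
qed simp

lemma integrable_square_add:
  fixes f g :: "'a \<Rightarrow> real"
  assumes "f \<in> borel_measurable M" "g \<in> borel_measurable M"
    and "integrable M (\<lambda>x. (f x)\<^sup>2)" "integrable M (\<lambda>x. (g x)\<^sup>2)"
  shows "integrable M (\<lambda>x. (f x + g x)\<^sup>2)"
  using assms integrable_mult_of_squares[OF assms]
  by (simp add: power2_sum mult.assoc)

text \<open>
  A bounded sequence in \<open>L\<^sup>2\<close> that converges almost everywhere has no integrable majorant, but paired with
  a fixed function it has one up to \<open>\<epsilon>\<close> times a sequence that is bounded in \<open>L\<^sup>1\<close> (Young's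
  inequality). The part of \<open>|X n - Z|\<close> above \<open>\<epsilon> * Y n\<close> is dominated, hence negligible in the limit.
\<close>

lemma almost_dominated_convergence:
  fixes X Y :: "nat \<Rightarrow> 'a \<Rightarrow> real" and Z :: "'a \<Rightarrow> real"
  assumes X: "\<And>n. integrable M (X n)" and Z: "integrable M Z"
    and lim: "AE x in M. (\<lambda>n. X n x) \<longlonglongrightarrow> Z x"
    and Y: "\<And>n. integrable M (Y n)" and Y0: "\<And>n x. 0 \<le> Y n x" and C: "\<And>n. (\<integral>x. Y n x \<partial>M) \<le> C"
    and dom: "\<And>\<epsilon>. 0 < \<epsilon> \<Longrightarrow> \<exists>D. integrable M D \<and> (\<forall>n. AE x in M. \<bar>X n x\<bar> \<le> D x + \<epsilon> * Y n x)"
  shows "(\<lambda>n. \<integral>x. \<bar>X n x - Z x\<bar> \<partial>M) \<longlonglongrightarrow> 0"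
proof (rule LIMSEQ_I)
  fix r :: real assume r: "0 < r"
  have C0: "0 \<le> C"
    using C[of 0] integral_nonneg_AE[where M=M and f="Y 0"] Y0 by (meson AE_I2 order_trans)
  define \<epsilon> where "\<epsilon> = r / (2 * (C + 1))"
  have \<epsilon>: "\<epsilon> > 0" using r C0 by (simp add: \<epsilon>_def)
  obtain D where D: "integrable M D" "\<And>n. AE x in M. \<bar>X n x\<bar> \<le> D x + \<epsilon> * Y n x"
    using dom[OF \<epsilon>] by auto
  define W where "W n x = max 0 (\<bar>X n x - Z x\<bar> - \<epsilon> * Y n x)" for n x
  note [measurable] = X[THEN borel_measurable_integrable] Z[THEN borel_measurable_integrable]
    Y[THEN borel_measurable_integrable] D(1)[THEN borel_measurable_integrable]
  have Wint: "integrable M (W n)" for n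
    unfolding W_def using X[of n] Y[of n] Z by (intro integrable_max) auto
  have "(\<lambda>n. \<integral>x. W n x \<partial>M) \<longlonglongrightarrow> (\<integral>x. 0 \<partial>M)"
  proof (rule integral_dominated_convergence[where w="\<lambda>x. \<bar>D x\<bar> + \<bar>Z x\<bar>"])
    show "integrable M (\<lambda>x. \<bar>D x\<bar> + \<bar>Z x\<bar>)" using D Z by auto
    show "AE x in M. (\<lambda>n. W n x) \<longlonglongrightarrow> 0"
      using lim
    proof eventually_elim
      case (elim x)
      then have "(\<lambda>n. \<bar>X n x - Z x\<bar>) \<longlonglongrightarrow> 0"
        by (simp add: LIM_zero tendsto_rabs_zero)
      then show ?case
      proof (rule Lim_null_comparison[rotated])
        show "\<forall>\<^sub>F n in sequentially. norm (W n x) \<le> \<bar>X n x - Z x\<bar>"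
          using Y0 \<epsilon> by (intro always_eventually) (auto simp: W_def max_def)
      qed
    qed
    show "AE x in M. norm (W n x) \<le> \<bar>D x\<bar> + \<bar>Z x\<bar>" for n
      using D(2)[of n] by eventually_elim (auto simp: W_def max_def)
  qed (auto simp: W_def)
  then obtain N where N: "\<And>n. n \<ge> N \<Longrightarrow> \<bar>\<integral>x. W n x \<partial>M\<bar> < r / 2"
    using r LIMSEQ_D[of "\<lambda>n. \<integral>x. W n x \<partial>M" 0 "r/2"] by (simp, blast)
  show "\<exists>no. \<forall>n\<ge>no. norm ((\<integral>x. \<bar>X n x - Z x\<bar> \<partial>M) - 0) < r"
  proof (intro exI allI impI)
    fix n assume n: "N \<le> n"
    have "(\<integral>x. \<bar>X n x - Z x\<bar> \<partial>M) \<le> (\<integral>x. W n x + \<epsilon> * Y n x \<partial>M)"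
      using X Y Z Wint by (intro integral_mono) (auto simp: W_def)
    also have "\<dots> = (\<integral>x. W n x \<partial>M) + \<epsilon> * (\<integral>x. Y n x \<partial>M)"
      using Wint Y by simp
    also have "\<epsilon> * (\<integral>x. Y n x \<partial>M) \<le> \<epsilon> * C"
      using C \<epsilon> by (intro mult_left_mono) auto
    also have "\<epsilon> * C \<le> r / 2"
      using r C0 by (simp add: \<epsilon>_def field_simps)
    finally show "norm ((\<integral>x. \<bar>X n x - Z x\<bar> \<partial>M) - 0) < r"
      using N[OF n] by auto
  qed
qed

lemma almost_dominated_convergence_integral:
  fixes X Y :: "nat \<Rightarrow> 'a \<Rightarrow> real" and Z :: "'a \<Rightarrow> real"
  assumes X: "\<And>n. integrable M (X n)" and Z: "integrable M Z"
    and "AE x in M. (\<lambda>n. X n x) \<longlonglongrightarrow> Z x"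
    and "\<And>n. integrable M (Y n)" and "\<And>n x. 0 \<le> Y n x" and "\<And>n. (\<integral>x. Y n x \<partial>M) \<le> C"
    and "\<And>\<epsilon>. 0 < \<epsilon> \<Longrightarrow> \<exists>D. integrable M D \<and> (\<forall>n. AE x in M. \<bar>X n x\<bar> \<le> D x + \<epsilon> * Y n x)"
  shows "(\<lambda>n. \<integral>x. X n x \<partial>M) \<longlonglongrightarrow> (\<integral>x. Z x \<partial>M)"
proof (rule LIM_zero_cancel, rule Lim_null_comparison)
  show "(\<lambda>n. \<integral>x. \<bar>X n x - Z x\<bar> \<partial>M) \<longlonglongrightarrow> 0"
    by (rule almost_dominated_convergence[OF assms])
  show "\<forall>\<^sub>F n in sequentially. norm ((\<integral>x. X n x \<partial>M) - (\<integral>x. Z x \<partial>M)) \<le> (\<integral>x. \<bar>X n x - Z x\<bar> \<partial>M)"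
  proof (intro always_eventually allI)
    fix n
    have "(\<integral>x. X n x \<partial>M) - (\<integral>x. Z x \<partial>M) = (\<integral>x. X n x - Z x \<partial>M)" using X Z by simp
    then show "norm ((\<integral>x. X n x \<partial>M) - (\<integral>x. Z x \<partial>M)) \<le> (\<integral>x. \<bar>X n x - Z x\<bar> \<partial>M)"
      using integral_norm_bound[of M "\<lambda>x. X n x - Z x"] by simp
  qed
qed

lemma bounded_square_weak_limit:
  fixes U :: "nat \<Rightarrow> 'a \<Rightarrow> real" and u \<psi> :: "'a \<Rightarrow> real"
  assumes [measurable]: "\<And>n. U n \<in> borel_measurable M" "u \<in> borel_measurable M" "\<psi> \<in> borel_measurable M"
    and U: "\<And>n. integrable M (\<lambda>x. (U n x)\<^sup>2)" and C: "\<And>n. (\<integral>x. (U n x)\<^sup>2 \<partial>M) \<le> C"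
    and u: "integrable M (\<lambda>x. (u x)\<^sup>2)" and \<psi>: "integrable M (\<lambda>x. (\<psi> x)\<^sup>2)"
    and lim: "AE x in M. (\<lambda>n. U n x) \<longlonglongrightarrow> u x"
  shows "(\<lambda>n. \<integral>x. U n x * \<psi> x \<partial>M) \<longlonglongrightarrow> (\<integral>x. u x * \<psi> x \<partial>M)"
proof (rule almost_dominated_convergence_integral[where Y="\<lambda>n x. (U n x)\<^sup>2" and C=C])
  show "AE x in M. (\<lambda>n. U n x * \<psi> x) \<longlonglongrightarrow> u x * \<psi> x"
    using lim by eventually_elim (intro tendsto_intros)
  fix \<epsilon> :: real assume \<epsilon>: "0 < \<epsilon>"
  have young: "\<bar>a * b\<bar> \<le> b\<^sup>2 / \<epsilon> + \<epsilon> * a\<^sup>2" for a b :: real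
  proof -
    have "0 \<le> (\<epsilon> * \<bar>a\<bar> - \<bar>b\<bar>)\<^sup>2 + \<epsilon>\<^sup>2 * a\<^sup>2 + b\<^sup>2" by simp
    then have "2 * (\<epsilon> * \<bar>a * b\<bar>) \<le> 2 * (\<epsilon> * (b\<^sup>2 / \<epsilon> + \<epsilon> * a\<^sup>2))"
      using \<epsilon> by (simp add: power2_diff abs_mult power_mult_distrib algebra_simps power2_eq_square)
    then show ?thesis using \<epsilon> by simp
  qed
  show "\<exists>D. integrable M D \<and> (\<forall>n. AE x in M. \<bar>U n x * \<psi> x\<bar> \<le> D x + \<epsilon> * (U n x)\<^sup>2)"
    using \<psi> young by (intro exI[of _ "\<lambda>x. (\<psi> x)\<^sup>2 / \<epsilon>"]) auto
qed (use assms in \<open>auto intro!: integrable_mult_of_squares\<close>)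

lemma fatou_ennreal:
  fixes X :: "nat \<Rightarrow> 'a \<Rightarrow> real"
  assumes X: "\<And>n. integrable M (X n)" and X0: "\<And>n. AE x in M. 0 \<le> X n x"
    and lim: "AE x in M. (\<lambda>n. X n x) \<longlonglongrightarrow> Z x"
  shows "(\<integral>\<^sup>+x. Z x \<partial>M) \<le> liminf (\<lambda>n. ennreal (\<integral>x. X n x \<partial>M))"
proof -
  note [measurable] = X[THEN borel_measurable_integrable]
  have "(\<integral>\<^sup>+x. Z x \<partial>M) = (\<integral>\<^sup>+x. liminf (\<lambda>n. ennreal (X n x)) \<partial>M)"
  proof (rule nn_integral_cong_AE, use lim in eventually_elim)
    case (elim x)
    then show ?case using lim_imp_Liminf[OF _ tendsto_ennrealI[OF elim]] by simp
  qed
  also have "\<dots> \<le> liminf (\<lambda>n. \<integral>\<^sup>+x. X n x \<partial>M)"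
    by (intro nn_integral_liminf) auto
  also have "\<dots> = liminf (\<lambda>n. ennreal (\<integral>x. X n x \<partial>M))"
    by (simp add: nn_integral_eq_integral[OF X X0])
  finally show ?thesis .
qed

lemma fatou_integrable:
  fixes X :: "nat \<Rightarrow> 'a \<Rightarrow> real"
  assumes X: "\<And>n. integrable M (X n)" and X0: "\<And>n. AE x in M. 0 \<le> X n x"
    and Z: "Z \<in> borel_measurable M"
    and lim: "AE x in M. (\<lambda>n. X n x) \<longlonglongrightarrow> Z x"
    and bd: "\<And>n. (\<integral>x. X n x \<partial>M) \<le> C"
  shows "integrable M Z"
proof -
  have "AE x in M. \<forall>n. 0 \<le> X n x"
    using X0 by (simp add: AE_all_countable)
  with lim have Z0: "AE x in M. 0 \<le> Z x"
    by eventually_elim (auto intro: LIMSEQ_le_const)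
  have "liminf (\<lambda>n. ennreal (\<integral>x. X n x \<partial>M)) \<le> liminf (\<lambda>n. ennreal C)"
    using bd by (intro Liminf_mono always_eventually allI ennreal_leI)
  also have "\<dots> = ennreal C" by (simp add: Liminf_const)
  finally have "(\<integral>\<^sup>+x. Z x \<partial>M) \<le> ennreal C"
    using fatou_ennreal[OF X X0 lim] by (rule order_trans[rotated])
  then show ?thesis
    using Z0 Z by (intro integrableI_nonneg) (auto intro: le_less_trans)
qed

text \<open>
  Fatou's lemma as lower semicontinuity, so that lower bounds for several integrals can be added.
\<close>

lemma fatou_lower_bound:
  fixes X :: "nat \<Rightarrow> 'a \<Rightarrow> real"
  assumes X: "\<And>n. integrable M (X n)" and X0: "\<And>n. AE x in M. 0 \<le> X n x"
    and Z: "integrable M Z" and Z0: "AE x in M. 0 \<le> Z x"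
    and lim: "AE x in M. (\<lambda>n. X n x) \<longlonglongrightarrow> Z x" and \<epsilon>: "0 < \<epsilon>"
  shows "\<forall>\<^sub>F n in sequentially. (\<integral>x. Z x \<partial>M) - \<epsilon> < (\<integral>x. X n x \<partial>M)"
proof (cases "(\<integral>x. Z x \<partial>M) - \<epsilon> < 0")
  case True
  have "0 \<le> (\<integral>x. X n x \<partial>M)" for n by (rule integral_nonneg_AE[OF X0])
  with True show ?thesis by (intro always_eventually allI) (rule less_le_trans)
next
  case False
  have "ennreal ((\<integral>x. Z x \<partial>M) - \<epsilon>) < ennreal (\<integral>x. Z x \<partial>M)"
    using \<epsilon> False by (subst ennreal_less_iff) auto
  also have "\<dots> = (\<integral>\<^sup>+x. Z x \<partial>M)" by (rule nn_integral_eq_integral[OF Z Z0, symmetric])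
  finally have "\<forall>\<^sub>F n in sequentially. ennreal ((\<integral>x. Z x \<partial>M) - \<epsilon>) < ennreal (\<integral>x. X n x \<partial>M)"
    using fatou_ennreal[OF X X0 lim] by (simp add: le_Liminf_iff)
  then show ?thesis using False by (auto simp: ennreal_less_iff elim!: eventually_mono)
qed

lemma diagonal_convergent_subsequence:
  fixes a :: "nat \<Rightarrow> nat \<Rightarrow> real"
  assumes bd: "\<And>i. \<exists>C. \<forall>n. \<bar>a i n\<bar> \<le> C"
  shows "\<exists>r. strict_mono r \<and> (\<forall>i. convergent (\<lambda>n. a i (r n)))"
proof -
  interpret subseqs "\<lambda>i r. convergent (\<lambda>n. a i (r n))"
  proof
    fix i and s :: "nat \<Rightarrow> nat" assume "strict_mono s"
    obtain C where C: "\<And>n. \<bar>a i n\<bar> \<le> C" using bd[of i] by auto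
    have "bounded (range (\<lambda>n. a i (s n)))"
      using C by (auto simp: bounded_iff)
    from bounded_imp_convergent_subsequence[OF this]
    show "\<exists>r'. strict_mono r' \<and> convergent (\<lambda>n. a i ((s \<circ> r') n))"
      by (auto simp: convergent_def o_def)
  qed
  have "convergent (\<lambda>n. a i (diagseq n))" for i
  proof -
    have "convergent (\<lambda>n. a i ((diagseq \<circ> ((+) (Suc i))) n))"
    proof (rule diagseq_holds)
      fix r s :: "nat \<Rightarrow> nat" and n assume "strict_mono r" "convergent (\<lambda>k. a n (s k))"
      then show "convergent (\<lambda>k. a n ((s \<circ> r) k))"
        using convergent_subseq_convergent[of "\<lambda>k. a n (s k)" r] by (simp add: o_def)
    qed
    then have "convergent (\<lambda>n. a i (diagseq (n + Suc i)))" by (simp add: o_def add.commute)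
    then show ?thesis using convergent_ignore_initial_segment[of "\<lambda>n. a i (diagseq n)" "Suc i"] by simp
  qed
  then show ?thesis using subseq_diagseq by blast
qed


section \<open>Translations and coordinate projections of Lebesgue measure\<close>

lemma lebesgue_translation:
  fixes z :: "'a::euclidean_space"
  shows "(\<lambda>x. x + z) \<in> lebesgue \<rightarrow>\<^sub>M lebesgue" and "distr lebesgue lebesgue (\<lambda>x. x + z) = lebesgue"
proof -
  have T: "(\<lambda>x. z + (\<Sum>j\<in>Basis. (1 * (x \<bullet> j)) *\<^sub>R j)) = (\<lambda>x::'a. x + z)"
    by (simp add: euclidean_representation add.commute)
  show "(\<lambda>x. x + z) \<in> lebesgue \<rightarrow>\<^sub>M lebesgue"
    using lebesgue_affine_measurable[of "\<lambda>_. 1" z] by (simp only: T)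
  have "lebesgue = density (distr lebesgue lebesgue (\<lambda>x. x + z)) (\<lambda>_. \<Prod>j\<in>(Basis::'a set). \<bar>1::real\<bar>)"
    using lebesgue_affine_euclidean[of "\<lambda>_. 1" z] by (simp only: T)
  then show "distr lebesgue lebesgue (\<lambda>x. x + z) = lebesgue"
    by (simp add: density_1)
qed

lemma borel_measurable_translation:
  "f \<in> borel_measurable lebesgue \<Longrightarrow> (\<lambda>x. f (x + z)) \<in> borel_measurable (lebesgue :: 'a::euclidean_space measure)"
  by (rule measurable_compose[OF lebesgue_translation(1)])

lemma AE_translation:
  "(AE x in lebesgue. P x) \<Longrightarrow> (AE x in (lebesgue :: 'a::euclidean_space measure). P (x + z))"
  using AE_distrD[OF lebesgue_translation(1)[of z], of P] unfolding lebesgue_translation(2) .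

lemma integrable_translation:
  fixes f :: "'a::euclidean_space \<Rightarrow> real"
  assumes "integrable lebesgue f"
  shows "integrable lebesgue (\<lambda>x. f (x + z))"
  using integrable_distr[OF lebesgue_translation(1)[of z], of f] assms
  by (simp add: lebesgue_translation(2))

lemma integral_translation:
  fixes f :: "'a::euclidean_space \<Rightarrow> real"
  assumes "f \<in> borel_measurable lebesgue"
  shows "(\<integral>x. f (x + z) \<partial>lebesgue) = (\<integral>x. f x \<partial>lebesgue)"
  using integral_distr[OF lebesgue_translation(1)[of z], of f] assms
  by (simp add: lebesgue_translation(2))

lemma AE_lborel_fst_snd:
  fixes P :: "'a::euclidean_space \<Rightarrow> bool" and Q :: "'b::euclidean_space \<Rightarrow> bool"
  shows "(AE x in lborel. P x) \<Longrightarrow> (AE p in (lborel :: ('a \<times> 'b) measure). P (fst p))"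
    and "(AE y in lborel. Q y) \<Longrightarrow> (AE p in (lborel :: ('a \<times> 'b) measure). Q (snd p))"
proof -
  assume "AE x in lborel. P x"
  then obtain N where N: "{x. \<not> P x} \<subseteq> N" "N \<in> sets borel" "emeasure lborel N = 0"
    by (auto elim!: AE_E)
  have "emeasure (lborel \<Otimes>\<^sub>M lborel) (N \<times> (UNIV :: 'b set)) = 0"
    using N by (subst lborel.emeasure_pair_measure_Times) auto
  then have "N \<times> UNIV \<in> null_sets (lborel :: ('a \<times> 'b) measure)"
    using N by (auto simp: lborel_prod[symmetric])
  then show "AE p in (lborel :: ('a \<times> 'b) measure). P (fst p)"
    by (rule AE_I') (use N in auto)
next
  assume "AE x in lborel. Q x"
  then obtain N where N: "{x. \<not> Q x} \<subseteq> N" "N \<in> sets borel" "emeasure lborel N = 0"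
    by (auto elim!: AE_E)
  have "emeasure (lborel \<Otimes>\<^sub>M lborel) ((UNIV :: 'a set) \<times> N) = 0"
    using N by (subst lborel.emeasure_pair_measure_Times) auto
  then have "UNIV \<times> N \<in> null_sets (lborel :: ('a \<times> 'b) measure)"
    using N by (auto simp: lborel_prod[symmetric])
  then show "AE p in (lborel :: ('a \<times> 'b) measure). Q (snd p)"
    by (rule AE_I') (use N in auto)
qed

text \<open>
  The completed measure on the product is not the product of the completed measures, so this goes
  through a Borel representative and the null sets \<open>N \<times> UNIV\<close> and \<open>UNIV \<times> N\<close>.
\<close>

lemma lebesgue_measurable_fst_snd:
  fixes f :: "'a::euclidean_space \<Rightarrow> real" and g :: "'b::euclidean_space \<Rightarrow> real"
  shows "f \<in> borel_measurable lebesgue \<Longrightarrow> (\<lambda>p. f (fst p)) \<in> borel_measurable (lebesgue :: ('a \<times> 'b) measure)"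
    and "g \<in> borel_measurable lebesgue \<Longrightarrow> (\<lambda>p. g (snd p)) \<in> borel_measurable (lebesgue :: ('a \<times> 'b) measure)"
proof -
  assume "f \<in> borel_measurable lebesgue"
  then obtain f' where f': "f' \<in> borel_measurable borel" "AE x in lborel. f x = f' x"
    using completion_ex_borel_measurable_real[of f lborel] by auto
  have "(\<lambda>p. f' (fst p)) \<in> borel_measurable (lebesgue :: ('a \<times> 'b) measure)"
    using f'(1) by (intro measurable_completion) (simp add: borel_prod[symmetric])
  moreover have "AE p in (lebesgue :: ('a \<times> 'b) measure). f' (fst p) = f (fst p)"
    using AE_lborel_fst_snd(1)[OF f'(2)] by (intro AE_completion) (auto simp: eq_commute)
  ultimately show "(\<lambda>p. f (fst p)) \<in> borel_measurable (lebesgue :: ('a \<times> 'b) measure)"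
    by (rule borel_measurable_AE)
next
  assume "g \<in> borel_measurable lebesgue"
  then obtain g' where g': "g' \<in> borel_measurable borel" "AE x in lborel. g x = g' x"
    using completion_ex_borel_measurable_real[of g lborel] by auto
  have "(\<lambda>p. g' (snd p)) \<in> borel_measurable (lebesgue :: ('a \<times> 'b) measure)"
    using g'(1) by (intro measurable_completion) (simp add: borel_prod[symmetric])
  moreover have "AE p in (lebesgue :: ('a \<times> 'b) measure). g' (snd p) = g (snd p)"
    using AE_lborel_fst_snd(2)[OF g'(2)] by (intro AE_completion) (auto simp: eq_commute)
  ultimately show "(\<lambda>p. g (snd p)) \<in> borel_measurable (lebesgue :: ('a \<times> 'b) measure)"
    by (rule borel_measurable_AE)
qed


section \<open>The fractional Sobolev space\<close>

text \<open>
  The Gagliardo kernel is the square of this linear expression, so \<open>H\<^bsup>\<alpha>/2\<^esup>\<close> is handled as the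
  set of those \<open>u\<close> for which both \<open>u\<close> and its weighted difference quotient are square integrable.
\<close>

definition diff_quot :: "real \<Rightarrow> (real^'n \<Rightarrow> real) \<Rightarrow> (real^'n) \<times> (real^'n) \<Rightarrow> real" where
  "diff_quot \<alpha> u = (\<lambda>(x, y). (u x - u y) / norm (x - y) powr ((real CARD('n) + \<alpha>) / 2))"

lemma gagliardo_kernel_eq:
  fixes u :: "real^'n \<Rightarrow> real"
  shows "gagliardo_kernel \<alpha> u p = (diff_quot \<alpha> u p)\<^sup>2"
proof -
  have "(norm z powr (s / 2))\<^sup>2 = norm z powr s" for z :: "real^'n" and s
  proof (cases "z = 0")
    case False
    then show ?thesis by (simp add: powr_realpow[symmetric] powr_powr flip: powr_add add: power2_eq_square)
  qed simp
  then show ?thesis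
    by (cases p) (simp add: gagliardo_kernel_def diff_quot_def power_divide del: powr_power)
qed

lemma gagliardo_eq: "gagliardo \<alpha> u = (\<integral>p. (diff_quot \<alpha> u p)\<^sup>2 \<partial>lebesgue)"
  by (simp add: gagliardo_def gagliardo_kernel_eq[abs_def])

lemma diff_quot_add: "diff_quot \<alpha> (\<lambda>x. u x + v x) p = diff_quot \<alpha> u p + diff_quot \<alpha> v p"
  by (cases p) (simp add: diff_quot_def add_divide_distrib[symmetric])

lemma diff_quot_scale: "diff_quot \<alpha> (\<lambda>x. a * u x) p = a * diff_quot \<alpha> u p"
  by (cases p) (simp add: diff_quot_def algebra_simps diff_divide_distrib)

lemma diff_quot_translation: "diff_quot \<alpha> (\<lambda>x. u (x + z)) p = diff_quot \<alpha> u (p + (z, z))"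
  by (cases p) (simp add: diff_quot_def)

lemma borel_measurable_diff_quot:
  fixes u :: "real^'n \<Rightarrow> real"
  assumes "u \<in> borel_measurable lebesgue"
  shows "diff_quot \<alpha> u \<in> borel_measurable lebesgue"
proof -
  have [measurable]: "(\<lambda>p. u (fst p)) \<in> borel_measurable (lebesgue :: ((real^'n) \<times> (real^'n)) measure)"
    "(\<lambda>p. u (snd p)) \<in> borel_measurable (lebesgue :: ((real^'n) \<times> (real^'n)) measure)"
    using lebesgue_measurable_fst_snd assms by blast+
  have [measurable]: "(\<lambda>p. norm (fst p - snd p) powr s) \<in> borel_measurable (lebesgue :: ((real^'n) \<times> (real^'n)) measure)" for s
    by (intro measurable_completion) (simp add: borel_prod[symmetric])
  show ?thesis
    unfolding diff_quot_def case_prod_unfold by measurable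
qed

lemma borel_measurable_diff_quot_borel:
  fixes u :: "real^'n \<Rightarrow> real"
  assumes [measurable]: "u \<in> borel_measurable borel"
  shows "diff_quot \<alpha> u \<in> borel_measurable (borel \<Otimes>\<^sub>M borel)"
  unfolding diff_quot_def case_prod_unfold by measurable

lemma frac_sobolev_iff:
  "u \<in> frac_sobolev \<alpha> \<longleftrightarrow> u \<in> borel_measurable lebesgue \<and>
     integrable lebesgue (\<lambda>x. (u x)\<^sup>2) \<and> integrable lebesgue (\<lambda>p. (diff_quot \<alpha> u p)\<^sup>2)"
  by (simp add: frac_sobolev_def gagliardo_kernel_eq[abs_def])

lemma frac_sobolevD:
  assumes "u \<in> frac_sobolev \<alpha>"
  shows "u \<in> borel_measurable lebesgue" "integrable lebesgue (\<lambda>x. (u x)\<^sup>2)"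
    "integrable lebesgue (\<lambda>p. (diff_quot \<alpha> u p)\<^sup>2)" "diff_quot \<alpha> u \<in> borel_measurable lebesgue"
  using assms by (auto simp: frac_sobolev_iff borel_measurable_diff_quot)

lemma frac_sobolev_add:
  assumes "u \<in> frac_sobolev \<alpha>" "v \<in> frac_sobolev \<alpha>"
  shows "(\<lambda>x. u x + v x) \<in> frac_sobolev \<alpha>"
  using frac_sobolevD[OF assms(1)] frac_sobolevD[OF assms(2)]
  by (auto simp: frac_sobolev_iff diff_quot_add intro!: integrable_square_add)

lemma frac_sobolev_scale:
  assumes "u \<in> frac_sobolev \<alpha>"
  shows "(\<lambda>x. a * u x) \<in> frac_sobolev \<alpha>"
  using frac_sobolevD[OF assms] by (auto simp: frac_sobolev_iff diff_quot_scale power_mult_distrib)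

lemma frac_sobolev_diff:
  assumes "u \<in> frac_sobolev \<alpha>" "v \<in> frac_sobolev \<alpha>"
  shows "(\<lambda>x. u x - v x) \<in> frac_sobolev \<alpha>"
  using frac_sobolev_add[OF assms(1) frac_sobolev_scale[OF assms(2), of "-1"]] by simp

lemma frac_sobolev_translation:
  assumes "u \<in> frac_sobolev \<alpha>"
  shows "(\<lambda>x. u (x + z)) \<in> frac_sobolev \<alpha>"
  using frac_sobolevD[OF assms]
    integrable_translation[of "\<lambda>x. (u x)\<^sup>2"] integrable_translation[of "\<lambda>p. (diff_quot \<alpha> u p)\<^sup>2"]
  by (auto simp: frac_sobolev_iff diff_quot_translation intro: borel_measurable_translation)

lemma frac_sobolev_norm_nonneg: "0 \<le> frac_sobolev_norm \<alpha> u"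
  by (simp add: frac_sobolev_norm_def gagliardo_eq)

lemma frac_sobolev_norm_sq:
  "(frac_sobolev_norm \<alpha> u)\<^sup>2 = (\<integral>x. (u x)\<^sup>2 \<partial>lebesgue) + (\<integral>p. (diff_quot \<alpha> u p)\<^sup>2 \<partial>lebesgue)"
  by (simp add: frac_sobolev_norm_def gagliardo_eq)

lemma frac_sobolev_norm_scale: "frac_sobolev_norm \<alpha> (\<lambda>x. a * u x) = \<bar>a\<bar> * frac_sobolev_norm \<alpha> u"
  by (simp add: frac_sobolev_norm_def gagliardo_eq diff_quot_scale power_mult_distrib
      real_sqrt_mult flip: distrib_left)

lemma frac_sobolev_norm_sq_add:
  assumes u: "u \<in> frac_sobolev \<alpha>" and v: "v \<in> frac_sobolev \<alpha>"
  shows "(frac_sobolev_norm \<alpha> (\<lambda>x. u x + v x))\<^sup>2 \<le> 2 * (frac_sobolev_norm \<alpha> u)\<^sup>2 + 2 * (frac_sobolev_norm \<alpha> v)\<^sup>2"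
proof -
  note I = frac_sobolevD(2,3)[OF u] frac_sobolevD(2,3)[OF v] frac_sobolevD(2,3)[OF frac_sobolev_add[OF u v]]
  have sq: "(a + b)\<^sup>2 \<le> 2 * a\<^sup>2 + 2 * b\<^sup>2" for a b :: real
  proof -
    have "0 \<le> (a - b)\<^sup>2" by simp
    then show ?thesis by (simp add: power2_eq_square algebra_simps)
  qed
  have "(\<integral>x. (u x + v x)\<^sup>2 \<partial>lebesgue) \<le> (\<integral>x. 2 * (u x)\<^sup>2 + 2 * (v x)\<^sup>2 \<partial>lebesgue)"
    using I by (intro integral_mono sq) auto
  moreover have "(\<integral>y. (diff_quot \<alpha> (\<lambda>x. u x + v x) y)\<^sup>2 \<partial>lebesgue)
      \<le> (\<integral>y. 2 * (diff_quot \<alpha> u y)\<^sup>2 + 2 * (diff_quot \<alpha> v y)\<^sup>2 \<partial>lebesgue)"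
    using I by (intro integral_mono) (auto simp: diff_quot_add intro: sq)
  ultimately show ?thesis using I by (simp add: frac_sobolev_norm_sq)
qed

lemma frac_sobolev_norm_translation:
  assumes "u \<in> frac_sobolev \<alpha>"
  shows "frac_sobolev_norm \<alpha> (\<lambda>x. u (x + z)) = frac_sobolev_norm \<alpha> u"
  using frac_sobolevD[OF assms]
    integral_translation[of "\<lambda>x. (u x)\<^sup>2"] integral_translation[of "\<lambda>p. (diff_quot \<alpha> u p)\<^sup>2"]
  by (simp add: frac_sobolev_norm_def gagliardo_eq diff_quot_translation)

lemma AE_diff_quot_cong:
  fixes u v :: "real^'n \<Rightarrow> real"
  assumes "AE x in lebesgue. u x = v x"
  shows "AE p in lebesgue. diff_quot \<alpha> u p = diff_quot \<alpha> v p"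
proof (rule AE_completion)
  have *: "AE x in lborel. u x = v x" using assms by (simp add: AE_completion_iff)
  show "AE p in lborel. diff_quot \<alpha> u p = diff_quot \<alpha> v p"
    using AE_lborel_fst_snd(1)[OF *] AE_lborel_fst_snd(2)[OF *]
    by eventually_elim (simp add: diff_quot_def case_prod_unfold)
qed

lemma frac_sobolev_AE_cong:
  fixes u v :: "real^'n \<Rightarrow> real"
  assumes u: "u \<in> frac_sobolev \<alpha>" and eq: "AE x in lebesgue. u x = v x"
  shows "v \<in> frac_sobolev \<alpha>" and "(\<integral>x. (v x)\<^sup>2 \<partial>lebesgue) = (\<integral>x. (u x)\<^sup>2 \<partial>lebesgue)"
    and "gagliardo \<alpha> v = gagliardo \<alpha> u" and "frac_sobolev_norm \<alpha> v = frac_sobolev_norm \<alpha> u"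
proof -
  note u = frac_sobolevD[OF u]
  have v: "v \<in> borel_measurable lebesgue"
    using borel_measurable_AE[OF u(1) eq] .
  note [measurable] = v u(1) u(4) borel_measurable_diff_quot[OF v]
  have eq2: "AE x in lebesgue. (u x)\<^sup>2 = (v x)\<^sup>2" using eq by eventually_elim simp
  have eq3: "AE p in lebesgue. (diff_quot \<alpha> u p)\<^sup>2 = (diff_quot \<alpha> v p)\<^sup>2"
    using AE_diff_quot_cong[OF eq, of \<alpha>] by eventually_elim simp
  show "v \<in> frac_sobolev \<alpha>"
    using u v integrable_cong_AE_imp[OF u(2) _ eq2] integrable_cong_AE_imp[OF u(3) _ eq3]
    by (auto simp: frac_sobolev_iff)
  show I: "(\<integral>x. (v x)\<^sup>2 \<partial>lebesgue) = (\<integral>x. (u x)\<^sup>2 \<partial>lebesgue)"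
    using eq2 by (intro integral_cong_AE[symmetric]) auto
  show G: "gagliardo \<alpha> v = gagliardo \<alpha> u"
    unfolding gagliardo_eq using eq3 by (intro integral_cong_AE[symmetric]) auto
  show "frac_sobolev_norm \<alpha> v = frac_sobolev_norm \<alpha> u"
    using I G by (simp add: frac_sobolev_norm_def)
qed

lemma frac_sobolev_borel_representative:
  assumes "u \<in> frac_sobolev \<alpha>"
  obtains v where "v \<in> borel_measurable borel" "AE x in lebesgue. u x = v x" "v \<in> frac_sobolev \<alpha>"
proof -
  obtain v where v: "v \<in> borel_measurable borel" "AE x in lborel. u x = v x"
    using completion_ex_borel_measurable_real[OF frac_sobolevD(1)[OF assms]] by auto
  have "AE x in lebesgue. u x = v x" using v(2) by (rule AE_completion)
  then show thesis using that v(1) frac_sobolev_AE_cong(1)[OF assms] by blast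
qed

lemma frac_sobolev_norm_eq_0:
  assumes u: "u \<in> frac_sobolev \<alpha>" and "frac_sobolev_norm \<alpha> u = 0"
  shows "AE x in lebesgue. u x = 0"
proof -
  have "(\<integral>x. (u x)\<^sup>2 \<partial>lebesgue) + (\<integral>p. (diff_quot \<alpha> u p)\<^sup>2 \<partial>lebesgue) = 0"
    using assms(2) frac_sobolev_norm_sq[of \<alpha> u] by simp
  moreover have "0 \<le> (\<integral>x. (u x)\<^sup>2 \<partial>lebesgue)" "0 \<le> (\<integral>p. (diff_quot \<alpha> u p)\<^sup>2 \<partial>lebesgue)"
    by simp_all
  ultimately have "(\<integral>x. (u x)\<^sup>2 \<partial>lebesgue) = 0" by linarith
  then show ?thesis
    using integral_nonneg_eq_0_iff_AE[OF frac_sobolevD(2)[OF u]] by simp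
qed

text \<open>
  The squared Gagliardo seminorm is the integral over \<open>x\<close> of the contribution of the pairs with first
  entry \<open>x\<close>. Pointwise bounds of \<open>u x\<close> by this density are the source of all embeddings below.
\<close>

definition energy_density :: "real \<Rightarrow> (real^'n \<Rightarrow> real) \<Rightarrow> real^'n \<Rightarrow> real" where
  "energy_density \<alpha> u x = (\<integral>y. (diff_quot \<alpha> u (x, y))\<^sup>2 \<partial>lborel)"

lemma energy_density_nonneg: "0 \<le> energy_density \<alpha> u x"
  by (simp add: energy_density_def)

lemma energy_density_integral:
  fixes u :: "real^'n \<Rightarrow> real"
  assumes u: "u \<in> frac_sobolev \<alpha>" and [measurable]: "u \<in> borel_measurable borel"
  shows "AE x in lborel. integrable lborel (\<lambda>y. (diff_quot \<alpha> u (x, y))\<^sup>2)"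
    and "integrable lborel (energy_density \<alpha> u)"
    and "(\<integral>x. energy_density \<alpha> u x \<partial>lborel) = gagliardo \<alpha> u"
proof -
  have m: "(\<lambda>p. (diff_quot \<alpha> u p)\<^sup>2) \<in> borel_measurable borel"
    using borel_measurable_diff_quot_borel[of u \<alpha>] by (simp add: borel_prod)
  have "integrable lborel (\<lambda>p. (diff_quot \<alpha> u p)\<^sup>2)"
    using frac_sobolevD(3)[OF u] m by (simp add: integrable_completion)
  then have I: "integrable (lborel \<Otimes>\<^sub>M lborel) (\<lambda>p. (diff_quot \<alpha> u p)\<^sup>2)"
    by (simp add: lborel_prod)
  show "AE x in lborel. integrable lborel (\<lambda>y. (diff_quot \<alpha> u (x, y))\<^sup>2)"
    using lborel_pair.AE_integrable_fst'[OF I] .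
  show "integrable lborel (energy_density \<alpha> u)"
    using lborel_pair.integrable_fst'[OF I] by (simp add: energy_density_def[abs_def])
  show "(\<integral>x. energy_density \<alpha> u x \<partial>lborel) = gagliardo \<alpha> u"
    using lborel_pair.integral_fst'[OF I] m
    by (simp add: energy_density_def gagliardo_eq lborel_prod integral_completion)
qed

text \<open>
  For \<open>y\<close> at distance at most \<open>d\<close> from \<open>x\<close> the kernel weighs \<open>(u x - u y)\<^sup>2\<close> by at least
  \<open>d\<^bsup>-(N+\<alpha>)\<^esup>\<close>. The set \<open>D\<close> will be a ball that need not be centred at \<open>x\<close>.
\<close>

lemma sq_diff_integral_le:
  fixes u :: "real^'n \<Rightarrow> real"
  assumes \<alpha>: "0 < \<alpha>" and [measurable]: "u \<in> borel_measurable borel" "D \<in> sets borel"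
    and I: "integrable lborel (\<lambda>y. (diff_quot \<alpha> u (x, y))\<^sup>2)"
    and d: "\<And>y. y \<in> D \<Longrightarrow> norm (x - y) \<le> d"
  shows "integrable lborel (\<lambda>y. indicator D y * (u x - u y)\<^sup>2)"
    and "(\<integral>y. indicator D y * (u x - u y)\<^sup>2 \<partial>lborel) \<le> d powr (real CARD('n) + \<alpha>) * energy_density \<alpha> u x"
proof -
  let ?s = "real CARD('n) + \<alpha>"
  have le: "indicator D y * (u x - u y)\<^sup>2 \<le> d powr ?s * (diff_quot \<alpha> u (x, y))\<^sup>2" for y
  proof (cases "y \<in> D \<and> x \<noteq> y")
    case True
    then have pos: "0 < norm (x - y) powr ?s" by simp
    have "(u x - u y)\<^sup>2 = norm (x - y) powr ?s * ((u x - u y)\<^sup>2 / norm (x - y) powr ?s)"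
      using pos by simp
    also have "\<dots> \<le> d powr ?s * ((u x - u y)\<^sup>2 / norm (x - y) powr ?s)"
      using True d \<alpha> by (intro mult_right_mono powr_mono2) auto
    also have "(u x - u y)\<^sup>2 / norm (x - y) powr ?s = (diff_quot \<alpha> u (x, y))\<^sup>2"
      using gagliardo_kernel_eq[of \<alpha> u "(x, y)"] by (simp add: gagliardo_kernel_def)
    finally show ?thesis using True by simp
  qed auto
  have I': "integrable lborel (\<lambda>y. d powr ?s * (diff_quot \<alpha> u (x, y))\<^sup>2)"
    using I by simp
  show J: "integrable lborel (\<lambda>y. indicator D y * (u x - u y)\<^sup>2)"
    by (rule Bochner_Integration.integrable_bound[OF I'])
       (use le in \<open>auto intro!: AE_I2 order_trans[OF le]\<close>)
  show "(\<integral>y. indicator D y * (u x - u y)\<^sup>2 \<partial>lborel) \<le> d powr ?s * energy_density \<alpha> u x"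
    using integral_mono[OF J I' le] by (simp add: energy_density_def)
qed


section \<open>Subcritical embeddings and vanishing\<close>

lemma frac_sobolev_borelD:
  assumes u: "u \<in> frac_sobolev \<alpha>" and [measurable]: "u \<in> borel_measurable borel"
  shows "integrable lborel (\<lambda>x. (u x)\<^sup>2)"
    and "(\<integral>x. (u x)\<^sup>2 \<partial>lborel) + (\<integral>x. energy_density \<alpha> u x \<partial>lborel) = (frac_sobolev_norm \<alpha> u)\<^sup>2"
  using frac_sobolevD(2)[OF u] energy_density_integral[OF assms]
  by (simp_all add: integrable_completion integral_completion frac_sobolev_norm_sq gagliardo_eq)

lemma L2_le_frac_sobolev_norm:
  assumes u: "u \<in> frac_sobolev \<alpha>" and R: "frac_sobolev_norm \<alpha> u \<le> R"
  shows "(\<integral>x. (u x)\<^sup>2 \<partial>lebesgue) \<le> R\<^sup>2" and "gagliardo \<alpha> u \<le> R\<^sup>2"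
proof -
  have "(frac_sobolev_norm \<alpha> u)\<^sup>2 \<le> R\<^sup>2" using R frac_sobolev_norm_nonneg by (intro power_mono)
  moreover have "0 \<le> gagliardo \<alpha> u" "0 \<le> (\<integral>x. (u x)\<^sup>2 \<partial>lebesgue)" by (simp_all add: gagliardo_eq)
  ultimately show "(\<integral>x. (u x)\<^sup>2 \<partial>lebesgue) \<le> R\<^sup>2" "gagliardo \<alpha> u \<le> R\<^sup>2"
    unfolding frac_sobolev_norm_sq gagliardo_eq by linarith+
qed

lemma powr_interpolation:
  fixes x s p a :: real
  assumes "0 \<le> x" "0 < s" "2 \<le> p" "p \<le> a"
  shows "x powr p \<le> s powr (p - 2) * x\<^sup>2 + s powr (p - a) * x powr a"
proof (cases "x = 0")
  case False
  with assms have x: "0 < x" by simp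
  show ?thesis
  proof (cases "x \<le> s")
    case True
    have "x powr p = x powr (p - 2) * x\<^sup>2"
      using x powr_add[of x "p - 2" 2] by simp
    also have "\<dots> \<le> s powr (p - 2) * x\<^sup>2"
      using True x assms by (intro mult_right_mono powr_mono2) auto
    finally show ?thesis by (simp add: add_increasing2)
  next
    case False
    have "x powr p = x powr (p - a) * x powr a"
      using x by (simp flip: powr_add)
    also have "\<dots> \<le> s powr (p - a) * x powr a"
      using False x assms by (intro mult_right_mono powr_mono2') auto
    finally show ?thesis by (simp add: add_increasing)
  qed
qed simp

text \<open>A version of Young's inequality; after averaging and optimizing \<open>s\<close> it does the work of Jensen's inequality.\<close>

lemma abs_le_plus_powr:
  fixes x s a :: real
  assumes "0 < s" "1 \<le> a"
  shows "\<bar>x\<bar> \<le> s + s powr (1 - a) * \<bar>x\<bar> powr a"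
proof (cases "\<bar>x\<bar> \<le> s")
  case False
  then have x: "0 < \<bar>x\<bar>" using assms by linarith
  have "\<bar>x\<bar> = \<bar>x\<bar> powr (1 - a) * \<bar>x\<bar> powr a"
    using x by (simp flip: powr_add)
  also have "\<dots> \<le> s powr (1 - a) * \<bar>x\<bar> powr a"
    using False assms by (intro mult_right_mono powr_mono2') auto
  finally show ?thesis using assms by linarith
qed (simp add: add_increasing2)

abbreviation unit_ball_mass :: "real \<Rightarrow> (real^'n \<Rightarrow> real) \<Rightarrow> real^'n \<Rightarrow> real" where
  "unit_ball_mass a u x \<equiv> (\<integral>y. indicator (ball x 1) y * \<bar>u y\<bar> powr a \<partial>lborel)"

text \<open>
  Averaging \<open>|u x| \<le> |u x - u y| + |u y|\<close> over the ball of radius \<open>t\<close>: the first term grows and the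
  second decays in \<open>t\<close>. The levels \<open>s\<close> and \<open>r\<close> at which the preceding inequality is applied are the
  values that make its two summands equal after averaging.
\<close>

lemma abs_bound_by_local_averages:
  fixes u :: "real^'n \<Rightarrow> real"
  assumes \<alpha>: "0 < \<alpha>" and [measurable]: "u \<in> borel_measurable borel"
    and I: "integrable lborel (\<lambda>y. (diff_quot \<alpha> u (x, y))\<^sup>2)"
    and t: "0 < t" "t \<le> 1" and m: "0 < m" and a: "1 \<le> a" and E: "0 < E" "energy_density \<alpha> u x \<le> E"
    and Iu: "integrable lborel (\<lambda>y. \<bar>u y\<bar> powr a)"
    and mu: "unit_ball_mass a u x \<le> m"
  defines "\<omega> \<equiv> unit_ball_vol (real CARD('n))"
  shows "\<bar>u x\<bar> \<le> 2 * sqrt (t powr \<alpha> * E / \<omega>) + 2 * (m / (\<omega> * t ^ CARD('n))) powr (1 / a)"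
proof -
  let ?B = "ball x t"
  define b where "b = \<omega> * t ^ CARD('n)"
  have \<omega>: "0 < \<omega>" unfolding \<omega>_def by (rule unit_ball_vol_pos) simp
  have b: "0 < b" using \<omega> t by (simp add: b_def)
  have vol: "measure lborel ?B = b"
    using content_ball[of t x] t by (simp add: b_def \<omega>_def)
  define s where "s = sqrt (t powr \<alpha> * E / \<omega>)"
  define r where "r = (m / b) powr (1 / a)"
  have s: "0 < s" using t E \<omega> by (simp add: s_def)
  have r: "0 < r" using m b by (simp add: r_def)
  have fin: "emeasure lborel ?B < \<infinity>" using emeasure_bounded_finite[OF bounded_ball, of x t] by simp
  have Iind: "integrable lborel (indicator ?B :: _ \<Rightarrow> real)"
    using fin by simp
  have Iu': "integrable lborel (\<lambda>y. indicator A y * \<bar>u y\<bar> powr a)" if "A \<in> sets borel" for A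
    by (rule Bochner_Integration.integrable_bound[OF Iu]) (use that in \<open>auto simp: indicator_def\<close>)
  have J: "integrable lborel (\<lambda>y. indicator ?B y * (u x - u y)\<^sup>2)"
    and K: "(\<integral>y. indicator ?B y * (u x - u y)\<^sup>2 \<partial>lborel) \<le> t powr (real CARD('n) + \<alpha>) * energy_density \<alpha> u x"
    using sq_diff_integral_le[OF \<alpha> _ _ I, of ?B t] by (auto simp: dist_norm)
  have "b * \<bar>u x\<bar> = (\<integral>y. indicator ?B y * \<bar>u x\<bar> \<partial>lborel)"
    using vol by simp
  also have "\<dots> \<le> (\<integral>y. (s + r) * indicator ?B y + (1 / s) * (indicator ?B y * (u x - u y)\<^sup>2)
                      + r powr (1 - a) * (indicator ?B y * \<bar>u y\<bar> powr a) \<partial>lborel)"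
  proof (rule integral_mono)
    fix y
    have "\<bar>u x - u y\<bar> \<le> s + (1 / s) * (u x - u y)\<^sup>2"
      using abs_le_plus_powr[OF s, of 2 "u x - u y"] s by (simp add: powr_minus_divide powr_numeral)
    moreover have "\<bar>u y\<bar> \<le> r + r powr (1 - a) * \<bar>u y\<bar> powr a"
      using abs_le_plus_powr[OF r a] .
    ultimately show "indicator ?B y * \<bar>u x\<bar> \<le> (s + r) * indicator ?B y
       + (1 / s) * (indicator ?B y * (u x - u y)\<^sup>2) + r powr (1 - a) * (indicator ?B y * \<bar>u y\<bar> powr a)"
      by (auto simp: indicator_def)
  qed (use Iind Iu'[of ?B] J in auto)
  also have "\<dots> = (s + r) * b + (1 / s) * (\<integral>y. indicator ?B y * (u x - u y)\<^sup>2 \<partial>lborel)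
      + r powr (1 - a) * (\<integral>y. indicator ?B y * \<bar>u y\<bar> powr a \<partial>lborel)"
    using Iind Iu'[of ?B] J vol by simp
  also have "\<dots> \<le> (s + r) * b + (1 / s) * (t powr (real CARD('n) + \<alpha>) * E) + r powr (1 - a) * m"
  proof (intro add_mono mult_left_mono order_refl)
    show "(\<integral>y. indicator ?B y * (u x - u y)\<^sup>2 \<partial>lborel) \<le> t powr (real CARD('n) + \<alpha>) * E"
      using K E(2) t by (meson mult_left_mono order_trans powr_ge_zero)
    have "(\<integral>y. indicator ?B y * \<bar>u y\<bar> powr a \<partial>lborel) \<le> unit_ball_mass a u x"
      using t by (intro integral_mono Iu') (auto simp: indicator_def)
    then show "(\<integral>y. indicator ?B y * \<bar>u y\<bar> powr a \<partial>lborel) \<le> m" using mu by linarith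
  qed (use s r in auto)
  also have "(1 / s) * (t powr (real CARD('n) + \<alpha>) * E) = s * b"
  proof -
    have "s * s = t powr \<alpha> * E / \<omega>"
      using t E \<omega> by (simp add: s_def)
    then have "s * s * b = t powr (real CARD('n) + \<alpha>) * E"
      using \<omega> t by (simp add: b_def powr_add powr_realpow)
    then show ?thesis using s by (simp add: field_simps)
  qed
  also have "r powr (1 - a) * m = r * b"
  proof -
    have "r powr a = m / b" using m b a by (simp add: r_def powr_powr)
    then have "m = r powr a * b" using b by simp
    then have "r powr (1 - a) * m = (r powr (1 - a) * r powr a) * b" by simp
    then show ?thesis using r by (simp flip: powr_add)
  qed
  finally have "b * \<bar>u x\<bar> \<le> b * (2 * s + 2 * r)" by (simp add: algebra_simps)
  with b have "\<bar>u x\<bar> \<le> 2 * s + 2 * r" by (rule mult_left_le_imp_le[rotated])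
  then show ?thesis by (simp add: s_def r_def b_def)
qed

text \<open>
  The two terms of the preceding bound balance for \<open>t\<^bsup>\<alpha>/2 + N/a\<^esup> = m\<^bsup>1/a\<^esup> / sqrt E\<close>, and then their
  common value has \<open>b\<close>-th power \<open>E m\<^bsup>\<alpha>/N\<^esup>\<close>, linear in the energy density. If that \<open>t\<close> exceeds \<open>1\<close>,
  the radius \<open>1\<close> bounds \<open>u x\<close> by a multiple of \<open>m\<^bsup>1/a\<^esup>\<close>, and two of the \<open>b\<close> factors are kept as \<open>(u x)\<^sup>2\<close>.
\<close>

lemma powr_bound_by_density:
  fixes u :: "real^'n \<Rightarrow> real"
  assumes \<alpha>: "0 < \<alpha>" and um: "u \<in> borel_measurable borel"
    and I: "integrable lborel (\<lambda>y. (diff_quot \<alpha> u (x, y))\<^sup>2)"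
    and m: "0 < m" and a: "1 \<le> a"
    and Iu: "integrable lborel (\<lambda>y. \<bar>u y\<bar> powr a)"
    and mu: "unit_ball_mass a u x \<le> m"
  defines "\<omega> \<equiv> unit_ball_vol (real CARD('n))" and "b \<equiv> 2 + \<alpha> * a / real CARD('n)"
  defines "A \<equiv> 2 / sqrt \<omega> + 2 * (1 / \<omega>) powr (1 / a)"
  shows "\<bar>u x\<bar> powr b \<le> (A powr b + A powr (b - 2)) * m powr (\<alpha> / real CARD('n)) * (energy_density \<alpha> u x + (u x)\<^sup>2)"
proof -
  let ?N = "real CARD('n)"
  have N: "0 < ?N" by simp
  have \<omega>: "0 < \<omega>" unfolding \<omega>_def by (rule unit_ball_vol_pos) simp
  have A: "0 < A" using \<omega> by (simp add: A_def add_pos_pos)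
  have b: "2 < b" using \<alpha> a N by (simp add: b_def)
  have est: "\<bar>u x\<bar> \<le> A * R"
    if t: "0 < t" "t \<le> 1" and E: "0 < E" "energy_density \<alpha> u x \<le> E"
      and R1: "t powr (\<alpha> / 2) * sqrt E \<le> R" and R2: "t powr (- ?N / a) * m powr (1 / a) \<le> R" for t E R
  proof -
    have "\<bar>u x\<bar> \<le> 2 * sqrt (t powr \<alpha> * E / \<omega>) + 2 * (m / (\<omega> * t ^ CARD('n))) powr (1 / a)"
      using abs_bound_by_local_averages[OF \<alpha> um I t m a E Iu mu] by (simp add: \<omega>_def)
    also have "sqrt (t powr \<alpha> * E / \<omega>) = (t powr (\<alpha> / 2) * sqrt E) / sqrt \<omega>"
      using t by (simp add: real_sqrt_mult real_sqrt_divide powr_half_sqrt[symmetric] powr_powr)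
    also have "(m / (\<omega> * t ^ CARD('n))) powr (1 / a) = (1 / \<omega>) powr (1 / a) * (t powr (- ?N / a) * m powr (1 / a))"
    proof -
      have "m / (\<omega> * t ^ CARD('n)) = (1 / \<omega>) * (t powr (- ?N) * m)"
        using t \<omega> by (simp add: powr_minus powr_realpow field_simps)
      also have "\<dots> powr (1 / a) = (1 / \<omega>) powr (1 / a) * (t powr (- ?N / a) * m powr (1 / a))"
        by (simp only: powr_mult powr_powr) simp
      finally show ?thesis .
    qed
    also have "2 * ((t powr (\<alpha> / 2) * sqrt E) / sqrt \<omega>) + 2 * ((1 / \<omega>) powr (1 / a) * (t powr (- ?N / a) * m powr (1 / a)))
        \<le> 2 * (R / sqrt \<omega>) + 2 * ((1 / \<omega>) powr (1 / a) * R)"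
      using \<omega> R1 R2 by (intro add_mono mult_left_mono divide_right_mono) auto
    also have "\<dots> = A * R" by (simp add: A_def algebra_simps)
    finally show ?thesis .
  qed
  have e0: "0 \<le> energy_density \<alpha> u x" by (rule energy_density_nonneg)
  have mp: "0 < m powr (\<alpha> / ?N)" using m by simp
  show ?thesis
  proof (cases "m powr (2 / a) < energy_density \<alpha> u x")
    case True
    let ?E = "energy_density \<alpha> u x"
    have "0 < m powr (2 / a)" using m by simp
    with True have E: "0 < ?E" by linarith
    define k where "k = \<alpha> / 2 + ?N / a"
    have k: "0 < k" using \<alpha> a N by (simp add: k_def add_pos_pos)
    define P Q where "P = ln m / a" and "Q = ln ?E / 2"
    have PQ: "P < Q"
    proof -
      have "ln (m powr (2 / a)) < ln ?E" using True m E by (subst ln_less_cancel_iff) auto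
      then show ?thesis using m by (simp add: P_def Q_def ln_powr mult.commute)
    qed
    define t where "t = exp ((P - Q) / k)"
    have t: "0 < t" "t \<le> 1" using PQ k by (auto simp: t_def divide_nonpos_pos)
    define \<rho> where "\<rho> = (\<alpha> / 2) * ((P - Q) / k) + Q"
    have E': "?E = exp (2 * Q)" using E by (simp add: Q_def)
    have m': "m = exp (a * P)" using m a by (simp add: P_def)
    have R1: "t powr (\<alpha> / 2) * sqrt ?E = exp \<rho>"
    proof -
      have "sqrt ?E = exp Q" by (simp add: E' exp_double)
      then show ?thesis by (simp add: powr_def t_def \<rho>_def exp_add)
    qed
    have R2: "t powr (- ?N / a) * m powr (1 / a) = exp \<rho>"
    proof -
      have "- ?N / a * ((P - Q) / k) + P = \<rho>"
      proof -
        have "(\<alpha> / 2 + ?N / a) * ((P - Q) / k) = P - Q"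
          using k by (simp add: k_def[symmetric])
        then show ?thesis by (simp add: \<rho>_def algebra_simps)
      qed
      moreover have "m powr (1 / a) = exp P" using a by (simp add: powr_def m')
      moreover have "t powr (- ?N / a) = exp (- ?N / a * ((P - Q) / k))" by (simp add: powr_def t_def)
      ultimately show ?thesis by (simp flip: exp_add)
    qed
    have "\<bar>u x\<bar> \<le> A * exp \<rho>"
      by (rule est[OF t E order_refl]) (use R1 R2 in auto)
    then have "\<bar>u x\<bar> powr b \<le> (A * exp \<rho>) powr b"
      using b by (intro powr_mono2) auto
    also have "\<dots> = A powr b * exp (b * \<rho>)"
      using A by (simp add: powr_mult exp_powr_real mult.commute)
    also have "b * \<rho> = (\<alpha> / ?N) * (a * P) + 2 * Q"
    proof -
      have bk: "b = (2 * a / ?N) * k" using a N by (simp add: b_def k_def field_simps)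
      have "k * \<rho> = (\<alpha> / 2) * (P - Q) + k * Q"
        using k by (simp add: \<rho>_def field_simps)
      also have "\<dots> = (\<alpha> / 2) * P + (?N / a) * Q" by (simp add: k_def algebra_simps diff_divide_distrib)
      finally have "b * \<rho> = (2 * a / ?N) * ((\<alpha> / 2) * P + (?N / a) * Q)" by (simp add: bk)
      also have "\<dots> = (2 * a / ?N) * ((\<alpha> / 2) * P) + (2 * a / ?N) * ((?N / a) * Q)"
        by (rule distrib_left)
      also have "\<dots> = (\<alpha> / ?N) * (a * P) + 2 * Q" using a N by simp
      finally show ?thesis .
    qed
    also have "exp ((\<alpha> / ?N) * (a * P) + 2 * Q) = m powr (\<alpha> / ?N) * ?E"
      using m a by (simp add: exp_add E' powr_def P_def)
    also have "A powr b * (m powr (\<alpha> / ?N) * ?E) = A powr b * m powr (\<alpha> / ?N) * ?E" by simp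
    also have "\<dots> \<le> (A powr b + A powr (b - 2)) * m powr (\<alpha> / ?N) * (?E + (u x)\<^sup>2)"
      using e0 by (intro mult_mono) auto
    finally show ?thesis .
  next
    case False
    have "\<bar>u x\<bar> \<le> A * m powr (1 / a)"
    proof (rule est[of 1 "m powr (2 / a)"])
      have "sqrt (m powr (2 / a)) = m powr (1 / a)"
        using m by (simp add: powr_half_sqrt[symmetric] powr_powr)
      then show "1 powr (\<alpha> / 2) * sqrt (m powr (2 / a)) \<le> m powr (1 / a)" by simp
    qed (use False m in auto)
    then have "\<bar>u x\<bar> powr (b - 2) \<le> (A * m powr (1 / a)) powr (b - 2)"
      using b by (intro powr_mono2) auto
    also have "\<dots> = A powr (b - 2) * m powr (\<alpha> / ?N)"
      using A a m by (simp add: powr_mult powr_powr b_def)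
    finally have "\<bar>u x\<bar> powr (b - 2) * (u x)\<^sup>2 \<le> A powr (b - 2) * m powr (\<alpha> / ?N) * (u x)\<^sup>2"
      by (rule mult_right_mono) simp
    moreover have "\<bar>u x\<bar> powr b = \<bar>u x\<bar> powr (b - 2) * (u x)\<^sup>2"
    proof (cases "u x = 0")
      case False
      then show ?thesis using powr_add[of "\<bar>u x\<bar>" "b - 2" 2] by simp
    qed (use b in simp)
    moreover have "A powr (b - 2) * m powr (\<alpha> / ?N) * (u x)\<^sup>2
        \<le> (A powr b + A powr (b - 2)) * m powr (\<alpha> / ?N) * (energy_density \<alpha> u x + (u x)\<^sup>2)"
      using e0 by (intro mult_mono) auto
    ultimately show ?thesis by linarith
  qed
qed

text \<open>
  One step of the embedding ladder: control of \<open>|u|\<^sup>a\<close> on unit balls yields control of \<open>|u|\<^sup>b\<close> on the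
  whole space. The power of \<open>m\<close> on the right serves twice: with \<open>m\<close> bounded the step raises the
  exponent, and with \<open>m\<close> small it shows that functions that vanish locally uniformly tend to \<open>0\<close>.
\<close>

lemma embedding_step:
  fixes \<alpha> a :: real
  assumes \<alpha>: "0 < \<alpha>" and a: "1 \<le> a"
  defines "b \<equiv> 2 + \<alpha> * a / real CARD('n)"
  shows "\<exists>C>0. \<forall>(u :: real^'n \<Rightarrow> real) m. u \<in> frac_sobolev \<alpha> \<longrightarrow> u \<in> borel_measurable borel \<longrightarrow> 0 < m \<longrightarrow>
      integrable lborel (\<lambda>y. \<bar>u y\<bar> powr a) \<longrightarrow>
      (\<forall>x. unit_ball_mass a u x \<le> m) \<longrightarrow>
      integrable lborel (\<lambda>y. \<bar>u y\<bar> powr b) \<and>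
      (\<integral>y. \<bar>u y\<bar> powr b \<partial>lborel) \<le> C * m powr (\<alpha> / real CARD('n)) * (frac_sobolev_norm \<alpha> u)\<^sup>2"
proof -
  define \<omega> where "\<omega> = unit_ball_vol (real CARD('n))"
  define A where "A = 2 / sqrt \<omega> + 2 * (1 / \<omega>) powr (1 / a)"
  define C where "C = A powr b + A powr (b - 2)"
  have \<omega>: "0 < \<omega>" unfolding \<omega>_def by (rule unit_ball_vol_pos) simp
  have A: "0 < A" using \<omega> by (simp add: A_def add_pos_pos)
  show ?thesis
  proof (intro exI[of _ C] conjI allI impI)
    show "0 < C" using A by (simp add: C_def add_pos_pos)
    fix u :: "real^'n \<Rightarrow> real" and m
    assume u: "u \<in> frac_sobolev \<alpha>" and um[measurable]: "u \<in> borel_measurable borel" and m: "0 < m"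
      and Iu: "integrable lborel (\<lambda>y. \<bar>u y\<bar> powr a)"
      and mu: "\<forall>x. unit_ball_mass a u x \<le> m"
    let ?M = "C * m powr (\<alpha> / real CARD('n))"
    have le: "AE x in lborel. \<bar>u x\<bar> powr b \<le> ?M * (energy_density \<alpha> u x + (u x)\<^sup>2)"
      using energy_density_integral(1)[OF u um]
    proof eventually_elim
      case (elim x)
      from powr_bound_by_density[OF \<alpha> um elim m a Iu mu[rule_format]]
      show ?case by (simp add: C_def A_def \<omega>_def b_def)
    qed
    have I: "integrable lborel (\<lambda>x. ?M * (energy_density \<alpha> u x + (u x)\<^sup>2))"
      using energy_density_integral(2)[OF u um] frac_sobolev_borelD(1)[OF u um] by simp
    show J: "integrable lborel (\<lambda>y. \<bar>u y\<bar> powr b)"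
      by (rule Bochner_Integration.integrable_bound[OF I]) (use le in \<open>auto elim!: eventually_mono\<close>)
    have "(\<integral>y. \<bar>u y\<bar> powr b \<partial>lborel) \<le> (\<integral>x. ?M * (energy_density \<alpha> u x + (u x)\<^sup>2) \<partial>lborel)"
      by (rule integral_mono_AE[OF J I le])
    also have "\<dots> = ?M * (frac_sobolev_norm \<alpha> u)\<^sup>2"
      using energy_density_integral(2)[OF u um] frac_sobolev_borelD[OF u um] by simp
    finally show "(\<integral>y. \<bar>u y\<bar> powr b \<partial>lborel) \<le> ?M * (frac_sobolev_norm \<alpha> u)\<^sup>2" .
  qed
qed

text \<open>
  The iterates from \<open>2\<close> of \<open>a \<mapsto> 2 + \<alpha> a / N\<close>, a contraction for \<open>\<alpha> < N\<close> whose fixed point is the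
  critical exponent.
\<close>

definition ladder_exp :: "nat \<Rightarrow> real \<Rightarrow> nat \<Rightarrow> real" where
  "ladder_exp N \<alpha> j = crit_exp N \<alpha> - (\<alpha> / real N) ^ j * (crit_exp N \<alpha> - 2)"

lemma ladder_exp:
  assumes \<alpha>: "0 < \<alpha>" "\<alpha> < real N"
  shows "ladder_exp N \<alpha> 0 = 2" and "ladder_exp N \<alpha> (Suc j) = 2 + \<alpha> * ladder_exp N \<alpha> j / real N"
    and "2 \<le> ladder_exp N \<alpha> j" and "ladder_exp N \<alpha> \<longlonglongrightarrow> crit_exp N \<alpha>"
proof -
  have c: "crit_exp N \<alpha> = 2 + \<alpha> * crit_exp N \<alpha> / real N"
    using \<alpha> by (simp add: crit_exp_def field_simps)
  have c2: "2 \<le> crit_exp N \<alpha>"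
    using \<alpha> by (simp add: crit_exp_def field_simps)
  have r: "0 \<le> \<alpha> / real N" "\<alpha> / real N < 1" using \<alpha> by auto
  show "ladder_exp N \<alpha> 0 = 2" by (simp add: ladder_exp_def)
  have "ladder_exp N \<alpha> (Suc j) = crit_exp N \<alpha> - (\<alpha> / real N) * (crit_exp N \<alpha> - ladder_exp N \<alpha> j)"
    by (simp add: ladder_exp_def)
  also have "\<dots> = 2 + \<alpha> * ladder_exp N \<alpha> j / real N"
    by (subst (1) c) (simp add: algebra_simps diff_divide_distrib)
  finally show "ladder_exp N \<alpha> (Suc j) = 2 + \<alpha> * ladder_exp N \<alpha> j / real N" .
  have "(\<alpha> / real N) ^ j * (crit_exp N \<alpha> - 2) \<le> 1 * (crit_exp N \<alpha> - 2)"
    using r c2 by (intro mult_right_mono power_le_one) auto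
  then show "2 \<le> ladder_exp N \<alpha> j" by (simp add: ladder_exp_def)
  have "(\<lambda>j. crit_exp N \<alpha> - (\<alpha> / real N) ^ j * (crit_exp N \<alpha> - 2)) \<longlonglongrightarrow> crit_exp N \<alpha> - 0 * (crit_exp N \<alpha> - 2)"
    using r by (intro tendsto_intros LIMSEQ_power_zero) auto
  then show "ladder_exp N \<alpha> \<longlonglongrightarrow> crit_exp N \<alpha>" by (simp add: ladder_exp_def[abs_def])
qed

lemma sobolev_ladder:
  fixes \<alpha> :: real
  assumes \<alpha>: "0 < \<alpha>" "\<alpha> < real CARD('n)"
  shows "\<exists>S\<ge>0. \<forall>u :: real^'n \<Rightarrow> real. u \<in> frac_sobolev \<alpha> \<longrightarrow> u \<in> borel_measurable borel \<longrightarrow> frac_sobolev_norm \<alpha> u \<le> R \<longrightarrow>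
      integrable lborel (\<lambda>y. \<bar>u y\<bar> powr ladder_exp CARD('n) \<alpha> j) \<and>
      (\<integral>y. \<bar>u y\<bar> powr ladder_exp CARD('n) \<alpha> j \<partial>lborel) \<le> S"
proof (induction j)
  case 0
  show ?case
  proof (intro exI[of _ "R\<^sup>2"] conjI allI impI)
    fix u :: "real^'n \<Rightarrow> real"
    assume u: "u \<in> frac_sobolev \<alpha>" "u \<in> borel_measurable borel" and R: "frac_sobolev_norm \<alpha> u \<le> R"
    have "(\<integral>x. (u x)\<^sup>2 \<partial>lborel) \<le> R\<^sup>2"
      using L2_le_frac_sobolev_norm(1)[OF u(1) R] u(2) by (simp add: integral_completion)
    then show "(\<integral>y. \<bar>u y\<bar> powr ladder_exp CARD('n) \<alpha> 0 \<partial>lborel) \<le> R\<^sup>2"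
      by (simp add: ladder_exp(1)[OF \<alpha>] powr_numeral)
    show "integrable lborel (\<lambda>y. \<bar>u y\<bar> powr ladder_exp CARD('n) \<alpha> 0)"
      using frac_sobolev_borelD(1)[OF u] by (simp add: ladder_exp(1)[OF \<alpha>] powr_numeral)
  qed simp
next
  case (Suc j)
  let ?a = "ladder_exp CARD('n) \<alpha> j" and ?b = "ladder_exp CARD('n) \<alpha> (Suc j)"
  obtain S where S: "0 \<le> S" "\<And>u :: real^'n \<Rightarrow> real. u \<in> frac_sobolev \<alpha> \<Longrightarrow> u \<in> borel_measurable borel \<Longrightarrow>
      frac_sobolev_norm \<alpha> u \<le> R \<Longrightarrow> integrable lborel (\<lambda>y. \<bar>u y\<bar> powr ?a) \<and> (\<integral>y. \<bar>u y\<bar> powr ?a \<partial>lborel) \<le> S"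
    using Suc by auto
  have a: "1 \<le> ?a" using ladder_exp(3)[OF \<alpha>, of j] by linarith
  obtain C where C: "0 < C" "\<And>(u :: real^'n \<Rightarrow> real) m. u \<in> frac_sobolev \<alpha> \<Longrightarrow> u \<in> borel_measurable borel \<Longrightarrow> 0 < m \<Longrightarrow>
      integrable lborel (\<lambda>y. \<bar>u y\<bar> powr ?a) \<Longrightarrow>
      (\<And>x. unit_ball_mass ?a u x \<le> m) \<Longrightarrow>
      integrable lborel (\<lambda>y. \<bar>u y\<bar> powr ?b) \<and>
      (\<integral>y. \<bar>u y\<bar> powr ?b \<partial>lborel) \<le> C * m powr (\<alpha> / real CARD('n)) * (frac_sobolev_norm \<alpha> u)\<^sup>2"
    using embedding_step[OF \<alpha>(1) a, where 'n='n] unfolding ladder_exp(2)[OF \<alpha>, symmetric] by blast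
  show ?case
  proof (intro exI[of _ "C * (S + 1) powr (\<alpha> / real CARD('n)) * R\<^sup>2"] conjI allI impI)
    fix u :: "real^'n \<Rightarrow> real"
    assume u: "u \<in> frac_sobolev \<alpha>" and um[measurable]: "u \<in> borel_measurable borel" and R: "frac_sobolev_norm \<alpha> u \<le> R"
    note Su = S(2)[OF u um R]
    have "unit_ball_mass ?a u x \<le> (\<integral>y. \<bar>u y\<bar> powr ?a \<partial>lborel)" for x
      using Su by (intro integral_mono' ) (auto simp: indicator_def)
    then have loc: "unit_ball_mass ?a u x \<le> S + 1" for x
      using Su by (meson add_increasing2 order_trans zero_le_one)
    note step = C(2)[OF u um, of "S + 1", OF _ _ loc]
    show "integrable lborel (\<lambda>y. \<bar>u y\<bar> powr ?b)" using step Su S(1) by auto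
    have "(\<integral>y. \<bar>u y\<bar> powr ?b \<partial>lborel) \<le> C * (S + 1) powr (\<alpha> / real CARD('n)) * (frac_sobolev_norm \<alpha> u)\<^sup>2"
      using step Su S(1) by auto
    also have "\<dots> \<le> C * (S + 1) powr (\<alpha> / real CARD('n)) * R\<^sup>2"
      using R frac_sobolev_norm_nonneg C(1) by (intro mult_left_mono power_mono) auto
    finally show "(\<integral>y. \<bar>u y\<bar> powr ?b \<partial>lborel) \<le> C * (S + 1) powr (\<alpha> / real CARD('n)) * R\<^sup>2" .
  qed (use C(1) in simp)
qed

lemma exponent_below_ladder:
  assumes "0 < \<alpha>" "\<alpha> < real N" "p < crit_exp N \<alpha>"
  shows "\<exists>j. p \<le> ladder_exp N \<alpha> (Suc j)"
proof -
  have "\<forall>\<^sub>F j in sequentially. p < ladder_exp N \<alpha> j"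
    using order_tendstoD(1)[OF ladder_exp(4)[OF assms(1,2)] assms(3)] .
  then obtain k where "\<And>j. j \<ge> k \<Longrightarrow> p < ladder_exp N \<alpha> j"
    by (auto simp: eventually_sequentially)
  from this[of "Suc k"] show ?thesis by (intro exI[of _ k]) simp
qed

text \<open>The subcritical Sobolev embedding; interpolation between \<open>L\<^sup>2\<close> and a rung of the ladder above \<open>p\<close>.\<close>

lemma sobolev_embedding:
  fixes \<alpha> p R :: real
  assumes \<alpha>: "0 < \<alpha>" "\<alpha> < real CARD('n)" and p: "2 \<le> p" "p < crit_exp CARD('n) \<alpha>"
  shows "\<exists>S\<ge>0. \<forall>u \<in> frac_sobolev \<alpha>. frac_sobolev_norm \<alpha> u \<le> R \<longrightarrow>
      integrable lebesgue (\<lambda>y :: real^'n. \<bar>u y\<bar> powr p) \<and> (\<integral>y. \<bar>u y\<bar> powr p \<partial>lebesgue) \<le> S"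
proof -
  obtain j where j: "p \<le> ladder_exp CARD('n) \<alpha> (Suc j)" using exponent_below_ladder[OF \<alpha> p(2)] by auto
  let ?b = "ladder_exp CARD('n) \<alpha> (Suc j)"
  obtain S where S: "0 \<le> S" "\<And>u :: real^'n \<Rightarrow> real. u \<in> frac_sobolev \<alpha> \<Longrightarrow> u \<in> borel_measurable borel \<Longrightarrow>
      frac_sobolev_norm \<alpha> u \<le> R \<Longrightarrow> integrable lborel (\<lambda>y. \<bar>u y\<bar> powr ?b) \<and> (\<integral>y. \<bar>u y\<bar> powr ?b \<partial>lborel) \<le> S"
    using sobolev_ladder[OF \<alpha>, of R "Suc j"] by auto
  show ?thesis
  proof (intro exI[of _ "R\<^sup>2 + S"] conjI ballI impI)
    fix u :: "real^'n \<Rightarrow> real"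
    assume u0: "u \<in> frac_sobolev \<alpha>" and R0: "frac_sobolev_norm \<alpha> u \<le> R"
    obtain v where vm[measurable]: "v \<in> borel_measurable borel" and uv: "AE x in lebesgue. u x = v x" and v: "v \<in> frac_sobolev \<alpha>"
      using frac_sobolev_borel_representative[OF u0] by auto
    have R: "frac_sobolev_norm \<alpha> v \<le> R" using R0 frac_sobolev_AE_cong(4)[OF u0 uv] by simp
    note Sv = S(2)[OF v vm R] and v2 = frac_sobolev_borelD[OF v vm]
    have le: "\<bar>v y\<bar> powr p \<le> (v y)\<^sup>2 + \<bar>v y\<bar> powr ?b" for y
      using powr_interpolation[of "\<bar>v y\<bar>" 1 p ?b] p j by simp
    have I: "integrable lborel (\<lambda>y. (v y)\<^sup>2 + \<bar>v y\<bar> powr ?b)" using Sv v2 by simp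
    have J: "integrable lborel (\<lambda>y. \<bar>v y\<bar> powr p)"
      by (rule Bochner_Integration.integrable_bound[OF I]) (use le in auto)
    have "(\<integral>y. \<bar>v y\<bar> powr p \<partial>lborel) \<le> (\<integral>y. (v y)\<^sup>2 + \<bar>v y\<bar> powr ?b \<partial>lborel)"
      by (rule integral_mono[OF J I le])
    also have "\<dots> = (\<integral>y. (v y)\<^sup>2 \<partial>lborel) + (\<integral>y. \<bar>v y\<bar> powr ?b \<partial>lborel)" using Sv v2 by simp
    also have "\<dots> \<le> R\<^sup>2 + S"
    proof (rule add_mono)
      have "(\<integral>x. (v x)\<^sup>2 \<partial>lborel) \<le> R\<^sup>2"
        using L2_le_frac_sobolev_norm(1)[OF v R] vm by (simp add: integral_completion)
      then show "(\<integral>x. (v x)\<^sup>2 \<partial>lborel) \<le> R\<^sup>2" .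
    qed (use Sv in simp)
    finally have K: "(\<integral>y. \<bar>v y\<bar> powr p \<partial>lborel) \<le> R\<^sup>2 + S" .
    have um[measurable]: "u \<in> borel_measurable lebesgue" using frac_sobolevD(1)[OF u0] .
    have vm'[measurable]: "v \<in> borel_measurable lebesgue" using frac_sobolevD(1)[OF v] .
    have eq: "AE y in lebesgue. \<bar>v y\<bar> powr p = \<bar>u y\<bar> powr p" using uv by eventually_elim simp
    have J': "integrable lebesgue (\<lambda>y. \<bar>v y\<bar> powr p)" using J by (simp add: integrable_completion)
    show "integrable lebesgue (\<lambda>y. \<bar>u y\<bar> powr p)"
      using integrable_cong_AE_imp[OF J' _ eq] by simp
    have "(\<integral>y. \<bar>u y\<bar> powr p \<partial>lebesgue) = (\<integral>y. \<bar>v y\<bar> powr p \<partial>lebesgue)"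
      using eq by (intro integral_cong_AE[symmetric]) auto
    then show "(\<integral>y. \<bar>u y\<bar> powr p \<partial>lebesgue) \<le> R\<^sup>2 + S" using K by (simp add: integral_completion)
  qed (use S(1) in simp)
qed

text \<open>
  Only the first step uses the local \<open>L\<^sup>2\<close> mass; afterwards the global integral of the previous power
  is already small and bounds the mass on every unit ball.
\<close>

lemma locally_vanishing_ladder:
  fixes \<alpha> R :: real
  assumes \<alpha>: "0 < \<alpha>" "\<alpha> < real CARD('n)" and \<epsilon>: "0 < \<epsilon>"
  shows "\<exists>\<delta>>0. \<forall>u :: real^'n \<Rightarrow> real. u \<in> frac_sobolev \<alpha> \<longrightarrow> u \<in> borel_measurable borel \<longrightarrow> frac_sobolev_norm \<alpha> u \<le> R \<longrightarrow>
      (\<forall>x. (\<integral>y. indicator (ball x 1) y * (u y)\<^sup>2 \<partial>lborel) \<le> \<delta>) \<longrightarrow>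
      (\<integral>y. \<bar>u y\<bar> powr ladder_exp CARD('n) \<alpha> (Suc j) \<partial>lborel) \<le> \<epsilon>"
  using \<epsilon>
proof (induction j arbitrary: \<epsilon>)
  have step: "\<exists>\<delta>>0. \<forall>u :: real^'n \<Rightarrow> real. u \<in> frac_sobolev \<alpha> \<longrightarrow> u \<in> borel_measurable borel \<longrightarrow> frac_sobolev_norm \<alpha> u \<le> R \<longrightarrow>
      (\<forall>x. unit_ball_mass (ladder_exp CARD('n) \<alpha> j) u x \<le> \<delta>) \<longrightarrow>
      (\<integral>y. \<bar>u y\<bar> powr ladder_exp CARD('n) \<alpha> (Suc j) \<partial>lborel) \<le> \<epsilon>" if \<epsilon>: "0 < \<epsilon>" for j and \<epsilon> :: real
  proof -
    let ?a = "ladder_exp CARD('n) \<alpha> j" and ?b = "ladder_exp CARD('n) \<alpha> (Suc j)" and ?N = "real CARD('n)"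
    have a: "1 \<le> ?a" using ladder_exp(3)[OF \<alpha>, of j] by linarith
    obtain C where C: "0 < C" "\<And>(u :: real^'n \<Rightarrow> real) m. u \<in> frac_sobolev \<alpha> \<Longrightarrow> u \<in> borel_measurable borel \<Longrightarrow> 0 < m \<Longrightarrow>
        integrable lborel (\<lambda>y. \<bar>u y\<bar> powr ?a) \<Longrightarrow>
        (\<And>x. unit_ball_mass ?a u x \<le> m) \<Longrightarrow>
        integrable lborel (\<lambda>y. \<bar>u y\<bar> powr ?b) \<and>
        (\<integral>y. \<bar>u y\<bar> powr ?b \<partial>lborel) \<le> C * m powr (\<alpha> / ?N) * (frac_sobolev_norm \<alpha> u)\<^sup>2"
      using embedding_step[OF \<alpha>(1) a, where 'n='n] unfolding ladder_exp(2)[OF \<alpha>, symmetric] by blast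
    define X where "X = \<epsilon> / (C * (R\<^sup>2 + 1))"
    define \<delta> where "\<delta> = X powr (?N / \<alpha>)"
    have R1: "0 < R\<^sup>2 + 1" by (simp add: add_nonneg_pos)
    have pos: "0 < X" using \<epsilon> C(1) R1 by (simp add: X_def)
    have \<delta>: "0 < \<delta>" using pos by (simp add: \<delta>_def)
    have \<delta>p: "\<delta> powr (\<alpha> / ?N) = X"
      using pos \<alpha> by (simp add: \<delta>_def powr_powr)
    show ?thesis
    proof (intro exI[of _ \<delta>] conjI allI impI)
      fix u :: "real^'n \<Rightarrow> real"
      assume u: "u \<in> frac_sobolev \<alpha>" and um: "u \<in> borel_measurable borel" and R: "frac_sobolev_norm \<alpha> u \<le> R"
        and loc: "\<forall>x. unit_ball_mass ?a u x \<le> \<delta>"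
      have "integrable lborel (\<lambda>y. \<bar>u y\<bar> powr ?a)" using sobolev_ladder[OF \<alpha>, of R j] u um R by auto
      then have "(\<integral>y. \<bar>u y\<bar> powr ?b \<partial>lborel) \<le> C * \<delta> powr (\<alpha> / ?N) * (frac_sobolev_norm \<alpha> u)\<^sup>2"
        using C(2)[OF u um \<delta> _ loc[rule_format]] by simp
      also have "\<dots> \<le> C * \<delta> powr (\<alpha> / ?N) * (R\<^sup>2 + 1)"
        using C(1) power_mono[OF R frac_sobolev_norm_nonneg, of 2] by (intro mult_left_mono) auto
      also have "\<dots> = \<epsilon>"
        using R1 C(1) by (simp add: \<delta>p X_def)
      finally show "(\<integral>y. \<bar>u y\<bar> powr ?b \<partial>lborel) \<le> \<epsilon>" .
    qed (rule \<delta>)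
  qed
  {
    case 0
    show ?case using step[OF 0, of 0] by (simp add: ladder_exp(1)[OF \<alpha>] powr_numeral)
  next
    case (Suc j)
    let ?b = "ladder_exp CARD('n) \<alpha> (Suc j)"
    obtain \<delta>1 where \<delta>1: "0 < \<delta>1" "\<And>u :: real^'n \<Rightarrow> real. u \<in> frac_sobolev \<alpha> \<Longrightarrow> u \<in> borel_measurable borel \<Longrightarrow> frac_sobolev_norm \<alpha> u \<le> R \<Longrightarrow>
      (\<And>x. unit_ball_mass ?b u x \<le> \<delta>1) \<Longrightarrow>
      (\<integral>y. \<bar>u y\<bar> powr ladder_exp CARD('n) \<alpha> (Suc (Suc j)) \<partial>lborel) \<le> \<epsilon>"
      using step[OF Suc.prems, of "Suc j"] by blast
    obtain \<delta> where \<delta>: "0 < \<delta>" "\<And>u :: real^'n \<Rightarrow> real. u \<in> frac_sobolev \<alpha> \<Longrightarrow> u \<in> borel_measurable borel \<Longrightarrow> frac_sobolev_norm \<alpha> u \<le> R \<Longrightarrow>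
      (\<And>x. (\<integral>y. indicator (ball x 1) y * (u y)\<^sup>2 \<partial>lborel) \<le> \<delta>) \<Longrightarrow> (\<integral>y. \<bar>u y\<bar> powr ?b \<partial>lborel) \<le> \<delta>1"
      using Suc.IH[OF \<delta>1(1)] by blast
    show ?case
    proof (intro exI[of _ \<delta>] conjI allI impI)
      fix u :: "real^'n \<Rightarrow> real"
      assume u: "u \<in> frac_sobolev \<alpha>" and um: "u \<in> borel_measurable borel" and R: "frac_sobolev_norm \<alpha> u \<le> R"
        and loc: "\<forall>x. (\<integral>y. indicator (ball x 1) y * (u y)\<^sup>2 \<partial>lborel) \<le> \<delta>"
      have I: "integrable lborel (\<lambda>y. \<bar>u y\<bar> powr ?b)" using sobolev_ladder[OF \<alpha>, of R "Suc j"] u um R by auto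
      have "unit_ball_mass ?b u x \<le> \<delta>1" for x
      proof -
        have "unit_ball_mass ?b u x \<le> (\<integral>y. \<bar>u y\<bar> powr ?b \<partial>lborel)"
          using I by (intro integral_mono') (auto simp: indicator_def)
        also have "\<dots> \<le> \<delta>1" using \<delta>(2)[OF u um R] loc by blast
        finally show ?thesis .
      qed
      then show "(\<integral>y. \<bar>u y\<bar> powr ladder_exp CARD('n) \<alpha> (Suc (Suc j)) \<partial>lborel) \<le> \<epsilon>"
        using \<delta>1(2)[OF u um R] by blast
    qed (rule \<delta>(1))
  }
qed

text \<open>
  Lions' vanishing lemma in contrapositive form. The power \<open>|u|\<^sup>p\<close> is interpolated between \<open>u\<^sup>2\<close> and a
  rung of the ladder above \<open>p\<close>, whose integral is small if \<open>u\<close> vanishes locally uniformly.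
\<close>

lemma concentration_on_unit_ball:
  fixes \<alpha> p R \<epsilon> :: real
  assumes \<alpha>: "0 < \<alpha>" "\<alpha> < real CARD('n)" and p: "2 < p" "p < crit_exp CARD('n) \<alpha>" and \<epsilon>: "0 < \<epsilon>"
  shows "\<exists>\<delta>>0. \<forall>u \<in> frac_sobolev \<alpha>. frac_sobolev_norm \<alpha> u \<le> R \<longrightarrow> \<epsilon> \<le> (\<integral>y. \<bar>u y\<bar> powr p \<partial>lebesgue) \<longrightarrow>
      (\<exists>x :: real^'n. \<delta> \<le> (\<integral>y. indicator (ball x 1) y * (u y)\<^sup>2 \<partial>lebesgue))"
proof -
  obtain j where j: "p \<le> ladder_exp CARD('n) \<alpha> (Suc j)" using exponent_below_ladder[OF \<alpha> p(2)] by auto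
  let ?b = "ladder_exp CARD('n) \<alpha> (Suc j)"
  \<comment> \<open>Below the level \<open>s\<close> the square absorbs \<open>|u|\<^sup>p\<close> with a small factor; above it the ladder exponent does.\<close>
  define s where "s = (\<epsilon> / (4 * (R\<^sup>2 + 1))) powr (1 / (p - 2))"
  have R1: "0 < R\<^sup>2 + 1" by (simp add: add_nonneg_pos)
  have s: "0 < s" using \<epsilon> R1 by (simp add: s_def)
  have sp: "s powr (p - 2) = \<epsilon> / (4 * (R\<^sup>2 + 1))" using \<epsilon> R1 p by (simp add: s_def powr_powr)
  define \<epsilon>' where "\<epsilon>' = \<epsilon> / (4 * s powr (p - ?b))"
  have \<epsilon>': "0 < \<epsilon>'" using \<epsilon> s by (simp add: \<epsilon>'_def)
  obtain \<delta> where \<delta>: "0 < \<delta>" "\<And>u :: real^'n \<Rightarrow> real. u \<in> frac_sobolev \<alpha> \<Longrightarrow> u \<in> borel_measurable borel \<Longrightarrow> frac_sobolev_norm \<alpha> u \<le> R \<Longrightarrow>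
      (\<And>x. (\<integral>y. indicator (ball x 1) y * (u y)\<^sup>2 \<partial>lborel) \<le> \<delta>) \<Longrightarrow> (\<integral>y. \<bar>u y\<bar> powr ?b \<partial>lborel) \<le> \<epsilon>'"
    using locally_vanishing_ladder[OF \<alpha> \<epsilon>', of R j] by blast
  show ?thesis
  proof (intro exI[of _ \<delta>] conjI ballI impI)
    fix u :: "real^'n \<Rightarrow> real"
    assume u0: "u \<in> frac_sobolev \<alpha>" and R0: "frac_sobolev_norm \<alpha> u \<le> R"
      and large: "\<epsilon> \<le> (\<integral>y. \<bar>u y\<bar> powr p \<partial>lebesgue)"
    obtain v where vm[measurable]: "v \<in> borel_measurable borel" and uv: "AE x in lebesgue. u x = v x" and v: "v \<in> frac_sobolev \<alpha>"
      using frac_sobolev_borel_representative[OF u0] by auto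
    have R: "frac_sobolev_norm \<alpha> v \<le> R" using R0 frac_sobolev_AE_cong(4)[OF u0 uv] by simp
    have um[measurable]: "u \<in> borel_measurable lebesgue" using frac_sobolevD(1)[OF u0] .
    have vm'[measurable]: "v \<in> borel_measurable lebesgue" using frac_sobolevD(1)[OF v] .
    show "\<exists>x. \<delta> \<le> (\<integral>y. indicator (ball x 1) y * (u y)\<^sup>2 \<partial>lebesgue)"
    proof (rule ccontr)
      assume "\<not> ?thesis"
      then have less: "(\<integral>y. indicator (ball x 1) y * (u y)\<^sup>2 \<partial>lebesgue) < \<delta>" for x
        by (auto simp: not_le)
      have "(\<integral>y. indicator (ball x 1) y * (v y)\<^sup>2 \<partial>lborel) \<le> \<delta>" for x
      proof -
        have "(\<integral>y. indicator (ball x 1) y * (v y)\<^sup>2 \<partial>lborel) = (\<integral>y. indicator (ball x 1) y * (v y)\<^sup>2 \<partial>lebesgue)"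
          by (intro integral_completion[symmetric] borel_measurable_times borel_measurable_power borel_measurable_indicator)
             (use vm in auto)
        also have "\<dots> = (\<integral>y. indicator (ball x 1) y * (u y)\<^sup>2 \<partial>lebesgue)"
        proof (rule integral_cong_AE)
          have [measurable]: "ball x 1 \<in> sets lebesgue" by simp
          show "(\<lambda>y. indicator (ball x 1) y * (v y)\<^sup>2) \<in> borel_measurable lebesgue"
            "(\<lambda>y. indicator (ball x 1) y * (u y)\<^sup>2) \<in> borel_measurable lebesgue" by measurable
        qed (use uv in auto)
        finally show ?thesis using less[of x] by simp
      qed
      then have small: "(\<integral>y. \<bar>v y\<bar> powr ?b \<partial>lborel) \<le> \<epsilon>'" using \<delta>(2)[OF v vm R] by blast
      have Ib: "integrable lborel (\<lambda>y. \<bar>v y\<bar> powr ?b)" using sobolev_ladder[OF \<alpha>, of R "Suc j"] v vm R by auto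
      note v2 = frac_sobolev_borelD[OF v vm]
      have le: "\<bar>v y\<bar> powr p \<le> s powr (p - 2) * (v y)\<^sup>2 + s powr (p - ?b) * \<bar>v y\<bar> powr ?b" for y
        using powr_interpolation[of "\<bar>v y\<bar>" s p ?b] p j s by simp
      have I: "integrable lborel (\<lambda>y. s powr (p - 2) * (v y)\<^sup>2 + s powr (p - ?b) * \<bar>v y\<bar> powr ?b)" using Ib v2 by simp
      have "(\<integral>y. \<bar>u y\<bar> powr p \<partial>lebesgue) = (\<integral>y. \<bar>v y\<bar> powr p \<partial>lebesgue)"
        using uv by (intro integral_cong_AE) auto
      also have "\<dots> = (\<integral>y. \<bar>v y\<bar> powr p \<partial>lborel)" by (simp add: integral_completion)
      also have "\<dots> \<le> (\<integral>y. s powr (p - 2) * (v y)\<^sup>2 + s powr (p - ?b) * \<bar>v y\<bar> powr ?b \<partial>lborel)"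
        by (rule integral_mono'[OF I le]) simp
      also have "\<dots> = s powr (p - 2) * (\<integral>y. (v y)\<^sup>2 \<partial>lborel) + s powr (p - ?b) * (\<integral>y. \<bar>v y\<bar> powr ?b \<partial>lborel)"
        using Ib v2 by simp
      also have "\<dots> \<le> s powr (p - 2) * (R\<^sup>2 + 1) + s powr (p - ?b) * \<epsilon>'"
      proof (intro add_mono mult_left_mono small)
        have "(\<integral>x. (v x)\<^sup>2 \<partial>lborel) \<le> R\<^sup>2"
          using L2_le_frac_sobolev_norm(1)[OF v R] vm by (simp add: integral_completion)
        then show "(\<integral>x. (v x)\<^sup>2 \<partial>lborel) \<le> R\<^sup>2 + 1" by simp
      qed auto
      also have "s powr (p - 2) * (R\<^sup>2 + 1) = \<epsilon> / 4"
      proof -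
        have "\<epsilon> / (4 * X) * X = \<epsilon> / 4" if "0 < X" for X :: real using that by simp
        from this[OF R1] show ?thesis by (simp only: sp)
      qed
      also have "s powr (p - ?b) * \<epsilon>' = \<epsilon> / 4" using s by (simp add: \<epsilon>'_def)
      finally show False using large \<epsilon> by linarith
    qed
  qed (rule \<delta>(1))
qed


section \<open>A fractional Hardy inequality\<close>

text \<open>
  Comparing \<open>u x\<close> with the values of \<open>u\<close> on a ball of radius \<open>L |x|\<close> around \<open>2 L x\<close> bounds
  \<open>|x|\<^bsup>-\<alpha>\<^esup> u\<^sup>2\<close> by the energy density plus an average that is taken further away from the origin.
  By Tonelli's theorem the average contributes the same weighted integral with a factor of order
  \<open>L\<^bsup>\<alpha>-N\<^esup>\<close>, and since \<open>\<alpha> < N\<close> it can be absorbed for large \<open>L\<close>. Cutting off near the origin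
  makes the absorbed integral finite, and the average at a point outside the cut-off ball involves
  only points outside it.
\<close>

lemma hardy_away_from_origin:
  fixes u :: "real^'n \<Rightarrow> real" and \<alpha> L \<epsilon> :: real
  assumes \<alpha>: "0 < \<alpha>" "\<alpha> < real CARD('n)" and u: "u \<in> frac_sobolev \<alpha>" and [measurable]: "u \<in> borel_measurable borel"
    and \<epsilon>: "0 < \<epsilon>" and L: "1 \<le> L" "2 * 3 powr (real CARD('n) + \<alpha>) * L powr (\<alpha> - real CARD('n)) \<le> 1 / 2"
  defines "C \<equiv> 2 * (4 * L) powr (real CARD('n) + \<alpha>) / unit_ball_vol (real CARD('n))"
  shows "(\<integral>\<^sup>+x. ennreal (indicator {x. \<epsilon> < norm x} x * ((u x)\<^sup>2 / norm x powr \<alpha>)) \<partial>lborel) \<le> ennreal (2 * C * gagliardo \<alpha> u)"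
proof -
  define \<omega> where "\<omega> = unit_ball_vol (real CARD('n))"
  let ?N = "real CARD('n)"
  let ?S = "{x :: real^'n. \<epsilon> < norm x}"
  define T where "T x = ball ((2 * L) *\<^sub>R x) (L * norm x)" for x :: "real^'n"
  define g where "g x = indicator ?S x * ((u x)\<^sup>2 / norm x powr \<alpha>)" for x
  define k where "k x y = indicator ?S x * (indicator (T x) y * (2 / (\<omega> * L powr ?N) * (u y)\<^sup>2 * norm x powr (- \<alpha> - ?N)))" for x y
  have \<omega>: "0 < \<omega>" unfolding \<omega>_def by (rule unit_ball_vol_pos) simp
  have C0: "0 < C" using \<omega> L by (simp add: C_def \<omega>_def)
  have u2: "integrable lborel (\<lambda>x. (u x)\<^sup>2)" using frac_sobolev_borelD(1)[OF u] by simp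
  have Sm[measurable]: "?S \<in> sets borel" by measurable
  have gm[measurable]: "g \<in> borel_measurable borel" unfolding g_def by measurable
  have g0: "0 \<le> g x" for x by (simp add: g_def)
  have k0: "0 \<le> k x y" for x y using \<omega> by (simp add: k_def)
  have km[measurable]: "(\<lambda>(x, y). ennreal (k x y)) \<in> borel_measurable (lborel \<Otimes>\<^sub>M lborel)"
  proof -
    have "{p :: (real^'n) \<times> (real^'n). snd p \<in> T (fst p)} = {p. norm ((2 * L) *\<^sub>R fst p - snd p) < L * norm (fst p)}"
      by (auto simp: T_def dist_norm)
    also have "open \<dots>" by (intro open_Collect_less continuous_intros)
    then have "\<dots> \<in> sets (borel \<Otimes>\<^sub>M borel)" unfolding borel_prod by (rule borel_open)
    finally have [measurable]: "{p :: (real^'n) \<times> (real^'n). snd p \<in> T (fst p)} \<in> sets (borel \<Otimes>\<^sub>M borel)" .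
    have "(\<lambda>p :: (real^'n) \<times> (real^'n). indicator ?S (fst p) * (indicator {p. snd p \<in> T (fst p)} p *
        (2 / (\<omega> * L powr ?N) * (u (snd p))\<^sup>2 * norm (fst p) powr (- \<alpha> - ?N)))) \<in> borel_measurable (borel \<Otimes>\<^sub>M borel)"
      by measurable
    then have "(\<lambda>p. k (fst p) (snd p)) \<in> borel_measurable (borel \<Otimes>\<^sub>M borel)"
      by (simp add: k_def indicator_def)
    then have "(\<lambda>p. ennreal (k (fst p) (snd p))) \<in> borel_measurable (lborel \<Otimes>\<^sub>M lborel)"
      by simp
    then show ?thesis by (simp add: case_prod_unfold)
  qed
  have vol: "measure lborel (ball c r) = \<omega> * r powr ?N" if "0 < r" for c :: "real^'n" and r
    using content_ball[of r c] that by (simp add: \<omega>_def powr_realpow)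
  have k_int: "(\<integral>\<^sup>+x. ennreal (k x y) \<partial>lborel) \<le> ennreal (1 / 2) * ennreal (g y)" for y :: "real^'n"
  proof (cases "\<epsilon> < norm y")
    case True
    then have y: "0 < norm y" using \<epsilon> by linarith
    let ?B = "ball (0 :: real^'n) (norm y / L)"
    define c where "c = 2 / (\<omega> * L powr ?N) * (u y)\<^sup>2 * ((3 * L) powr (\<alpha> + ?N) * norm y powr (- \<alpha> - ?N))"
    have c0: "0 \<le> c" using \<omega> by (simp add: c_def)
    have le: "k x y \<le> indicator ?B x * c" for x
    proof (cases "\<epsilon> < norm x \<and> y \<in> T x")
      case True
      then have "norm ((2 * L) *\<^sub>R x - y) < L * norm x" by (simp add: T_def dist_norm)
      moreover have "norm ((2 * L) *\<^sub>R x) = 2 * L * norm x" using L by simp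
      ultimately have 1: "L * norm x < norm y" "norm y < 3 * L * norm x"
        using norm_triangle_ineq3[of "(2 * L) *\<^sub>R x" y] by (auto simp: abs_le_iff)
      have x: "0 < norm x" using True \<epsilon> by linarith
      have "norm x powr (- \<alpha> - ?N) \<le> (norm y / (3 * L)) powr (- \<alpha> - ?N)"
        using 1 L y \<alpha> by (intro powr_mono2') (auto simp: field_simps)
      also have "\<dots> = (3 * L) powr (\<alpha> + ?N) * norm y powr (- \<alpha> - ?N)"
      proof -
        have "(norm y / (3 * L)) powr (- \<alpha> - ?N) = norm y powr (- \<alpha> - ?N) / (3 * L) powr (- (\<alpha> + ?N))"
          using L by (simp add: powr_divide)
        then show ?thesis by (simp only: powr_minus) (simp add: field_simps)
      qed
      finally have "2 / (\<omega> * L powr ?N) * (u y)\<^sup>2 * norm x powr (- \<alpha> - ?N) \<le> c"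
        unfolding c_def using \<omega> by (intro mult_left_mono) auto
      then have "k x y \<le> c"
        using True unfolding k_def by simp
      moreover have "x \<in> ?B" using 1 L by (simp add: field_simps)
      ultimately show ?thesis by simp
    qed (use c0 in \<open>auto simp: k_def indicator_def\<close>)
    have "(\<integral>\<^sup>+x. ennreal (k x y) \<partial>lborel) \<le> (\<integral>\<^sup>+x. ennreal c * indicator ?B x \<partial>lborel)"
    proof (rule nn_integral_mono)
      fix x
      have "ennreal (k x y) \<le> ennreal (indicator ?B x * c)" using le by (rule ennreal_leI)
      also have "\<dots> = ennreal c * indicator ?B x" by (auto split: split_indicator)
      finally show "ennreal (k x y) \<le> ennreal c * indicator ?B x" .
    qed
    also have "\<dots> = ennreal c * emeasure lborel ?B"
      by (rule nn_integral_cmult_indicator) simp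
    also have "emeasure lborel ?B = ennreal (\<omega> * (norm y / L) powr ?N)"
      using vol[of "norm y / L" 0] y L emeasure_eq_ennreal_measure[of lborel ?B] emeasure_bounded_finite[OF bounded_ball, of 0 "norm y / L"]
      by (simp add: less_top)
    also have "ennreal c * \<dots> = ennreal (c * (\<omega> * (norm y / L) powr ?N))"
      using c0 \<omega> by (simp add: ennreal_mult)
    also have "c * (\<omega> * (norm y / L) powr ?N) = (2 * 3 powr (?N + \<alpha>) * L powr (\<alpha> - ?N)) * g y"
    proof -
      have "(norm y / L) powr ?N = norm y powr ?N * L powr (- ?N)"
        using L by (simp add: powr_divide powr_minus field_simps)
      moreover have "(3 * L) powr (\<alpha> + ?N) = 3 powr (?N + \<alpha>) * L powr (\<alpha> + ?N)"
        using L by (simp add: powr_mult add.commute)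
      ultimately have "c * (\<omega> * (norm y / L) powr ?N) =
        2 * (u y)\<^sup>2 * 3 powr (?N + \<alpha>) * (norm y powr (- \<alpha> - ?N) * norm y powr ?N) *
        ((L powr (\<alpha> + ?N) * L powr (- ?N)) * (1 / L powr ?N))"
        using \<omega> by (simp add: c_def)
      also have "norm y powr (- \<alpha> - ?N) * norm y powr ?N = 1 / norm y powr \<alpha>"
        using y by (simp flip: powr_add add: powr_minus_divide)
      also have "(L powr (\<alpha> + ?N) * L powr (- ?N)) * (1 / L powr ?N) = L powr (\<alpha> - ?N)"
        using L by (simp add: powr_diff flip: powr_add)
      finally show ?thesis using True by (simp add: g_def)
    qed
    also have "ennreal \<dots> \<le> ennreal (1 / 2 * g y)"
      using L(2) g0[of y] by (intro ennreal_leI mult_right_mono)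
    also have "\<dots> = ennreal (1 / 2) * ennreal (g y)" by (rule ennreal_mult) (use g0[of y] in auto)
    finally show ?thesis .
  next
    case False
    have "k x y = 0" for x
    proof (rule ccontr)
      assume "k x y \<noteq> 0"
      then have x: "\<epsilon> < norm x" "y \<in> T x" by (auto simp: k_def indicator_def split: if_splits)
      then have "norm ((2 * L) *\<^sub>R x - y) < L * norm x" by (simp add: T_def dist_norm)
      moreover have "norm ((2 * L) *\<^sub>R x) = 2 * L * norm x" using L by simp
      ultimately have "L * norm x < norm y"
        using norm_triangle_ineq3[of "(2 * L) *\<^sub>R x" y] by (auto simp: abs_le_iff)
      moreover have "1 * norm x \<le> L * norm x" using L by (intro mult_right_mono) auto
      ultimately show False using x False by linarith
    qed
    then show ?thesis by simp
  qed
  have pw: "AE x in lborel. ennreal (g x) \<le> ennreal (C * energy_density \<alpha> u x) + (\<integral>\<^sup>+y. ennreal (k x y) \<partial>lborel)"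
    using energy_density_integral(1)[OF u \<open>u \<in> borel_measurable borel\<close>]
  proof eventually_elim
    case (elim x)
    show ?case
    proof (cases "\<epsilon> < norm x")
      case False
      then show ?thesis by (simp add: g_def)
    next
      case True
      then have x: "0 < norm x" using \<epsilon> by linarith
      define b where "b = \<omega> * (L * norm x) powr ?N"
      have b: "0 < b" using \<omega> L x by (simp add: b_def)
      have vT: "measure lborel (T x) = b" using vol[of "L * norm x"] L x by (simp add: T_def b_def)
      have fT: "emeasure lborel (T x) < \<infinity>"
        unfolding T_def using emeasure_bounded_finite[OF bounded_ball] by auto
      have [measurable]: "T x \<in> sets borel" by (simp add: T_def)
      have d: "norm (x - y) \<le> 4 * L * norm x" if "y \<in> T x" for y
      proof -
        have "norm (x - y) \<le> norm (x - (2 * L) *\<^sub>R x) + norm ((2 * L) *\<^sub>R x - y)"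
          using norm_triangle_ineq[of "x - (2 * L) *\<^sub>R x" "(2 * L) *\<^sub>R x - y"] by simp
        also have "norm (x - (2 * L) *\<^sub>R x) \<le> norm x + norm ((2 * L) *\<^sub>R x)" by (rule norm_triangle_ineq4)
        also have "norm ((2 * L) *\<^sub>R x) = 2 * (L * norm x)" using L by simp
        also have "norm ((2 * L) *\<^sub>R x - y) \<le> L * norm x" using that by (simp add: T_def dist_norm)
        finally have "norm (x - y) \<le> norm x + 3 * (L * norm x)" by simp
        moreover have "1 * norm x \<le> L * norm x" using L by (intro mult_right_mono) auto
        ultimately show ?thesis by linarith
      qed
      have J: "integrable lborel (\<lambda>y. indicator (T x) y * (u x - u y)\<^sup>2)"
        and K: "(\<integral>y. indicator (T x) y * (u x - u y)\<^sup>2 \<partial>lborel) \<le> (4 * L * norm x) powr (?N + \<alpha>) * energy_density \<alpha> u x"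
        using sq_diff_integral_le[OF \<alpha>(1) _ _ elim, of "T x" "4 * L * norm x"] d by auto
      have Iu: "integrable lborel (\<lambda>y. indicator (T x) y * (u y)\<^sup>2)"
        by (rule Bochner_Integration.integrable_bound[OF u2]) (auto simp: indicator_def)
      have Iind: "integrable lborel (indicator (T x) :: _ \<Rightarrow> real)" using fT by simp
      have "b * (u x)\<^sup>2 = (\<integral>y. indicator (T x) y * (u x)\<^sup>2 \<partial>lborel)" using vT by simp
      also have "\<dots> \<le> (\<integral>y. 2 * (indicator (T x) y * (u x - u y)\<^sup>2) + 2 * (indicator (T x) y * (u y)\<^sup>2) \<partial>lborel)"
      proof (rule integral_mono)
        fix y
        have "(u x)\<^sup>2 \<le> 2 * (u x - u y)\<^sup>2 + 2 * (u y)\<^sup>2"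
        proof -
          have "0 \<le> (u x - 2 * u y)\<^sup>2" by simp
          then show ?thesis by (simp add: power2_eq_square algebra_simps)
        qed
        then show "indicator (T x) y * (u x)\<^sup>2 \<le> 2 * (indicator (T x) y * (u x - u y)\<^sup>2) + 2 * (indicator (T x) y * (u y)\<^sup>2)"
          by (simp add: indicator_def)
      qed (use J Iu Iind in auto)
      also have "\<dots> = 2 * (\<integral>y. indicator (T x) y * (u x - u y)\<^sup>2 \<partial>lborel) + 2 * (\<integral>y. indicator (T x) y * (u y)\<^sup>2 \<partial>lborel)"
        using J Iu by simp
      also have "\<dots> \<le> 2 * ((4 * L * norm x) powr (?N + \<alpha>) * energy_density \<alpha> u x) + 2 * (\<integral>y. indicator (T x) y * (u y)\<^sup>2 \<partial>lborel)"
        using K by simp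
      finally have main: "b * (u x)\<^sup>2 \<le> 2 * ((4 * L * norm x) powr (?N + \<alpha>) * energy_density \<alpha> u x) + 2 * (\<integral>y. indicator (T x) y * (u y)\<^sup>2 \<partial>lborel)" .
      define w where "w = 1 / (b * norm x powr \<alpha>)"
      have w: "0 < w" using b x by (simp add: w_def)
      have "g x = w * (b * (u x)\<^sup>2)" using True b by (simp add: g_def w_def)
      also have "\<dots> \<le> w * (2 * ((4 * L * norm x) powr (?N + \<alpha>) * energy_density \<alpha> u x) + 2 * (\<integral>y. indicator (T x) y * (u y)\<^sup>2 \<partial>lborel))"
        using main w by (intro mult_left_mono) auto
      also have "\<dots> = (w * (2 * (4 * L * norm x) powr (?N + \<alpha>))) * energy_density \<alpha> u x + 2 * w * (\<integral>y. indicator (T x) y * (u y)\<^sup>2 \<partial>lborel)"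
        by (simp add: algebra_simps)
      also have "w * (2 * (4 * L * norm x) powr (?N + \<alpha>)) \<le> C"
      proof -
        have "(4 * L * norm x) powr (?N + \<alpha>) = (4 * L) powr (?N + \<alpha>) * (norm x powr ?N * norm x powr \<alpha>)"
          using L x by (simp add: powr_mult powr_add)
        moreover have "w = 1 / (\<omega> * L powr ?N * (norm x powr ?N * norm x powr \<alpha>))"
          using L x by (simp add: w_def b_def powr_mult)
        ultimately have "w * (2 * (4 * L * norm x) powr (?N + \<alpha>)) = C / L powr ?N"
          using x by (simp add: C_def \<omega>_def)
        also have "\<dots> \<le> C / 1"
          using C0 L ge_one_powr_ge_zero[of L ?N] by (intro divide_left_mono) auto
        finally show ?thesis by simp
      qed
      finally have g_le: "g x \<le> C * energy_density \<alpha> u x + 2 * w * (\<integral>y. indicator (T x) y * (u y)\<^sup>2 \<partial>lborel)"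
        using energy_density_nonneg[of \<alpha> u x] by (simp add: mult_right_mono)
      have "2 * w = 2 / (\<omega> * L powr ?N) * norm x powr (- \<alpha> - ?N)"
      proof -
        have "norm x powr (- \<alpha> - ?N) = 1 / (norm x powr ?N * norm x powr \<alpha>)"
          using x by (simp add: powr_diff powr_minus field_simps)
        then show ?thesis using L x by (simp add: w_def b_def powr_mult)
      qed
      then have kx: "k x y = 2 * w * (indicator (T x) y * (u y)\<^sup>2)" for y
        using True by (simp add: k_def)
      have "(\<integral>\<^sup>+y. ennreal (k x y) \<partial>lborel) = ennreal (\<integral>y. k x y \<partial>lborel)"
        using w Iu by (intro nn_integral_eq_integral) (auto simp: kx)
      also have "(\<integral>y. k x y \<partial>lborel) = 2 * w * (\<integral>y. indicator (T x) y * (u y)\<^sup>2 \<partial>lborel)"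
        by (simp add: kx)
      finally have kk: "(\<integral>\<^sup>+y. ennreal (k x y) \<partial>lborel) = ennreal (2 * w * (\<integral>y. indicator (T x) y * (u y)\<^sup>2 \<partial>lborel))" .
      have "0 \<le> C * energy_density \<alpha> u x" using C0 energy_density_nonneg[of \<alpha> u x] by simp
      moreover have "0 \<le> 2 * w * (\<integral>y. indicator (T x) y * (u y)\<^sup>2 \<partial>lborel)" using w by simp
      ultimately show ?thesis unfolding kk using g_le by (simp flip: ennreal_plus)
    qed
  qed
  let ?X = "\<integral>\<^sup>+x. ennreal (g x) \<partial>lborel"
  have fin: "?X < \<infinity>"
  proof -
    have "g x \<le> (1 / \<epsilon> powr \<alpha>) * (u x)\<^sup>2" for x
    proof (cases "\<epsilon> < norm x")
      case True
      then have "\<epsilon> powr \<alpha> \<le> norm x powr \<alpha>" using \<epsilon> \<alpha> by (intro powr_mono2) auto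
      then have "(u x)\<^sup>2 / norm x powr \<alpha> \<le> (u x)\<^sup>2 / \<epsilon> powr \<alpha>"
        using \<epsilon> by (intro divide_left_mono mult_pos_pos) auto
      then show ?thesis using True by (simp add: g_def)
    qed (simp add: g_def)
    then have "?X \<le> (\<integral>\<^sup>+x. ennreal ((1 / \<epsilon> powr \<alpha>) * (u x)\<^sup>2) \<partial>lborel)"
      by (intro nn_integral_mono ennreal_leI)
    also have "\<dots> < \<infinity>"
      using u2 by (subst nn_integral_eq_integral) auto
    finally show ?thesis .
  qed
  have gag: "(\<integral>\<^sup>+x. ennreal (C * energy_density \<alpha> u x) \<partial>lborel) = ennreal (C * gagliardo \<alpha> u)"
    using energy_density_integral(2,3)[OF u \<open>u \<in> borel_measurable borel\<close>] C0 energy_density_nonneg[of \<alpha> u]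
    by (subst nn_integral_eq_integral) auto
  have em[measurable]: "energy_density \<alpha> u \<in> borel_measurable lborel"
    using energy_density_integral(2)[OF u \<open>u \<in> borel_measurable borel\<close>] by (rule borel_measurable_integrable)
  have "?X \<le> (\<integral>\<^sup>+x. (ennreal (C * energy_density \<alpha> u x) + (\<integral>\<^sup>+y. ennreal (k x y) \<partial>lborel)) \<partial>lborel)"
    by (rule nn_integral_mono_AE[OF pw])
  also have "\<dots> = ennreal (C * gagliardo \<alpha> u) + (\<integral>\<^sup>+x. (\<integral>\<^sup>+y. ennreal (k x y) \<partial>lborel) \<partial>lborel)"
    by (subst nn_integral_add) (auto simp: gag)
  also have "(\<integral>\<^sup>+x. (\<integral>\<^sup>+y. ennreal (k x y) \<partial>lborel) \<partial>lborel) = (\<integral>\<^sup>+y. (\<integral>\<^sup>+x. ennreal (k x y) \<partial>lborel) \<partial>lborel)"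
    by (rule lborel_pair.Fubini'[OF km, symmetric])
  also have "\<dots> \<le> (\<integral>\<^sup>+y. ennreal (1 / 2) * ennreal (g y) \<partial>lborel)"
    by (intro nn_integral_mono k_int)
  also have "\<dots> = ennreal (1 / 2) * ?X"
    by (rule nn_integral_cmult) simp
  finally have le: "?X \<le> ennreal (C * gagliardo \<alpha> u) + ennreal (1 / 2) * ?X" by (simp add: add_left_mono)
  obtain X where X: "?X = ennreal X" "0 \<le> X" using fin by (cases ?X) auto
  have G0: "0 \<le> C * gagliardo \<alpha> u" using C0 by (simp add: gagliardo_eq)
  have "ennreal (1 / 2 * X) = ennreal (1 / 2) * ennreal X"
    by (rule ennreal_mult) (use X in auto)
  moreover have "ennreal (C * gagliardo \<alpha> u + 1 / 2 * X) = ennreal (C * gagliardo \<alpha> u) + ennreal (1 / 2 * X)"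
    by (rule ennreal_plus) (use X G0 in auto)
  ultimately have "ennreal X \<le> ennreal (C * gagliardo \<alpha> u + 1 / 2 * X)"
    using le unfolding X(1) by (simp only:)
  then have "X \<le> C * gagliardo \<alpha> u + 1 / 2 * X"
    using X G0 by (subst (asm) ennreal_le_iff) auto
  then have "X \<le> 2 * C * gagliardo \<alpha> u" by simp
  then show ?thesis using X by (simp add: g_def[abs_def] ennreal_leI)
qed

text \<open>
  The cut-off at \<open>1 / Suc n\<close> is removed by Fatou's lemma, with \<open>L\<close> chosen such that the factor of the
  absorbed term is exactly \<open>1/2\<close>.
\<close>

lemma hardy_inequality:
  fixes \<alpha> :: real
  assumes \<alpha>: "0 < \<alpha>" "\<alpha> < real CARD('n)"
  shows "\<exists>C\<ge>0. \<forall>u \<in> frac_sobolev \<alpha>. integrable lebesgue (\<lambda>x :: real^'n. (u x)\<^sup>2 / norm x powr \<alpha>) \<and>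
      (\<integral>x. (u x)\<^sup>2 / norm x powr \<alpha> \<partial>lebesgue) \<le> C * gagliardo \<alpha> u"
proof -
  let ?N = "real CARD('n)"
  define L where "L = (4 * 3 powr (?N + \<alpha>)) powr (1 / (?N - \<alpha>))"
  have "1 \<le> 3 powr (?N + \<alpha>)" using \<alpha> by (intro ge_one_powr_ge_zero) auto
  then have L1: "1 \<le> L" unfolding L_def using \<alpha> by (intro ge_one_powr_ge_zero) auto
  have "L powr (\<alpha> - ?N) = (4 * 3 powr (?N + \<alpha>)) powr (1 / (?N - \<alpha>) * (\<alpha> - ?N))"
    by (simp add: L_def powr_powr)
  also have "1 / (?N - \<alpha>) * (\<alpha> - ?N) = -1" using \<alpha> by (simp add: field_simps)
  finally have L2: "2 * 3 powr (?N + \<alpha>) * L powr (\<alpha> - ?N) \<le> 1 / 2"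
    by (simp add: powr_minus field_simps)
  define C where "C = 2 * (4 * L) powr (?N + \<alpha>) / unit_ball_vol ?N"
  have C0: "0 \<le> 2 * C" by (simp add: C_def)
  show ?thesis
  proof (intro exI[of _ "2 * C"] conjI ballI C0)
    fix u :: "real^'n \<Rightarrow> real" assume u0: "u \<in> frac_sobolev \<alpha>"
    obtain v where vm: "v \<in> borel_measurable borel" and uv: "AE x in lebesgue. u x = v x" and v: "v \<in> frac_sobolev \<alpha>"
      using frac_sobolev_borel_representative[OF u0] by auto
    define w where "w n x = indicator {x. 1 / real (Suc n) < norm x} x * ((v x)\<^sup>2 / norm x powr \<alpha>)" for n and x :: "real^'n"
    have wm: "w n \<in> borel_measurable borel" for n using vm unfolding w_def by measurable
    have lim: "(\<lambda>n. w n x) \<longlonglongrightarrow> (v x)\<^sup>2 / norm x powr \<alpha>" for x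
    proof (cases "x = 0")
      case False
      then obtain m where "inverse (real (Suc m)) < norm x" using reals_Archimedean[of "norm x"] by auto
      then have "w n x = (v x)\<^sup>2 / norm x powr \<alpha>" if "m \<le> n" for n
      proof -
        have "1 / real (Suc n) \<le> 1 / real (Suc m)" using that by (intro divide_left_mono) auto
        then show ?thesis using \<open>inverse (real (Suc m)) < norm x\<close> by (simp add: w_def inverse_eq_divide)
      qed
      then show ?thesis
        by (intro tendsto_eventually) (auto simp: eventually_sequentially intro: exI[of _ m])
    qed (simp add: w_def)
    have Hn: "(\<integral>\<^sup>+x. ennreal (w n x) \<partial>lborel) \<le> ennreal (2 * C * gagliardo \<alpha> u)" for n
      using hardy_away_from_origin[OF \<alpha> v vm _ L1 L2, of "1 / real (Suc n)"] frac_sobolev_AE_cong(3)[OF u0 uv]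
      by (simp add: w_def[abs_def] C_def)
    have "(\<integral>\<^sup>+x. ennreal ((v x)\<^sup>2 / norm x powr \<alpha>) \<partial>lborel) = (\<integral>\<^sup>+x. liminf (\<lambda>n. ennreal (w n x)) \<partial>lborel)"
    proof (rule nn_integral_cong)
      fix x show "ennreal ((v x)\<^sup>2 / norm x powr \<alpha>) = liminf (\<lambda>n. ennreal (w n x))"
        using lim_imp_Liminf[OF _ tendsto_ennrealI[OF lim[of x]]] by simp
    qed
    also have "\<dots> \<le> liminf (\<lambda>n. \<integral>\<^sup>+x. ennreal (w n x) \<partial>lborel)"
      using wm by (intro nn_integral_liminf) auto
    also have "\<dots> \<le> liminf (\<lambda>n. ennreal (2 * C * gagliardo \<alpha> u))"
      by (intro Liminf_mono always_eventually allI Hn)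
    also have "\<dots> = ennreal (2 * C * gagliardo \<alpha> u)" by (simp add: Liminf_const)
    finally have le: "(\<integral>\<^sup>+x. ennreal ((v x)\<^sup>2 / norm x powr \<alpha>) \<partial>lborel) \<le> ennreal (2 * C * gagliardo \<alpha> u)" .
    have vhm: "(\<lambda>x. (v x)\<^sup>2 / norm x powr \<alpha>) \<in> borel_measurable borel" using vm by measurable
    have I: "integrable lborel (\<lambda>x. (v x)\<^sup>2 / norm x powr \<alpha>)"
      using le vhm by (intro integrableI_nonneg) (auto intro: le_less_trans)
    then have I': "integrable lebesgue (\<lambda>x. (v x)\<^sup>2 / norm x powr \<alpha>)"
      using vhm by (simp add: integrable_completion)
    have G0: "0 \<le> 2 * C * gagliardo \<alpha> u" using C0 by (simp add: gagliardo_eq)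
    have J: "(\<integral>x. (v x)\<^sup>2 / norm x powr \<alpha> \<partial>lborel) \<le> 2 * C * gagliardo \<alpha> u"
      using le nn_integral_eq_integral[OF I] G0 by simp
    have um: "u \<in> borel_measurable lebesgue" using frac_sobolevD(1)[OF u0] .
    have nm: "(\<lambda>x :: real^'n. norm x powr \<alpha>) \<in> borel_measurable lebesgue"
      by (intro measurable_completion) measurable
    have uhm: "(\<lambda>x. (u x)\<^sup>2 / norm x powr \<alpha>) \<in> borel_measurable lebesgue" using um nm by measurable
    have eq: "AE x in lebesgue. (v x)\<^sup>2 / norm x powr \<alpha> = (u x)\<^sup>2 / norm x powr \<alpha>"
      using uv by eventually_elim simp
    show "integrable lebesgue (\<lambda>x. (u x)\<^sup>2 / norm x powr \<alpha>)"
      using integrable_cong_AE_imp[OF I' uhm eq] .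
    have "(\<integral>x. (u x)\<^sup>2 / norm x powr \<alpha> \<partial>lebesgue) = (\<integral>x. (v x)\<^sup>2 / norm x powr \<alpha> \<partial>lebesgue)"
      using eq I' uhm by (intro integral_cong_AE[symmetric]) auto
    then show "(\<integral>x. (u x)\<^sup>2 / norm x powr \<alpha> \<partial>lebesgue) \<le> 2 * C * gagliardo \<alpha> u"
      using J vhm by (simp add: integral_completion)
  qed
qed


section \<open>Compactness\<close>

text \<open>
  The average is over a ball near \<open>x\<close> whose centre can be taken from a countable set. Dividing by \<open>s\<close>
  keeps the bound linear in the energy density.
\<close>

lemma local_average_error:
  fixes u :: "real^'n \<Rightarrow> real"
  assumes \<alpha>: "0 < \<alpha>" and um[measurable]: "u \<in> borel_measurable borel" and u2: "integrable lborel (\<lambda>x. (u x)\<^sup>2)"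
    and I: "integrable lborel (\<lambda>y. (diff_quot \<alpha> u (x, y))\<^sup>2)"
    and r: "0 < r" and c: "dist x c < r" and s: "0 < s"
  defines "b \<equiv> measure lborel (ball c r)"
  shows "\<bar>u x - (\<integral>y. indicator (ball c r) y * u y \<partial>lborel) / b\<bar>
      \<le> s + (2 powr (real CARD('n) + \<alpha>) / unit_ball_vol (real CARD('n))) * r powr \<alpha> * energy_density \<alpha> u x / s"
proof -
  let ?B = "ball c r" and ?N = "real CARD('n)"
  define \<omega> where "\<omega> = unit_ball_vol (real CARD('n))"
  have \<omega>: "0 < \<omega>" unfolding \<omega>_def by (rule unit_ball_vol_pos) simp
  have bw: "b = \<omega> * r powr ?N"
    using content_ball[of r c] r by (simp add: b_def \<omega>_def powr_realpow)
  have b: "0 < b" using \<omega> r by (simp add: bw)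
  have Iind: "integrable lborel (indicator ?B :: _ \<Rightarrow> real)"
    using emeasure_bounded_finite[OF bounded_ball, of c r] by simp
  have Bm[measurable]: "?B \<in> sets borel" by simp
  have Iu: "integrable lborel (\<lambda>y. indicator ?B y * u y)"
  proof (rule Bochner_Integration.integrable_bound)
    show "integrable lborel (\<lambda>y. indicator ?B y + (u y)\<^sup>2 :: real)" using Iind u2 by simp
    have "\<bar>a\<bar> \<le> 1 + a\<^sup>2" for a :: real
      using abs_le_plus_powr[of 1 2 a] by simp
    then show "AE y in lborel. norm (indicator ?B y * u y) \<le> norm (indicator ?B y + (u y)\<^sup>2 :: real)"
      by (auto simp: indicator_def)
  qed measurable
  have J: "integrable lborel (\<lambda>y. indicator ?B y * (u x - u y)\<^sup>2)"
    and K: "(\<integral>y. indicator ?B y * (u x - u y)\<^sup>2 \<partial>lborel) \<le> (2 * r) powr (?N + \<alpha>) * energy_density \<alpha> u x"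
  proof -
    have "norm (x - y) \<le> 2 * r" if "y \<in> ?B" for y
      using that c dist_triangle[of x y c] by (simp add: dist_norm norm_minus_commute)
    then show "integrable lborel (\<lambda>y. indicator ?B y * (u x - u y)\<^sup>2)"
      and "(\<integral>y. indicator ?B y * (u x - u y)\<^sup>2 \<partial>lborel) \<le> (2 * r) powr (?N + \<alpha>) * energy_density \<alpha> u x"
      using sq_diff_integral_le[OF \<alpha> um Bm I, of "2 * r"] by auto
  qed
  have I1: "integrable lborel (\<lambda>y. indicator ?B y * (u x - u y))"
    using Iu integrable_mult_left[OF Iind, of "u x"] by (simp add: right_diff_distrib)
  have "b * (u x - (\<integral>y. indicator ?B y * u y \<partial>lborel) / b) = (\<integral>y. indicator ?B y * (u x - u y) \<partial>lborel)"
  proof -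
    have "(\<integral>y. indicator ?B y * (u x - u y) \<partial>lborel) = (\<integral>y. indicator ?B y * u x \<partial>lborel) - (\<integral>y. indicator ?B y * u y \<partial>lborel)"
      using Iu integrable_mult_left[OF Iind, of "u x"] by (simp add: right_diff_distrib)
    then show ?thesis using b by (simp add: b_def right_diff_distrib)
  qed
  moreover have "b * \<bar>z\<bar> = \<bar>b * z\<bar>" for z using b by (simp add: abs_mult)
  ultimately have "b * \<bar>u x - (\<integral>y. indicator ?B y * u y \<partial>lborel) / b\<bar> = \<bar>\<integral>y. indicator ?B y * (u x - u y) \<partial>lborel\<bar>"
    by (simp only:)
  also have "\<dots> \<le> (\<integral>y. \<bar>indicator ?B y * (u x - u y)\<bar> \<partial>lborel)" by (rule integral_abs_bound)
  also have "\<dots> \<le> (\<integral>y. s * indicator ?B y + (1 / s) * (indicator ?B y * (u x - u y)\<^sup>2) \<partial>lborel)"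
  proof (rule integral_mono)
    fix y
    have "\<bar>u x - u y\<bar> \<le> s + (1 / s) * (u x - u y)\<^sup>2"
      using abs_le_plus_powr[OF s, of 2 "u x - u y"] s by (simp add: powr_minus_divide)
    then show "\<bar>indicator ?B y * (u x - u y)\<bar> \<le> s * indicator ?B y + (1 / s) * (indicator ?B y * (u x - u y)\<^sup>2)"
      by (auto simp: indicator_def)
  qed (use I1 Iind J in auto)
  also have "\<dots> = s * b + (1 / s) * (\<integral>y. indicator ?B y * (u x - u y)\<^sup>2 \<partial>lborel)"
    using Iind J by (simp add: b_def)
  also have "\<dots> \<le> s * b + (1 / s) * ((2 * r) powr (?N + \<alpha>) * energy_density \<alpha> u x)"
    using K s by (intro add_mono mult_left_mono) auto
  also have "\<dots> = b * (s + (2 powr (?N + \<alpha>) / \<omega>) * r powr \<alpha> * energy_density \<alpha> u x / s)"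
  proof -
    have "(2 * r) powr (?N + \<alpha>) = b * ((2 powr (?N + \<alpha>) / \<omega>) * r powr \<alpha>)"
      using r \<omega> by (simp add: bw powr_mult powr_add)
    then show ?thesis by (simp add: distrib_left ac_simps)
  qed
  finally show ?thesis using b by (simp add: \<omega>_def)
qed

text \<open>
  Rellich's theorem in the form in which it is used: averages over countably many balls are bounded
  and hence converge along a diagonal sequence, and by the preceding lemma they determine a bounded
  sequence up to an error that is uniformly small in \<open>L\<^sup>1\<close> with an integrable weight.
\<close>

lemma bounded_AE_convergent_subsequence_borel:
  fixes u :: "nat \<Rightarrow> real^'n \<Rightarrow> real"
  assumes \<alpha>: "0 < \<alpha>" and u: "\<And>n. u n \<in> frac_sobolev \<alpha>" and um[measurable]: "\<And>n. u n \<in> borel_measurable borel"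
    and R: "\<And>n. frac_sobolev_norm \<alpha> (u n) \<le> R"
  shows "\<exists>r v. strict_mono r \<and> v \<in> borel_measurable borel \<and> (AE x in lborel. (\<lambda>n. u (r n) x) \<longlonglongrightarrow> v x)"
proof -
  let ?N = "real CARD('n)"
  obtain D :: "(real^'n) set" where D: "countable D" "\<And>X. open X \<Longrightarrow> X \<noteq> {} \<Longrightarrow> \<exists>d\<in>D. d \<in> X"
    using countable_dense_exists by blast
  have "D \<noteq> {}" using D(2)[of UNIV] by auto
  define d where "d = from_nat_into D"
  have dense: "\<exists>j. dist x (d j) < \<rho>" if "0 < \<rho>" for x \<rho>
  proof -
    obtain c where "c \<in> D" "c \<in> ball x \<rho>" using D(2)[of "ball x \<rho>"] \<open>0 < \<rho>\<close> by auto
    then show ?thesis using from_nat_into_surj[OF D(1), of c] by (auto simp: d_def)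
  qed
  define \<rho> where "\<rho> m = 1 / real (Suc m)" for m
  have \<rho>0: "0 < \<rho> m" for m by (simp add: \<rho>_def)
  define B where "B m j = ball (d j) (\<rho> m)" for m j
  define vol where "vol m = unit_ball_vol ?N * \<rho> m ^ CARD('n)" for m
  have volB: "measure lborel (B m j) = vol m" for m j
    using content_ball[of "\<rho> m" "d j"] \<rho>0[of m] by (simp add: B_def vol_def)
  have vol0: "0 < vol m" for m using \<rho>0[of m] by (simp add: vol_def)
  define av where "av m j n = (\<integral>y. indicator (B m j) y * u n y \<partial>lborel) / vol m" for m j n
  have u2: "integrable lborel (\<lambda>x. (u n x)\<^sup>2)" for n using frac_sobolev_borelD(1)[OF u um] .
  have u2R: "(\<integral>x. (u n x)\<^sup>2 \<partial>lborel) \<le> R\<^sup>2" for n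
    using L2_le_frac_sobolev_norm(1)[OF u R, of n] um by (simp add: integral_completion)
  have eR: "(\<integral>x. energy_density \<alpha> (u n) x \<partial>lborel) \<le> R\<^sup>2" for n
    using L2_le_frac_sobolev_norm(2)[OF u R, of n] energy_density_integral(3)[OF u um, of n] by simp
  have young: "\<bar>a\<bar> \<le> 1 + a\<^sup>2" for a :: real
    using abs_le_plus_powr[of 1 2 a] by simp
  define bd where "bd m = (vol m + R\<^sup>2) / vol m" for m
  have av_bd: "\<bar>av m j n\<bar> \<le> bd m" for m j n
  proof -
    have Iind: "integrable lborel (indicator (B m j) :: _ \<Rightarrow> real)"
      unfolding B_def using emeasure_bounded_finite[OF bounded_ball, of "d j" "\<rho> m"] by simp
    have I: "integrable lborel (\<lambda>y. indicator (B m j) y + (u n y)\<^sup>2 :: real)" using Iind u2 by simp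
    have "\<bar>\<integral>y. indicator (B m j) y * u n y \<partial>lborel\<bar> \<le> (\<integral>y. \<bar>indicator (B m j) y * u n y\<bar> \<partial>lborel)"
      by (rule integral_abs_bound)
    also have "\<dots> \<le> (\<integral>y. indicator (B m j) y + (u n y)\<^sup>2 \<partial>lborel)"
      using young by (intro integral_mono' I) (auto simp: indicator_def)
    also have "\<dots> = vol m + (\<integral>y. (u n y)\<^sup>2 \<partial>lborel)" using Iind u2 by (simp add: volB)
    also have "\<dots> \<le> vol m + R\<^sup>2" using u2R by simp
    finally show ?thesis using vol0[of m] by (simp add: av_def bd_def divide_right_mono)
  qed
  have "\<exists>r. strict_mono r \<and> (\<forall>i. convergent (\<lambda>n. av (fst (prod_decode i)) (snd (prod_decode i)) (r n)))"
    using av_bd by (intro diagonal_convergent_subsequence) blast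
  then obtain r where r: "strict_mono r" and conv: "\<And>i. convergent (\<lambda>n. av (fst (prod_decode i)) (snd (prod_decode i)) (r n))"
    by auto
  have conv_av: "convergent (\<lambda>n. av m j (r n))" for m j
    using conv[of "prod_encode (m, j)"] by simp
  define J where "J m x = (LEAST j. dist x (d j) < \<rho> m)" for m x
  have J: "dist x (d (J m x)) < \<rho> m" for m x
    unfolding J_def using dense[OF \<rho>0[of m], of x] by (rule LeastI_ex)
  have Jm[measurable]: "J m \<in> measurable borel (count_space UNIV)" for m
    unfolding J_def by measurable
  define A where "A m n x = av m (J m x) (r n)" for m n x
  have Am[measurable]: "A m n \<in> borel_measurable borel" for m n
    unfolding A_def by measurable
  \<comment> \<open>The weight turns local convergence into convergence in one \<open>L\<^sup>1\<close> space.\<close>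
  obtain w :: "real^'n \<Rightarrow> real" where w[measurable]: "w \<in> borel_measurable lborel"
    and w0: "\<And>x. 0 < w x" and w1: "\<And>x. w x \<le> 1" and wI: "integrable lborel w"
    using sigma_finite_measure.obtain_positive_integrable_function[OF lborel.sigma_finite_measure_axioms] by blast
  define c where "c = 2 powr (?N + \<alpha>) / unit_ball_vol ?N"
  have c0: "0 \<le> c" by (simp add: c_def)
  define W where "W = (\<integral>x. w x \<partial>lborel)"
  have W0: "0 \<le> W" unfolding W_def using w0 by (intro integral_nonneg_AE) (auto intro: less_imp_le)
  have wuI: "integrable lborel (\<lambda>x. w x * u n x)" for n
  proof (rule Bochner_Integration.integrable_bound)
    show "integrable lborel (\<lambda>x. w x + (u n x)\<^sup>2)" using wI u2 by simp
    have "\<bar>w x * u n x\<bar> \<le> w x + (u n x)\<^sup>2" for x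
    proof -
      have "\<bar>w x * u n x\<bar> \<le> w x * (1 + (u n x)\<^sup>2)"
        using young[of "u n x"] w0[of x] by (simp add: abs_mult)
      also have "\<dots> \<le> w x + 1 * (u n x)\<^sup>2" using mult_right_mono[OF w1[of x], of "(u n x)\<^sup>2"] by (simp add: distrib_left)
      finally show ?thesis by simp
    qed
    then show "AE x in lborel. norm (w x * u n x) \<le> norm (w x + (u n x)\<^sup>2)" by (intro AE_I2) (simp add: order_trans[OF _ abs_ge_self])
  qed simp
  have wAI: "integrable lborel (\<lambda>x. w x * A m n x)" for m n
  proof (rule Bochner_Integration.integrable_bound)
    show "integrable lborel (\<lambda>x. w x * bd m)" using wI by simp
    show "AE x in lborel. norm (w x * A m n x) \<le> norm (w x * bd m)"
    proof (intro AE_I2)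
      fix x
      have "0 \<le> bd m" using av_bd[of m 0 0] by linarith
      then show "norm (w x * A m n x) \<le> norm (w x * bd m)"
        using av_bd[of m "J m x" "r n"] w0[of x] by (simp add: A_def abs_mult)
    qed
  qed simp
  have err: "(\<integral>x. \<bar>w x * u (r n) x - w x * A m n x\<bar> \<partial>lborel) \<le> s * W + c * \<rho> m powr \<alpha> * R\<^sup>2 / s" if s: "0 < s" for m n s
  proof -
    have eI: "integrable lborel (energy_density \<alpha> (u (r n)))" using energy_density_integral(2)[OF u um] .
    have I: "integrable lborel (\<lambda>x. s * w x + (c * \<rho> m powr \<alpha> / s) * energy_density \<alpha> (u (r n)) x)"
      using wI eI by simp
    have "AE x in lborel. \<bar>w x * u (r n) x - w x * A m n x\<bar> \<le> s * w x + (c * \<rho> m powr \<alpha> / s) * energy_density \<alpha> (u (r n)) x"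
      using energy_density_integral(1)[OF u[of "r n"] um]
    proof eventually_elim
      case (elim x)
      have "\<bar>u (r n) x - A m n x\<bar> \<le> s + c * \<rho> m powr \<alpha> * energy_density \<alpha> (u (r n)) x / s"
        using local_average_error[OF \<alpha> um u2 elim \<rho>0[of m] J[where m=m] s]
          volB[of m "J m x"] by (simp add: A_def av_def B_def c_def)
      then have "w x * \<bar>u (r n) x - A m n x\<bar> \<le> w x * (s + c * \<rho> m powr \<alpha> * energy_density \<alpha> (u (r n)) x / s)"
        using w0[of x] by (intro mult_left_mono) auto
      also have "\<dots> = s * w x + w x * (c * \<rho> m powr \<alpha> * energy_density \<alpha> (u (r n)) x / s)"
        by (simp add: distrib_left)
      also have "w x * (c * \<rho> m powr \<alpha> * energy_density \<alpha> (u (r n)) x / s) \<le> 1 * (c * \<rho> m powr \<alpha> * energy_density \<alpha> (u (r n)) x / s)"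
        using w1[of x] c0 energy_density_nonneg[of \<alpha> "u (r n)" x] s by (intro mult_right_mono) auto
      finally show ?case using w0[of x] by (simp add: abs_mult flip: right_diff_distrib)
    qed
    then have "(\<integral>x. \<bar>w x * u (r n) x - w x * A m n x\<bar> \<partial>lborel) \<le> (\<integral>x. s * w x + (c * \<rho> m powr \<alpha> / s) * energy_density \<alpha> (u (r n)) x \<partial>lborel)"
      using wuI wAI by (intro integral_mono_AE I) auto
    also have "\<dots> = s * W + (c * \<rho> m powr \<alpha> / s) * (\<integral>x. energy_density \<alpha> (u (r n)) x \<partial>lborel)"
      using wI eI by (simp add: W_def)
    also have "\<dots> \<le> s * W + (c * \<rho> m powr \<alpha> / s) * R\<^sup>2"
      using eR[of "r n"] c0 s by (intro add_mono mult_left_mono) auto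
    finally show ?thesis by simp
  qed
  have A_lim: "(\<lambda>n. \<integral>x. \<bar>w x * A m n x - w x * lim (\<lambda>n. A m n x)\<bar> \<partial>lborel) \<longlonglongrightarrow> 0"
    and A_limI: "integrable lborel (\<lambda>x. w x * lim (\<lambda>n. A m n x))" for m
  proof -
    define L where "L x = lim (\<lambda>n. A m n x)" for x
    have L: "(\<lambda>n. A m n x) \<longlonglongrightarrow> L x" for x
      using conv_av[of m "J m x"] by (simp add: A_def L_def convergent_LIMSEQ_iff)
    have Lm[measurable]: "L \<in> borel_measurable borel"
      unfolding L_def by measurable
    have bd0: "0 \<le> bd m" using av_bd[of m 0 0] by linarith
    have A_le: "\<bar>A m n x\<bar> \<le> bd m" for n x using av_bd by (simp add: A_def)
    have L_le: "\<bar>L x\<bar> \<le> bd m" for x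
      by (rule LIMSEQ_le_const2[OF tendsto_rabs[OF L[of x]]]) (use A_le in auto)
    show "integrable lborel (\<lambda>x. w x * lim (\<lambda>n. A m n x))"
      unfolding L_def[symmetric]
    proof (rule Bochner_Integration.integrable_bound)
      show "integrable lborel (\<lambda>x. w x * bd m)" using wI by simp
      show "AE x in lborel. norm (w x * L x) \<le> norm (w x * bd m)"
        using L_le bd0 by (intro AE_I2) (simp add: abs_mult mult_left_mono)
    qed simp
    have "(\<lambda>n. \<integral>x. \<bar>w x * A m n x - w x * L x\<bar> \<partial>lborel) \<longlonglongrightarrow> (\<integral>x. 0 \<partial>(lborel :: (real^'n) measure))"
    proof (rule integral_dominated_convergence[where w="\<lambda>x. w x * (2 * bd m)"])
      show "integrable lborel (\<lambda>x. w x * (2 * bd m))" using wI by simp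
      show "AE x in lborel. (\<lambda>n. \<bar>w x * A m n x - w x * L x\<bar>) \<longlonglongrightarrow> 0"
      proof (intro AE_I2)
        fix x
        have "(\<lambda>n. \<bar>w x * A m n x - w x * L x\<bar>) \<longlonglongrightarrow> \<bar>w x * L x - w x * L x\<bar>"
          by (intro tendsto_intros L)
        then show "(\<lambda>n. \<bar>w x * A m n x - w x * L x\<bar>) \<longlonglongrightarrow> 0" by simp
      qed
      show "AE x in lborel. norm \<bar>w x * A m n x - w x * L x\<bar> \<le> w x * (2 * bd m)" for n
      proof (intro AE_I2)
        fix x
        have "\<bar>A m n x - L x\<bar> \<le> 2 * bd m" using A_le[of n x] L_le[of x] by linarith
        then have "w x * \<bar>A m n x - L x\<bar> \<le> w x * (2 * bd m)" using w0[of x] by simp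
        then show "norm \<bar>w x * A m n x - w x * L x\<bar> \<le> w x * (2 * bd m)"
          using w0[of x] by (simp add: abs_mult flip: right_diff_distrib)
      qed
    qed auto
    then show "(\<lambda>n. \<integral>x. \<bar>w x * A m n x - w x * lim (\<lambda>n. A m n x)\<bar> \<partial>lborel) \<longlonglongrightarrow> 0"
      by (simp add: L_def)
  qed
  have cauchy: "\<exists>M. \<forall>i\<ge>M. \<forall>j\<ge>M. (\<integral>x. norm (w x * u (r i) x - w x * u (r j) x) \<partial>lborel) < e" if e: "0 < e" for e
  proof -
    define s where "s = e / (8 * (W + 1))"
    have s: "0 < s" using e W0 by (simp add: s_def)
    have sW: "s * W \<le> e / 8" using e W0 by (simp add: s_def field_simps)
    have "(\<lambda>m. c * \<rho> m powr \<alpha> * R\<^sup>2 / s) \<longlonglongrightarrow> c * 0 * R\<^sup>2 / s"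
    proof (intro tendsto_intros)
      have "\<rho> \<longlonglongrightarrow> 0" unfolding \<rho>_def by (rule LIMSEQ_Suc[OF lim_1_over_n])
      then show "(\<lambda>m. \<rho> m powr \<alpha>) \<longlonglongrightarrow> 0"
        using tendsto_powr2[of \<rho> 0 sequentially "\<lambda>_. \<alpha>" \<alpha>] \<alpha> \<rho>0 by (auto simp: less_imp_le)
    qed (use s in auto)
    then have "\<forall>\<^sub>F m in sequentially. c * \<rho> m powr \<alpha> * R\<^sup>2 / s < e / 8"
      using e by (intro order_tendstoD(2)) auto
    then obtain m where m: "c * \<rho> m powr \<alpha> * R\<^sup>2 / s < e / 8" by (auto simp: eventually_sequentially)
    let ?L = "\<lambda>x. lim (\<lambda>n. A m n x)"
    have "\<forall>\<^sub>F n in sequentially. (\<integral>x. \<bar>w x * A m n x - w x * ?L x\<bar> \<partial>lborel) < e / 8"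
      using A_lim[of m] e by (intro order_tendstoD(2)) auto
    then obtain M where M: "\<And>n. n \<ge> M \<Longrightarrow> (\<integral>x. \<bar>w x * A m n x - w x * ?L x\<bar> \<partial>lborel) < e / 8"
      by (auto simp: eventually_sequentially)
    have one: "(\<integral>x. \<bar>w x * u (r i) x - w x * ?L x\<bar> \<partial>lborel) < e / 2" if "i \<ge> M" for i
    proof -
      have "(\<integral>x. \<bar>w x * u (r i) x - w x * ?L x\<bar> \<partial>lborel) \<le>
        (\<integral>x. \<bar>w x * u (r i) x - w x * A m i x\<bar> + \<bar>w x * A m i x - w x * ?L x\<bar> \<partial>lborel)"
        using wuI wAI A_limI by (intro integral_mono) auto
      also have "\<dots> = (\<integral>x. \<bar>w x * u (r i) x - w x * A m i x\<bar> \<partial>lborel) + (\<integral>x. \<bar>w x * A m i x - w x * ?L x\<bar> \<partial>lborel)"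
        using wuI wAI A_limI by (intro Bochner_Integration.integral_add) auto
      also have "\<dots> < e / 2" using err[OF s, of i m] sW m M[OF that] e by linarith
      finally show ?thesis .
    qed
    show ?thesis
    proof (intro exI[of _ M] allI impI)
      fix i j assume ij: "i \<ge> M" "j \<ge> M"
      have "(\<integral>x. norm (w x * u (r i) x - w x * u (r j) x) \<partial>lborel) \<le>
        (\<integral>x. \<bar>w x * u (r i) x - w x * ?L x\<bar> + \<bar>w x * u (r j) x - w x * ?L x\<bar> \<partial>lborel)"
        using wuI A_limI by (intro integral_mono) auto
      also have "\<dots> = (\<integral>x. \<bar>w x * u (r i) x - w x * ?L x\<bar> \<partial>lborel) + (\<integral>x. \<bar>w x * u (r j) x - w x * ?L x\<bar> \<partial>lborel)"
        using wuI A_limI by (intro Bochner_Integration.integral_add) auto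
      also have "\<dots> < e" using one[OF ij(1)] one[OF ij(2)] by linarith
      finally show "(\<integral>x. norm (w x * u (r i) x - w x * u (r j) x) \<partial>lborel) < e" .
    qed
  qed
  obtain r' where r': "strict_mono r'" and C: "AE x in lborel. Cauchy (\<lambda>i. w x * u (r (r' i)) x)"
    using cauchy_L1_AE_cauchy_subseq[of lborel "\<lambda>n x. w x * u (r n) x", OF wuI cauchy] by blast
  define v where "v x = lim (\<lambda>n. u (r (r' n)) x)" for x
  show ?thesis
  proof (intro exI[of _ "r \<circ> r'"] exI[of _ v] conjI)
    show "strict_mono (r \<circ> r')" using r r' by (rule strict_mono_o)
    show "v \<in> borel_measurable borel" unfolding v_def by measurable
    show "AE x in lborel. (\<lambda>n. u ((r \<circ> r') n) x) \<longlonglongrightarrow> v x"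
      using C
    proof eventually_elim
      case (elim x)
      then obtain l where "(\<lambda>i. w x * u (r (r' i)) x) \<longlonglongrightarrow> l"
        using Cauchy_convergent convergent_def by blast
      then have "(\<lambda>i. w x * u (r (r' i)) x / w x) \<longlonglongrightarrow> l / w x"
        using w0[of x] by (intro tendsto_divide tendsto_const) auto
      then have "(\<lambda>i. u (r (r' i)) x) \<longlonglongrightarrow> l / w x" using w0[of x] less_irrefl by fastforce
      then show ?case by (auto simp: v_def convergent_LIMSEQ_iff[symmetric] convergent_def)
    qed
  qed
qed

text \<open>
  The limit belongs to the space by Fatou's lemma, applied to \<open>u\<close> and to its difference quotient.
\<close>

lemma bounded_AE_convergent_subsequence:
  fixes u :: "nat \<Rightarrow> real^'n \<Rightarrow> real"
  assumes \<alpha>: "0 < \<alpha>" and u: "\<And>n. u n \<in> frac_sobolev \<alpha>" and R: "\<And>n. frac_sobolev_norm \<alpha> (u n) \<le> R"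
  shows "\<exists>r v. strict_mono r \<and> v \<in> frac_sobolev \<alpha> \<and> (AE x in lebesgue. (\<lambda>n. u (r n) x) \<longlonglongrightarrow> v x)
    \<and> (AE p in lebesgue. (\<lambda>n. diff_quot \<alpha> (u (r n)) p) \<longlonglongrightarrow> diff_quot \<alpha> v p)"
proof -
  have "\<exists>v. v \<in> borel_measurable borel \<and> (AE x in lebesgue. u n x = v x) \<and> v \<in> frac_sobolev \<alpha>" for n
    using frac_sobolev_borel_representative[OF u[of n]] by metis
  then obtain b where b: "\<And>n. b n \<in> borel_measurable borel" "\<And>n. AE x in lebesgue. u n x = b n x" "\<And>n. b n \<in> frac_sobolev \<alpha>"
    by metis
  have bR: "frac_sobolev_norm \<alpha> (b n) \<le> R" for n
    using R frac_sobolev_AE_cong(4)[OF u b(2)] by simp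
  obtain r v where r: "strict_mono r" and vm: "v \<in> borel_measurable borel" and lim: "AE x in lborel. (\<lambda>n. b (r n) x) \<longlonglongrightarrow> v x"
    using bounded_AE_convergent_subsequence_borel[where u=b, OF \<alpha> b(3) b(1) bR] by (elim exE conjE) (rule that)
  have all: "AE x in lebesgue. \<forall>n. u n x = b n x" using b(2) by (simp add: AE_all_countable)
  have ulim: "AE x in lebesgue. (\<lambda>n. u (r n) x) \<longlonglongrightarrow> v x"
    using AE_completion[OF lim] all by eventually_elim simp
  have ulim': "AE x in lborel. (\<lambda>n. u (r n) x) \<longlonglongrightarrow> v x"
    using ulim by (simp add: AE_completion_iff)
  have dlim: "AE p in lebesgue. (\<lambda>n. diff_quot \<alpha> (u (r n)) p) \<longlonglongrightarrow> diff_quot \<alpha> v p"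
  proof (rule AE_completion)
    show "AE p in lborel. (\<lambda>n. diff_quot \<alpha> (u (r n)) p) \<longlonglongrightarrow> diff_quot \<alpha> v p"
      using AE_lborel_fst_snd(1)[OF ulim'] AE_lborel_fst_snd(2)[OF ulim']
    proof eventually_elim
      case (elim p)
      show ?case
      proof (cases "fst p = snd p")
        case False
        then have "norm (fst p - snd p) powr ((real CARD('n) + \<alpha>) / 2) \<noteq> 0" by simp
        then show ?thesis unfolding diff_quot_def case_prod_unfold by (intro tendsto_intros elim)
      qed (simp add: diff_quot_def case_prod_unfold)
    qed
  qed
  have vml: "v \<in> borel_measurable lebesgue" using vm by (intro measurable_completion) simp
  have "integrable lebesgue (\<lambda>x. (v x)\<^sup>2)"
  proof (rule fatou_integrable)
    show "AE x in lebesgue. (\<lambda>n. (u (r n) x)\<^sup>2) \<longlonglongrightarrow> (v x)\<^sup>2"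
      using ulim by eventually_elim (intro tendsto_intros)
    show "(\<integral>x. (u (r n) x)\<^sup>2 \<partial>lebesgue) \<le> R\<^sup>2" for n
      by (rule L2_le_frac_sobolev_norm(1)[OF u R])
  qed (use frac_sobolevD(2)[OF u] vml in auto)
  moreover have "integrable lebesgue (\<lambda>p. (diff_quot \<alpha> v p)\<^sup>2)"
  proof (rule fatou_integrable)
    show "AE p in lebesgue. (\<lambda>n. (diff_quot \<alpha> (u (r n)) p)\<^sup>2) \<longlonglongrightarrow> (diff_quot \<alpha> v p)\<^sup>2"
      using dlim by eventually_elim (intro tendsto_intros)
    show "(\<integral>p. (diff_quot \<alpha> (u (r n)) p)\<^sup>2 \<partial>lebesgue) \<le> R\<^sup>2" for n
      using L2_le_frac_sobolev_norm(2)[OF u R, of "r n"] by (simp add: gagliardo_eq)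
  qed (use frac_sobolevD(3)[OF u] borel_measurable_diff_quot[OF vml] in auto)
  ultimately have "v \<in> frac_sobolev \<alpha>" using vml by (simp add: frac_sobolev_iff)
  then show ?thesis using r ulim dlim by blast
qed


section \<open>The nonlinearity\<close>

lemma abs_powr_tendsto_0:
  fixes r :: real
  assumes "0 < r"
  shows "((\<lambda>h::real. \<bar>h\<bar> powr r) \<longlongrightarrow> 0) (at 0)"
proof -
  have "((\<lambda>h::real. \<bar>h\<bar>) \<longlongrightarrow> 0) (at 0)" by (rule tendsto_rabs_zero[OF tendsto_ident_at])
  from tendsto_powr2[OF this tendsto_const, of r] show ?thesis using assms by simp
qed

lemma DERIV_abs_powr:
  fixes r s :: real
  assumes r: "1 < r"
  shows "((\<lambda>s. \<bar>s\<bar> powr r) has_real_derivative r * (\<bar>s\<bar> powr (r - 2) * s)) (at s)"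
proof (cases s "0::real" rule: linorder_cases)
  case equal
  have "((\<lambda>h. \<bar>h\<bar> powr r / h) \<longlongrightarrow> 0) (at (0::real))"
  proof (rule Lim_null_comparison)
    show "\<forall>\<^sub>F h in at 0. norm (\<bar>h\<bar> powr r / h) \<le> \<bar>h\<bar> powr (r - 1)"
    proof (intro always_eventually allI)
      fix h :: real
      show "norm (\<bar>h\<bar> powr r / h) \<le> \<bar>h\<bar> powr (r - 1)"
        by (cases "h = 0") (simp_all add: powr_diff abs_divide)
    qed
    show "((\<lambda>h::real. \<bar>h\<bar> powr (r - 1)) \<longlongrightarrow> 0) (at 0)"
      using r by (intro abs_powr_tendsto_0) simp
  qed
  then show ?thesis using equal r by (simp add: DERIV_def)
next
  case greater
  have "((\<lambda>s. s powr r) has_real_derivative r * s powr (r - 1)) (at s)"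
    using greater by (auto intro!: derivative_eq_intros)
  moreover have "s powr (r - 1) = \<bar>s\<bar> powr (r - 2) * s"
    using greater powr_add[of s "r - 2" 1] by simp
  moreover have "\<forall>\<^sub>F x in nhds s. \<bar>x\<bar> powr r = x powr r"
    using greater eventually_nhds_in_open[of "{0<..}" s] by (auto elim!: eventually_mono)
  ultimately show ?thesis by (subst DERIV_cong_ev[OF refl _ refl]) auto
next
  case less
  have "((\<lambda>s. (- s) powr r) has_real_derivative r * ((- s) powr (r - 1) * (- 1))) (at s)"
    using less by (auto intro!: derivative_eq_intros)
  moreover have "(- s) powr (r - 1) * (- 1) = \<bar>s\<bar> powr (r - 2) * s"
    using less powr_add[of "- s" "r - 2" 1] by simp
  moreover have "\<forall>\<^sub>F x in nhds s. \<bar>x\<bar> powr r = (- x) powr r"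
    using less eventually_nhds_in_open[of "{..<0}" s] by (auto elim!: eventually_mono)
  ultimately have "((\<lambda>s. (- s) powr r) has_real_derivative r * (\<bar>s\<bar> powr (r - 2) * s)) (at s)"
    "\<forall>\<^sub>F x in nhds s. \<bar>x\<bar> powr r = (- x) powr r" by (simp_all only:)
  then show ?thesis by (subst DERIV_cong_ev[OF refl _ refl]) auto
qed

lemma DERIV_signed_powr:
  fixes r s :: real
  assumes r: "0 < r"
  shows "((\<lambda>s. \<bar>s\<bar> powr r * s) has_real_derivative (r + 1) * \<bar>s\<bar> powr r) (at s)"
proof (cases s "0::real" rule: linorder_cases)
  case equal
  have "((\<lambda>h::real. \<bar>h\<bar> powr r) \<longlongrightarrow> 0) (at 0)"
    using r by (rule abs_powr_tendsto_0)
  moreover have "\<forall>\<^sub>F h in at 0. \<bar>h\<bar> powr r = \<bar>h\<bar> powr r * h / h" for r :: real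
    by (auto simp: eventually_at intro!: exI[of _ 1])
  ultimately have "((\<lambda>h::real. \<bar>h\<bar> powr r * h / h) \<longlongrightarrow> 0) (at 0)"
    using tendsto_cong by fastforce
  then show ?thesis using equal r by (simp add: DERIV_def)
next
  case greater
  have "((\<lambda>s. s powr (r + 1)) has_real_derivative (r + 1) * s powr (r + 1 - 1)) (at s)"
    using greater by (auto intro!: derivative_eq_intros)
  moreover have "\<forall>\<^sub>F x in nhds s. \<bar>x\<bar> powr r * x = x powr (r + 1)"
    using greater eventually_nhds_in_open[of "{0<..}" s] by (auto elim!: eventually_mono simp: powr_add)
  ultimately show ?thesis using greater by (subst DERIV_cong_ev[OF refl _ refl]) auto
next
  case less
  have "((\<lambda>s. - ((- s) powr (r + 1))) has_real_derivative - ((r + 1) * ((- s) powr (r + 1 - 1) * (- 1)))) (at s)"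
    using less by (auto intro!: derivative_eq_intros)
  moreover have "\<forall>\<^sub>F x in nhds s. \<bar>x\<bar> powr r * x = - ((- x) powr (r + 1))"
    using less eventually_nhds_in_open[of "{..<0}" s] by (auto elim!: eventually_mono simp: powr_add)
  ultimately show ?thesis using less by (subst DERIV_cong_ev[OF refl _ refl]) auto
qed

lemma lipschitz_from_derivative_growth:
  fixes h :: "real \<Rightarrow> real"
  assumes d: "\<And>s. (h has_real_derivative h' s) (at s)" and b: "\<And>s. \<bar>h' s\<bar> \<le> c * (1 + \<bar>s\<bar> powr r)"
    and "0 \<le> c" "0 \<le> r"
  shows "\<bar>h a - h b\<bar> \<le> c * \<bar>a - b\<bar> * (1 + \<bar>a\<bar> powr r + \<bar>b\<bar> powr r)"
proof -
  have *: "\<bar>h a - h b\<bar> \<le> c * \<bar>a - b\<bar> * (1 + \<bar>a\<bar> powr r + \<bar>b\<bar> powr r)" if ab: "a < b" for a b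
  proof -
    obtain z where z: "a < z" "z < b" "h b - h a = (b - a) * h' z"
      using MVT2[OF ab, of h h'] d by auto
    have "\<bar>z\<bar> powr r \<le> \<bar>a\<bar> powr r + \<bar>b\<bar> powr r"
    proof (cases "\<bar>z\<bar> \<le> \<bar>a\<bar>")
      case True
      then have "\<bar>z\<bar> powr r \<le> \<bar>a\<bar> powr r" using assms by (intro powr_mono2) auto
      then show ?thesis by (simp add: add_increasing2)
    next
      case False
      then have "\<bar>z\<bar> \<le> \<bar>b\<bar>" using z by linarith
      then have "\<bar>z\<bar> powr r \<le> \<bar>b\<bar> powr r" using assms by (intro powr_mono2) auto
      then show ?thesis by (simp add: add_increasing)
    qed
    then have "\<bar>h' z\<bar> \<le> c * (1 + \<bar>a\<bar> powr r + \<bar>b\<bar> powr r)"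
      using b[of z] \<open>0 \<le> c\<close> by (meson add_left_mono mult_left_mono order_trans add.assoc[symmetric, THEN eq_refl])
    then have "\<bar>b - a\<bar> * \<bar>h' z\<bar> \<le> \<bar>b - a\<bar> * (c * (1 + \<bar>a\<bar> powr r + \<bar>b\<bar> powr r))"
      by (rule mult_left_mono) simp
    then have "\<bar>h b - h a\<bar> \<le> \<bar>b - a\<bar> * (c * (1 + \<bar>a\<bar> powr r + \<bar>b\<bar> powr r))"
      by (simp add: z(3) abs_mult)
    then show ?thesis by (simp add: abs_minus_commute mult.commute mult.left_commute)
  qed
  show ?thesis
  proof (cases a b rule: linorder_cases)
    case less then show ?thesis by (rule *)
  next
    case greater
    from *[OF this] show ?thesis by (simp add: abs_minus_commute add_ac)
  qed simp
qed

text \<open>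
  \<open>u\<close> is approximated by functions \<open>a n\<close> with countably many values.
\<close>

lemma caratheodory_measurable:
  fixes h :: "'a::euclidean_space \<Rightarrow> real \<Rightarrow> real"
  assumes h: "\<And>s. (\<lambda>x. h x s) \<in> borel_measurable lebesgue"
    and cont: "AE x in lebesgue. continuous_on UNIV (h x)"
    and u[measurable]: "u \<in> borel_measurable lebesgue"
  shows "(\<lambda>x. h x (u x)) \<in> borel_measurable lebesgue"
proof -
  define a where "a n x = real_of_int \<lfloor>real (Suc n) * u x\<rfloor> / real (Suc n)" for n x
  have m: "(\<lambda>x. h x (a n x)) \<in> borel_measurable lebesgue" for n
  proof -
    have "(\<lambda>x. \<lfloor>real (Suc n) * u x\<rfloor>) \<in> measurable lebesgue (count_space UNIV)" by measurable
    from measurable_compose_countable[OF h this, of "\<lambda>i. real_of_int i / real (Suc n)"]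
    show ?thesis by (simp add: a_def)
  qed
  have lim: "(\<lambda>n. a n x) \<longlonglongrightarrow> u x" for x
  proof (rule LIM_zero_cancel, rule Lim_null_comparison)
    show "\<forall>\<^sub>F n in sequentially. norm (a n x - u x) \<le> 1 / real (Suc n)"
    proof (intro always_eventually allI)
      fix n
      have "\<bar>real_of_int \<lfloor>real (Suc n) * u x\<rfloor> - real (Suc n) * u x\<bar> \<le> 1" by linarith
      then have "\<bar>real_of_int \<lfloor>real (Suc n) * u x\<rfloor> - real (Suc n) * u x\<bar> / real (Suc n) \<le> 1 / real (Suc n)"
        by (intro divide_right_mono) auto
      also have "\<bar>real_of_int \<lfloor>real (Suc n) * u x\<rfloor> - real (Suc n) * u x\<bar> / real (Suc n) = norm (a n x - u x)"
      proof -
        have "a n x - u x = (real_of_int \<lfloor>real (Suc n) * u x\<rfloor> - real (Suc n) * u x) / real (Suc n)"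
          by (simp add: a_def diff_divide_distrib del: of_nat_Suc)
        then show ?thesis by (simp add: abs_divide del: of_nat_Suc)
      qed
      finally show "norm (a n x - u x) \<le> 1 / real (Suc n)" .
    qed
    show "(\<lambda>n. 1 / real (Suc n)) \<longlonglongrightarrow> 0" by (rule LIMSEQ_Suc[OF lim_1_over_n])
  qed
  have "(\<lambda>x. lim (\<lambda>n. h x (a n x))) \<in> borel_measurable lebesgue"
    using m by measurable
  moreover have "AE x in lebesgue. lim (\<lambda>n. h x (a n x)) = h x (u x)"
    using cont
  proof eventually_elim
    case (elim x)
    have "(\<lambda>n. h x (a n x)) \<longlonglongrightarrow> h x (u x)"
      using elim lim[of x] by (intro continuous_on_tendsto_compose[of UNIV "h x"]) auto
    then show ?case by (rule limI)
  qed
  ultimately show ?thesis by (rule borel_measurable_AE)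
qed

lemma primitive_DERIV:
  assumes "continuous_on UNIV (f x)"
  shows "(primitive f x has_real_derivative f x s) (at s)"
proof -
  define a where "a = - \<bar>s\<bar> - 1"
  define b where "b = \<bar>s\<bar> + 1"
  have "((\<lambda>u. LBINT y=ereal 0..ereal u. f x y) has_vector_derivative f x s) (at s within {a..b})"
    using interval_integral_FTC2[of a 0 b "f x" s] continuous_on_subset[OF assms, of "{a..b}"]
    by (auto simp: a_def b_def)
  then have "((\<lambda>u. LBINT y=ereal 0..ereal u. f x y) has_vector_derivative f x s) (at s within {a<..<b})"
    by (rule has_vector_derivative_within_subset) auto
  moreover have "s \<in> {a<..<b}" by (auto simp: a_def b_def)
  ultimately show ?thesis
    by (simp add: primitive_def[abs_def] has_real_derivative_iff_has_vector_derivative at_within_open[OF _ open_greaterThanLessThan])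
qed

lemma primitive_0: "primitive f x 0 = 0"
  by (simp add: primitive_def zero_ereal_def[symmetric])

text \<open>
  The integrand is replaced by a Borel function on the product, for which Fubini's theorem gives
  measurability of the partial integral.
\<close>

lemma primitive_measurable_fixed:
  fixes f :: "real^'n \<Rightarrow> real \<Rightarrow> real"
  assumes fm: "(\<lambda>(x, u). f x u) \<in> borel_measurable lebesgue"
    and cont: "AE x in lebesgue. continuous_on UNIV (f x)"
  shows "(\<lambda>x. primitive f x s) \<in> borel_measurable lebesgue"
proof -
  obtain h where h: "h \<in> borel_measurable (lborel :: ((real^'n) \<times> real) measure)"
    and fh: "AE p in lborel. (\<lambda>(x, u). f x u) p = h p"
    using completion_ex_borel_measurable_real[OF fm] by auto
  have hm[measurable]: "h \<in> borel_measurable (borel \<Otimes>\<^sub>M borel)" using h by (simp add: borel_prod)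
  have "AE p in lborel \<Otimes>\<^sub>M lborel. (\<lambda>(x, u). f x u) p = h p" using fh by (simp only: lborel_prod)
  from lborel_pair.AE_pair[OF this]
  have ae: "AE x in lborel. AE t in lborel. f x t = h (x, t)" by simp
  have "(\<lambda>x. LBINT t=ereal 0..ereal s. h (x, t)) \<in> borel_measurable borel"
    unfolding interval_lebesgue_integral_def set_lebesgue_integral_def by measurable
  then have "(\<lambda>x. LBINT t=ereal 0..ereal s. h (x, t)) \<in> borel_measurable lebesgue"
    by (intro measurable_completion) simp
  moreover have "AE x in lebesgue. (LBINT t=ereal 0..ereal s. h (x, t)) = primitive f x s"
    using AE_completion[OF ae] cont
  proof eventually_elim
    case (elim x)
    have [measurable]: "f x \<in> borel_measurable borel"
      using elim(2) by (rule borel_measurable_continuous_onI)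
    have *: "(LBINT t:A. h (x, t)) = (LBINT t:A. f x t)" if [measurable]: "A \<in> sets borel" for A
      unfolding set_lebesgue_integral_def
    proof (rule integral_cong_AE)
      show "AE t in lborel. indicator A t *\<^sub>R h (x, t) = indicator A t *\<^sub>R f x t"
        using elim(1) by eventually_elim simp
    qed measurable
    show ?case unfolding primitive_def interval_lebesgue_integral_def by (simp add: *)
  qed
  ultimately show ?thesis by (rule borel_measurable_AE)
qed

lemma primitive_measurable:
  fixes f :: "real^'n \<Rightarrow> real \<Rightarrow> real"
  assumes fm: "(\<lambda>(x, u). f x u) \<in> borel_measurable lebesgue"
    and cont: "AE x in lebesgue. continuous_on UNIV (f x)"
    and u: "u \<in> borel_measurable lebesgue"
  shows "(\<lambda>x. primitive f x (u x)) \<in> borel_measurable lebesgue"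
proof (rule caratheodory_measurable[OF primitive_measurable_fixed[OF fm cont] _ u])
  show "AE x in lebesgue. continuous_on UNIV (primitive f x)"
    using cont
  proof eventually_elim
    case (elim x)
    show ?case
      using DERIV_isCont[OF primitive_DERIV[of f x, OF elim]] by (simp add: continuous_on_eq_continuous_at)
  qed
qed

text \<open>
  Joint Lebesgue measurability of \<open>f\<close> says nothing about the values on the graph of \<open>u\<close>, which is a
  null set; continuity in the second variable recovers \<open>f x (u x)\<close> as a limit of difference
  quotients of the primitive.
\<close>

lemma nonlinearity_measurable:
  fixes f :: "real^'n \<Rightarrow> real \<Rightarrow> real"
  assumes fm: "(\<lambda>(x, u). f x u) \<in> borel_measurable lebesgue"
    and cont: "AE x in lebesgue. continuous_on UNIV (f x)"
    and u[measurable]: "u \<in> borel_measurable lebesgue"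
  shows "(\<lambda>x. f x (u x)) \<in> borel_measurable lebesgue"
proof -
  define D where "D n x = (primitive f x (u x + 1 / real (Suc n)) - primitive f x (u x)) / (1 / real (Suc n))" for n x
  have "D n \<in> borel_measurable lebesgue" for n
  proof -
    have 1: "(\<lambda>x. primitive f x (u x + 1 / real (Suc n))) \<in> borel_measurable lebesgue"
      by (rule primitive_measurable[OF fm cont]) measurable
    have 2: "(\<lambda>x. primitive f x (u x)) \<in> borel_measurable lebesgue"
      by (rule primitive_measurable[OF fm cont]) measurable
    show ?thesis unfolding D_def using 1 2 by measurable
  qed
  then have "(\<lambda>x. lim (\<lambda>n. D n x)) \<in> borel_measurable lebesgue" by measurable
  moreover have "AE x in lebesgue. lim (\<lambda>n. D n x) = f x (u x)"
    using cont
  proof eventually_elim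
    case (elim x)
    have "(\<lambda>h. (primitive f x (u x + h) - primitive f x (u x)) / h) \<midarrow>0\<rightarrow> f x (u x)"
      using primitive_DERIV[of f x "u x", OF elim] by (simp add: DERIV_def)
    moreover have "filterlim (\<lambda>n. 1 / real (Suc n)) (at 0) sequentially"
      using LIMSEQ_Suc[OF lim_1_over_n] by (intro filterlim_atI) auto
    ultimately have "(\<lambda>n. D n x) \<longlonglongrightarrow> f x (u x)"
      unfolding D_def by (rule filterlim_compose)
    then show ?case by (rule limI)
  qed
  ultimately show ?thesis by (rule borel_measurable_AE)
qed

text \<open>
  The competing nonlinear terms are treated as one, because the variational argument uses only their
  combined growth and monotonicity.
\<close>

definition total_force :: "(real^'n \<Rightarrow> real \<Rightarrow> real) \<Rightarrow> (real^'n \<Rightarrow> real) \<Rightarrow> real \<Rightarrow> real^'n \<Rightarrow> real \<Rightarrow> real" where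
  "total_force f K q x s = f x s - K x * (\<bar>s\<bar> powr (q - 2) * s)"

definition total_potential :: "(real^'n \<Rightarrow> real \<Rightarrow> real) \<Rightarrow> (real^'n \<Rightarrow> real) \<Rightarrow> real \<Rightarrow> real^'n \<Rightarrow> real \<Rightarrow> real" where
  "total_potential f K q x s = primitive f x s - 1 / q * K x * \<bar>s\<bar> powr q"

lemma total_potential_0: "total_potential f K q x 0 = 0"
  by (simp add: total_potential_def primitive_0)

lemma total_potential_DERIV:
  assumes "continuous_on UNIV (f x)" "1 < q"
  shows "(total_potential f K q x has_real_derivative total_force f K q x s) (at s)"
proof -
  have "((\<lambda>s. primitive f x s - 1 / q * K x * \<bar>s\<bar> powr q) has_real_derivative
      f x s - 1 / q * K x * (q * (\<bar>s\<bar> powr (q - 2) * s))) (at s)"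
    using primitive_DERIV[of f x s, OF assms(1)] DERIV_abs_powr[OF assms(2), of s]
    by (intro DERIV_diff DERIV_cmult)
  then show ?thesis using assms by (simp add: total_potential_def[abs_def] total_force_def)
qed

text \<open>
  Monotonicity of \<open>f(x,u)/|u|\<^bsup>q-1\<^esup>\<close> integrated along the ray through \<open>s\<close>; the \<open>K\<close>-term is
  \<open>q\<close>-homogeneous and contributes an equality. For \<open>t = 0\<close> this is an Ambrosetti-Rabinowitz
  condition with exponent \<open>q\<close>.
\<close>

lemma total_potential_along_ray:
  assumes cont: "continuous_on UNIV (f x)" and q: "1 < q" and f0: "f x 0 = 0"
    and mono: "mono_on {..<0} (\<lambda>u. f x u / \<bar>u\<bar> powr (q - 1))" "mono_on {0<..} (\<lambda>u. f x u / \<bar>u\<bar> powr (q - 1))"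
    and t: "0 \<le> t"
  shows "(t powr q - 1) / q * (total_force f K q x s * s) \<le> total_potential f K q x (t * s) - total_potential f K q x s"
proof (cases "s = 0")
  case True
  then show ?thesis by (simp add: total_potential_0)
next
  case s: False
  let ?g = "total_force f K q x" and ?G = "total_potential f K q x"
  have f_hom: "(f x (t * s) - t powr (q - 1) * f x s) * s * (t - 1) \<ge> 0" if t: "0 < t" for t
  proof -
    define \<phi> where "\<phi> u = f x u / \<bar>u\<bar> powr (q - 1)" for u
    have *: "f x (t * s) - t powr (q - 1) * f x s = \<bar>t * s\<bar> powr (q - 1) * (\<phi> (t * s) - \<phi> s)"
    proof -
      have "\<bar>t * s\<bar> powr (q - 1) = t powr (q - 1) * \<bar>s\<bar> powr (q - 1)" using t by (simp add: abs_mult powr_mult)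
      moreover have "\<bar>t * s\<bar> powr (q - 1) \<noteq> 0" "\<bar>s\<bar> powr (q - 1) \<noteq> 0" using t s by simp_all
      ultimately show ?thesis by (simp add: \<phi>_def right_diff_distrib)
    qed
    have "(\<phi> (t * s) - \<phi> s) * (s * (t - 1)) \<ge> 0"
    proof (cases "0 < s")
      case True
      have m: "mono_on {0<..} \<phi>" using mono(2) by (simp add: \<phi>_def[abs_def])
      show ?thesis
      proof (cases "1 \<le> t")
        case True
        then have "\<phi> s \<le> \<phi> (t * s)" using \<open>0 < s\<close> t by (intro mono_onD[OF m]) auto
        then show ?thesis using True \<open>0 < s\<close> by simp
      next
        case False
        then have "\<phi> (t * s) \<le> \<phi> s" using \<open>0 < s\<close> t by (intro mono_onD[OF m]) auto
        then show ?thesis using False \<open>0 < s\<close> by (intro mult_nonpos_nonpos) (auto intro: mult_nonneg_nonpos)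
      qed
    next
      case False
      then have s0: "s < 0" using s by simp
      have m: "mono_on {..<0} \<phi>" using mono(1) by (simp add: \<phi>_def[abs_def])
      show ?thesis
      proof (cases "1 \<le> t")
        case True
        have "t * s \<le> 1 * s" using True s0 by (intro mult_right_mono_neg) auto
        then have "\<phi> (t * s) \<le> \<phi> s" using s0 t by (intro mono_onD[OF m]) (auto simp: mult_pos_neg)
        then show ?thesis using True s0 by (intro mult_nonpos_nonpos) (auto intro: mult_nonpos_nonneg)
      next
        case False
        have "1 * s \<le> t * s" using False s0 by (intro mult_right_mono_neg) auto
        then have "\<phi> s \<le> \<phi> (t * s)" using s0 t by (intro mono_onD[OF m]) (auto simp: mult_pos_neg)
        moreover have "0 \<le> s * (t - 1)" using False s0 by (intro mult_nonpos_nonpos) auto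
        ultimately show ?thesis by simp
      qed
    qed
    then have "0 \<le> \<bar>t * s\<bar> powr (q - 1) * ((\<phi> (t * s) - \<phi> s) * (s * (t - 1)))" by simp
    then show ?thesis unfolding * by (simp add: mult_ac)
  qed
  have g_hom: "(?g (t * s) - t powr (q - 1) * ?g s) * s * (t - 1) \<ge> 0" if t: "0 < t" for t
  proof -
    have "\<bar>t * s\<bar> powr (q - 2) = t powr (q - 2) * \<bar>s\<bar> powr (q - 2)"
      using t by (simp add: abs_mult powr_mult)
    moreover have "t powr (q - 1) = t powr (q - 2) * t"
      using t powr_add[of t "q - 2" 1] by simp
    ultimately have "\<bar>t * s\<bar> powr (q - 2) * (t * s) = t powr (q - 1) * (\<bar>s\<bar> powr (q - 2) * s)"
      by simp
    then have "?g (t * s) = f x (t * s) - K x * (t powr (q - 1) * (\<bar>s\<bar> powr (q - 2) * s))"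
      by (simp only: total_force_def)
    then have "?g (t * s) - t powr (q - 1) * ?g s = f x (t * s) - t powr (q - 1) * f x s"
      by (simp add: total_force_def algebra_simps)
    then show ?thesis using f_hom[OF t] by simp
  qed
  define \<psi> where "\<psi> t = ?G (t * s) - \<bar>t\<bar> powr q / q * (?g s * s)" for t
  define \<psi>' where "\<psi>' t = ?g (t * s) * s - \<bar>t\<bar> powr (q - 2) * t * (?g s * s)" for t
  have d: "(\<psi> has_real_derivative \<psi>' t) (at t)" for t
  proof -
    have "((\<lambda>t. ?G (t * s)) has_real_derivative ?g (t * s) * s) (at t)"
      by (rule DERIV_chain2[OF total_potential_DERIV[of f x, OF cont q]]) (auto intro!: derivative_eq_intros)
    moreover have "((\<lambda>t. \<bar>t\<bar> powr q / q * (?g s * s)) has_real_derivative (q * (\<bar>t\<bar> powr (q - 2) * t)) / q * (?g s * s)) (at t)"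
      by (intro DERIV_cmult_right DERIV_cdivide DERIV_abs_powr q)
    ultimately show ?thesis unfolding \<psi>_def[abs_def] \<psi>'_def using q by (auto intro: DERIV_diff)
  qed
  have \<psi>'_sign: "\<psi>' t * (t - 1) \<ge> 0" if "0 \<le> t" for t
  proof (cases "t = 0")
    case True
    then show ?thesis using f0 by (simp add: \<psi>'_def total_force_def)
  next
    case False
    then have "0 < t" using that by simp
    then have "\<bar>t\<bar> powr (q - 2) * t = t powr (q - 1)" using powr_add[of t "q - 2" 1] by simp
    then show ?thesis using g_hom[OF \<open>0 < t\<close>] by (simp add: \<psi>'_def algebra_simps)
  qed
  have "\<psi> 1 \<le> \<psi> t"
  proof (cases "1 \<le> t")
    case True
    show ?thesis
    proof (rule DERIV_nonneg_imp_nondecreasing[OF True])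
      fix y assume y: "1 \<le> y" "y \<le> t"
      have "0 \<le> \<psi>' y"
      proof (cases "y = 1")
        case True then show ?thesis by (simp add: \<psi>'_def)
      next
        case False then show ?thesis using \<psi>'_sign[of y] y by (simp add: zero_le_mult_iff)
      qed
      then show "\<exists>z. (\<psi> has_real_derivative z) (at y) \<and> 0 \<le> z" using d by blast
    qed
  next
    case False
    show ?thesis
    proof (rule DERIV_nonpos_imp_nonincreasing[of t 1 \<psi>])
      show "t \<le> 1" using False by simp
      fix y assume y: "t \<le> y" "y \<le> 1"
      have "\<psi>' y \<le> 0"
      proof (cases "y = 1")
        case True then show ?thesis by (simp add: \<psi>'_def)
      next
        case False then show ?thesis using \<psi>'_sign[of y] y t by (simp add: zero_le_mult_iff)
      qed
      then show "\<exists>z. (\<psi> has_real_derivative z) (at y) \<and> z \<le> 0" using d by blast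
    qed
  qed
  then show ?thesis using t by (simp add: \<psi>_def diff_divide_distrib left_diff_distrib)
qed

lemma total_force_subcritical:
  fixes f :: "real^'n \<Rightarrow> real \<Rightarrow> real"
  assumes F1: "cond_F1 \<alpha> q p f" and F2: "cond_F2 f" and K: "cond_K K" and \<epsilon>: "0 < \<epsilon>"
  shows "\<exists>C\<ge>0. AE x in lebesgue. \<forall>s. total_force f K q x s * s \<le> \<epsilon> * s\<^sup>2 + C * \<bar>s\<bar> powr p"
proof -
  obtain c where c: "0 < c" "\<And>x u. \<bar>f x u\<bar> \<le> c * (1 + \<bar>u\<bar> powr (p - 1))"
    using F1 by (auto simp: cond_F1_def)
  have p: "2 < p" using F1 by (auto simp: cond_F1_def)
  have "\<forall>\<^sub>F u in at 0. \<forall>x\<in>UNIV. dist (f x u / \<bar>u\<bar>) 0 < \<epsilon>"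
    using F2 \<epsilon> by (auto simp: cond_F2_def uniform_limit_iff)
  then obtain \<delta> where \<delta>: "0 < \<delta>" "\<And>u x. u \<noteq> 0 \<Longrightarrow> \<bar>u\<bar> < \<delta> \<Longrightarrow> \<bar>f x u / \<bar>u\<bar>\<bar> < \<epsilon>"
    by (auto simp: eventually_at dist_real_def)
  define C where "C = c * (\<delta> powr (1 - p) + 1)"
  have C0: "0 \<le> C" using c by (simp add: C_def)
  have fs: "f x s * s \<le> \<epsilon> * s\<^sup>2 + C * \<bar>s\<bar> powr p" for x s
  proof (cases "\<bar>s\<bar> < \<delta>")
    case True
    have "f x s * s \<le> \<epsilon> * s\<^sup>2"
    proof (cases "s = 0")
      case False
      have "\<bar>f x s\<bar> \<le> \<epsilon> * \<bar>s\<bar>" using \<delta>(2)[OF False True, of x] False by (simp add: abs_divide pos_divide_less_eq)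
      then have "\<bar>f x s\<bar> * \<bar>s\<bar> \<le> \<epsilon> * \<bar>s\<bar> * \<bar>s\<bar>" by (rule mult_right_mono) simp
      then have "\<bar>f x s * s\<bar> \<le> \<epsilon> * s\<^sup>2" by (simp add: abs_mult power2_eq_square mult.assoc)
      then show ?thesis by linarith
    qed simp
    moreover have "0 \<le> C * \<bar>s\<bar> powr p" using C0 by simp
    ultimately show ?thesis by linarith
  next
    case False
    then have s: "0 < \<bar>s\<bar>" "\<delta> \<le> \<bar>s\<bar>" using \<delta>(1) by auto
    have "f x s * s \<le> \<bar>f x s\<bar> * \<bar>s\<bar>" by (simp flip: abs_mult)
    also have "\<dots> \<le> c * (1 + \<bar>s\<bar> powr (p - 1)) * \<bar>s\<bar>" using c(2) by (intro mult_right_mono) auto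
    also have "\<dots> = c * (\<bar>s\<bar> + \<bar>s\<bar> powr p)"
      using s powr_add[of "\<bar>s\<bar>" "p - 1" 1] by (simp add: algebra_simps)
    also have "\<dots> \<le> c * (\<delta> powr (1 - p) * \<bar>s\<bar> powr p + \<bar>s\<bar> powr p)"
    proof -
      have "\<bar>s\<bar> = \<bar>s\<bar> powr (1 - p) * \<bar>s\<bar> powr p" using s by (simp flip: powr_add)
      also have "\<dots> \<le> \<delta> powr (1 - p) * \<bar>s\<bar> powr p"
        using s \<delta>(1) p by (intro mult_right_mono powr_mono2') auto
      finally show ?thesis using c(1) by simp
    qed
    also have "\<dots> = C * \<bar>s\<bar> powr p" by (simp add: C_def algebra_simps)
    finally have "f x s * s \<le> C * \<bar>s\<bar> powr p" using c(1) by simp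
    moreover have "0 \<le> \<epsilon> * s\<^sup>2" using \<epsilon> by simp
    ultimately show ?thesis by linarith
  qed
  have "AE x in lebesgue. 0 \<le> K x" using K by (simp add: cond_K_def)
  then have "AE x in lebesgue. \<forall>s. total_force f K q x s * s \<le> \<epsilon> * s\<^sup>2 + C * \<bar>s\<bar> powr p"
  proof eventually_elim
    case (elim x)
    show ?case
    proof
      fix s
      have "0 \<le> K x * (\<bar>s\<bar> powr (q - 2) * s) * s"
        using elim by (simp add: mult.assoc zero_le_mult_iff)
      then show "total_force f K q x s * s \<le> \<epsilon> * s\<^sup>2 + C * \<bar>s\<bar> powr p"
        using fs[of x s] by (simp add: total_force_def left_diff_distrib)
    qed
  qed
  then show ?thesis using C0 by blast
qed

lemma cond_F1_F2_zero:
  assumes F2: "cond_F2 f" and cont: "continuous_on UNIV (f x)"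
  shows "f x 0 = 0"
proof -
  have lim: "((\<lambda>u. f x u / \<bar>u\<bar>) \<longlongrightarrow> 0) (at 0)"
    using tendsto_uniform_limitI[OF F2[unfolded cond_F2_def], of x] by simp
  have "((\<lambda>u. f x u / \<bar>u\<bar> * \<bar>u\<bar>) \<longlongrightarrow> 0 * \<bar>0\<bar>) (at 0)"
    by (intro tendsto_intros lim)
  moreover have "\<forall>\<^sub>F u in at 0. f x u / \<bar>u\<bar> * \<bar>u\<bar> = f x u"
    by (auto simp: eventually_at intro!: exI[of _ 1])
  ultimately have "(f x \<longlongrightarrow> 0) (at 0)" using tendsto_cong by fastforce
  moreover have "(f x \<longlongrightarrow> f x 0) (at 0)"
    using cont by (simp add: continuous_on_eq_continuous_at continuous_at)
  ultimately show ?thesis using tendsto_unique[of "at (0::real)"] by simp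
qed

lemma total_force_lipschitz:
  fixes f :: "real^'n \<Rightarrow> real \<Rightarrow> real"
  assumes F1: "cond_F1 \<alpha> q p f" and F5: "cond_F5 p f" and K: "cond_K K"
  shows "\<exists>C\<ge>0. AE x in lebesgue. \<forall>a b. \<bar>total_force f K q x a - total_force f K q x b\<bar>
      \<le> C * \<bar>a - b\<bar> * (1 + \<bar>a\<bar> powr (p - 2) + \<bar>b\<bar> powr (p - 2))"
proof -
  have q: "2 < q" "q < p" using F1 by (auto simp: cond_F1_def)
  obtain c where c: "0 < c" "AE x in lebesgue. \<forall>u. \<bar>deriv (f x) u\<bar> \<le> c * (1 + \<bar>u\<bar> powr (p - 2))"
  proof -
    obtain r b c where "0 < c" and *: "AE x in lebesgue. \<forall>u. f x u * u - 2 * primitive f x u \<ge> b * \<bar>u\<bar> powr r \<and>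
        \<bar>deriv (f x) u\<bar> \<le> c * (1 + \<bar>u\<bar> powr (p - 2))"
      using F5 unfolding cond_F5_def by blast
    from * have "AE x in lebesgue. \<forall>u. \<bar>deriv (f x) u\<bar> \<le> c * (1 + \<bar>u\<bar> powr (p - 2))"
      by (rule eventually_mono) blast
    with \<open>0 < c\<close> show thesis by (rule that)
  qed
  obtain k where k: "AE x in lebesgue. \<bar>K x\<bar> \<le> k" using K by (auto simp: cond_K_def Linfty_def)
  define C where "C = c + 2 * \<bar>k\<bar> * (q - 1)"
  have C0: "0 \<le> C" using c q by (simp add: C_def)
  have "AE x in lebesgue. f x C1_differentiable_on UNIV" using F5 by (simp add: cond_F5_def)
  then have "AE x in lebesgue. \<forall>a b. \<bar>total_force f K q x a - total_force f K q x b\<bar>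
      \<le> C * \<bar>a - b\<bar> * (1 + \<bar>a\<bar> powr (p - 2) + \<bar>b\<bar> powr (p - 2))"
    using c(2) k
  proof eventually_elim
    case (elim x)
    obtain D where D: "\<And>s. (f x has_real_derivative D s) (at s)"
      using elim(1) by (auto simp: C1_differentiable_on_def has_real_derivative_iff_has_vector_derivative)
    have D': "D s = deriv (f x) s" for s using DERIV_imp_deriv[OF D[of s]] by simp
    define h' where "h' s = D s - K x * ((q - 2 + 1) * \<bar>s\<bar> powr (q - 2))" for s
    have d: "(total_force f K q x has_real_derivative h' s) (at s)" for s
      unfolding total_force_def[abs_def] h'_def
      using q by (intro DERIV_diff DERIV_cmult DERIV_signed_powr D) auto
    have b: "\<bar>h' s\<bar> \<le> C * (1 + \<bar>s\<bar> powr (p - 2))" for s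
    proof -
      have "\<bar>s\<bar> powr (q - 2) \<le> 1 + \<bar>s\<bar> powr (p - 2)"
      proof (cases "\<bar>s\<bar> \<le> 1")
        case True
        then have "\<bar>s\<bar> powr (q - 2) \<le> 1 powr (q - 2)" using q by (intro powr_mono2) auto
        then show ?thesis by (simp add: add_increasing2)
      next
        case False
        then have "\<bar>s\<bar> powr (q - 2) \<le> \<bar>s\<bar> powr (p - 2)" using q by (intro powr_mono) auto
        then show ?thesis by simp
      qed
      then have "\<bar>K x\<bar> * ((q - 1) * \<bar>s\<bar> powr (q - 2)) \<le> \<bar>k\<bar> * ((q - 1) * (1 + \<bar>s\<bar> powr (p - 2)))"
        using elim(3) q by (intro mult_mono mult_left_mono) auto
      moreover have "\<bar>h' s\<bar> \<le> \<bar>D s\<bar> + \<bar>K x\<bar> * ((q - 1) * \<bar>s\<bar> powr (q - 2))"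
        using q by (simp add: h'_def abs_mult order_trans[OF abs_triangle_ineq4])
      moreover have "\<bar>D s\<bar> \<le> c * (1 + \<bar>s\<bar> powr (p - 2))" using elim(2) by (simp add: D')
      moreover have "0 \<le> \<bar>k\<bar> * ((q - 1) * (1 + \<bar>s\<bar> powr (p - 2)))" using q by simp
      ultimately show ?thesis by (simp add: C_def algebra_simps)
    qed
    show ?case
      using lipschitz_from_derivative_growth[OF d b C0] q by simp
  qed
  then show ?thesis using C0 by blast
qed

lemma total_potential_superlinear:
  fixes f :: "real^'n \<Rightarrow> real \<Rightarrow> real"
  assumes F3: "cond_F3 q f" and K: "cond_K K" and q: "0 < q"
  shows "\<exists>R>0. AE x in lebesgue. \<forall>s. R \<le> \<bar>s\<bar> \<longrightarrow> \<bar>s\<bar> powr q \<le> total_potential f K q x s"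
proof -
  obtain k where k: "AE x in lebesgue. \<bar>K x\<bar> \<le> k" using K by (auto simp: cond_K_def Linfty_def)
  have "\<forall>\<^sub>F u in at_infinity. \<forall>x. 1 + k / q \<le> primitive f x u / \<bar>u\<bar> powr q"
    using F3 by (simp add: cond_F3_def)
  then obtain b where b: "\<And>u x. b \<le> \<bar>u\<bar> \<Longrightarrow> 1 + k / q \<le> primitive f x u / \<bar>u\<bar> powr q"
    by (auto simp: eventually_at_infinity)
  show ?thesis
  proof (intro exI[of _ "max b 1"] conjI)
    show "AE x in lebesgue. \<forall>s. max b 1 \<le> \<bar>s\<bar> \<longrightarrow> \<bar>s\<bar> powr q \<le> total_potential f K q x s"
      using k
    proof (eventually_elim, intro allI impI)
      fix x s assume kx: "\<bar>K x\<bar> \<le> k" and s: "max b 1 \<le> \<bar>s\<bar>"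
      then have pos: "0 < \<bar>s\<bar> powr q" by auto
      have "(1 + k / q) * \<bar>s\<bar> powr q \<le> primitive f x s" using b[of s x] s pos by (simp add: pos_le_divide_eq)
      moreover have "1 / q * K x * \<bar>s\<bar> powr q \<le> k / q * \<bar>s\<bar> powr q"
        using kx q by (intro mult_right_mono) (auto simp: field_simps)
      ultimately show "\<bar>s\<bar> powr q \<le> total_potential f K q x s"
        by (simp add: total_potential_def algebra_simps)
    qed
  qed simp
qed

lemma total_periodic:
  fixes f :: "real^'n \<Rightarrow> real \<Rightarrow> real"
  assumes F1: "cond_F1 \<alpha> q p f" and K: "cond_K K" and z: "z \<in> int_lattice"
  shows "AE x in lebesgue. \<forall>s. total_force f K q (x + z) s = total_force f K q x s
      \<and> total_potential f K q (x + z) s = total_potential f K q x s"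
proof -
  have f: "f (x + z) s = f x s" for x s using F1 z by (auto simp: cond_F1_def)
  have "AE x in lebesgue. K (x + z) = K x" using K z by (auto simp: cond_K_def ae_periodic_def)
  then show ?thesis
    by eventually_elim (simp add: total_force_def total_potential_def primitive_def f)
qed


section \<open>The energy functional and its derivative\<close>

text \<open>
  The variational argument does not separate \<open>f\<close> from \<open>K\<close>: here \<open>g\<close> is the whole right-hand side of
  the equation and \<open>G\<close> its primitive. The constants \<open>v0\<close> and \<open>v1\<close> are essential bounds of \<open>V\<close>, and \<open>\<kappa>\<close> is
  the factor of the Gagliardo form.
\<close>

locale hardy_problem =
  fixes \<alpha> p q \<kappa> v0 v1 c :: real and V :: "real^'n \<Rightarrow> real" and g G :: "real^'n \<Rightarrow> real \<Rightarrow> real"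
  assumes alpha: "0 < \<alpha>" "\<alpha> < real CARD('n)"
    and exps: "2 < q" "q < p" "p < crit_exp CARD('n) \<alpha>"
    and kappa: "0 < \<kappa>"
    and V_meas: "V \<in> borel_measurable lebesgue" and v0: "0 < v0"
    and V_bounds: "AE x in lebesgue. v0 \<le> V x \<and> V x \<le> v1"
    and V_periodic: "\<And>z. z \<in> int_lattice \<Longrightarrow> AE x in lebesgue. V (x + z) = V x"
    and g_meas: "\<And>u. u \<in> borel_measurable lebesgue \<Longrightarrow> (\<lambda>x. g x (u x)) \<in> borel_measurable lebesgue"
    and G_meas: "\<And>u. u \<in> borel_measurable lebesgue \<Longrightarrow> (\<lambda>x. G x (u x)) \<in> borel_measurable lebesgue"
    and G_deriv: "AE x in lebesgue. \<forall>s. (G x has_real_derivative g x s) (at s)"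
    and G_zero: "\<And>x. G x 0 = 0"
    and g_zero: "AE x in lebesgue. g x 0 = 0"
    and c0: "0 \<le> c"
    and g_lipschitz: "AE x in lebesgue. \<forall>a b. \<bar>g x a - g x b\<bar> \<le> c * \<bar>a - b\<bar> * (1 + \<bar>a\<bar> powr (p - 2) + \<bar>b\<bar> powr (p - 2))"
    and g_subcritical: "\<And>\<epsilon>. 0 < \<epsilon> \<Longrightarrow> \<exists>C\<ge>0. AE x in lebesgue. \<forall>s. g x s * s \<le> \<epsilon> * s\<^sup>2 + C * \<bar>s\<bar> powr p"
    and G_ray: "AE x in lebesgue. \<forall>t\<ge>0. \<forall>s. (t powr q - 1) / q * (g x s * s) \<le> G x (t * s) - G x s"
    and G_superlinear: "\<exists>R>0. AE x in lebesgue. \<forall>s. R \<le> \<bar>s\<bar> \<longrightarrow> \<bar>s\<bar> powr q \<le> G x s"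
    and gG_periodic: "\<And>z. z \<in> int_lattice \<Longrightarrow> AE x in lebesgue. \<forall>s. g (x + z) s = g x s \<and> G (x + z) s = G x s"

lemma young_powr:
  fixes a b \<epsilon> r :: real
  assumes "0 < \<epsilon>" "1 \<le> r"
  shows "\<bar>a\<bar> powr (r - 1) * \<bar>b\<bar> \<le> \<epsilon> * \<bar>a\<bar> powr r + \<epsilon> powr (1 - r) * \<bar>b\<bar> powr r"
proof (cases "\<bar>b\<bar> \<le> \<epsilon> * \<bar>a\<bar>")
  case True
  have "\<bar>a\<bar> powr (r - 1) * \<bar>b\<bar> \<le> \<bar>a\<bar> powr (r - 1) * (\<epsilon> * \<bar>a\<bar>)" using True by (intro mult_left_mono) auto
  also have "\<dots> = \<epsilon> * \<bar>a\<bar> powr r"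
    using powr_add[of "\<bar>a\<bar>" "r - 1" 1] by (cases "a = 0") auto
  finally show ?thesis using assms by (simp add: add_increasing2)
next
  case False
  then have b: "0 < \<bar>b\<bar>" and a: "\<bar>a\<bar> \<le> \<bar>b\<bar> / \<epsilon>"
    using assms by (auto simp: field_simps intro: le_less_trans[of _ "\<epsilon> * \<bar>a\<bar>"])
  have "\<bar>a\<bar> powr (r - 1) * \<bar>b\<bar> \<le> (\<bar>b\<bar> / \<epsilon>) powr (r - 1) * \<bar>b\<bar>"
    using a assms by (intro mult_right_mono powr_mono2) auto
  also have "\<dots> = \<epsilon> powr (1 - r) * \<bar>b\<bar> powr r"
  proof -
    have "(\<bar>b\<bar> / \<epsilon>) powr (r - 1) = \<epsilon> powr (- (r - 1)) * \<bar>b\<bar> powr (r - 1)"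
      using assms b by (simp only: powr_minus powr_divide) (simp add: field_simps)
    moreover have "\<bar>b\<bar> powr r = \<bar>b\<bar> powr (r - 1) * \<bar>b\<bar>" using b powr_add[of "\<bar>b\<bar>" "r - 1" 1] by simp
    ultimately show ?thesis by simp
  qed
  finally show ?thesis using assms by (simp add: add_increasing)
qed

lemma young_powr_square:
  fixes a b s r :: real
  assumes "0 < s" "2 \<le> r"
  shows "b\<^sup>2 * \<bar>a\<bar> powr (r - 2) \<le> s\<^sup>2 * \<bar>a\<bar> powr r + s powr (2 - r) * \<bar>b\<bar> powr r"
proof (cases "\<bar>b\<bar> \<le> s * \<bar>a\<bar>")
  case True
  then have "\<bar>b\<bar>\<^sup>2 \<le> (s * \<bar>a\<bar>)\<^sup>2" by (intro power_mono) auto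
  then have "b\<^sup>2 * \<bar>a\<bar> powr (r - 2) \<le> (s * \<bar>a\<bar>)\<^sup>2 * \<bar>a\<bar> powr (r - 2)" by (intro mult_right_mono) auto
  also have "\<dots> = s\<^sup>2 * \<bar>a\<bar> powr r"
    using powr_add[of "\<bar>a\<bar>" "r - 2" 2] by (cases "a = 0") (auto simp: power_mult_distrib)
  finally show ?thesis using assms by (simp add: add_increasing2)
next
  case False
  then have b: "0 < \<bar>b\<bar>" and a: "\<bar>a\<bar> \<le> \<bar>b\<bar> / s"
    using assms by (auto simp: field_simps intro: le_less_trans[of _ "s * \<bar>a\<bar>"])
  have "b\<^sup>2 * \<bar>a\<bar> powr (r - 2) \<le> b\<^sup>2 * (\<bar>b\<bar> / s) powr (r - 2)"
    using a assms by (intro mult_left_mono powr_mono2) auto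
  also have "\<dots> = s powr (2 - r) * \<bar>b\<bar> powr r"
  proof -
    have "(\<bar>b\<bar> / s) powr (r - 2) = s powr (- (r - 2)) * \<bar>b\<bar> powr (r - 2)"
      using assms b by (simp only: powr_minus powr_divide) (simp add: field_simps)
    moreover have "\<bar>b\<bar> powr r = \<bar>b\<bar> powr (r - 2) * b\<^sup>2" using b powr_add[of "\<bar>b\<bar>" "r - 2" 2] by simp
    ultimately show ?thesis by simp
  qed
  finally show ?thesis using assms by (simp add: add_increasing)
qed

lemma homogeneous_bounded:
  fixes L :: "(real^'n \<Rightarrow> real) \<Rightarrow> real"
  assumes bd: "\<And>v. v \<in> frac_sobolev \<alpha> \<Longrightarrow> frac_sobolev_norm \<alpha> v \<le> 1 \<Longrightarrow> \<bar>L v\<bar> \<le> M"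
    and hom: "\<And>a v. v \<in> frac_sobolev \<alpha> \<Longrightarrow> L (\<lambda>x. a * v x) = a * L v"
    and v: "v \<in> frac_sobolev \<alpha>"
  shows "\<bar>L v\<bar> \<le> M * frac_sobolev_norm \<alpha> v"
proof (cases "frac_sobolev_norm \<alpha> v = 0")
  case True
  have M: "\<bar>a\<bar> * \<bar>L v\<bar> \<le> M" for a
    using bd[OF frac_sobolev_scale[OF v, of a]] True by (simp add: frac_sobolev_norm_scale hom[OF v] abs_mult)
  have "L v = 0"
  proof (rule ccontr)
    assume L: "L v \<noteq> 0"
    have "(M + 1) / \<bar>L v\<bar> * \<bar>L v\<bar> \<le> \<bar>(M + 1) / \<bar>L v\<bar>\<bar> * \<bar>L v\<bar>"
      by (rule mult_right_mono[OF abs_ge_self]) simp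
    also have "\<dots> \<le> M" by (rule M)
    finally show False using L by simp
  qed
  then show ?thesis using True by simp
next
  case False
  then have s: "0 < frac_sobolev_norm \<alpha> v" using frac_sobolev_norm_nonneg[of \<alpha> v] by simp
  let ?a = "1 / frac_sobolev_norm \<alpha> v"
  have "\<bar>L (\<lambda>x. ?a * v x)\<bar> \<le> M"
    using s by (intro bd frac_sobolev_scale v) (simp only: frac_sobolev_norm_scale, simp)
  then show ?thesis using s by (simp only: hom[OF v]) (simp add: abs_mult field_simps)
qed

text \<open>
  Two derivatives differ by \<open>o(norm h)\<close> near \<open>0\<close>; by homogeneity the difference at a fixed \<open>v\<close> is then
  smaller than every multiple of its norm.
\<close>

lemma frechet_derivative_unique:
  assumes 1: "has_frechet_derivative \<alpha> J L1 u" and 2: "has_frechet_derivative \<alpha> J L2 u" and v: "v \<in> frac_sobolev \<alpha>"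
  shows "L1 v = L2 v"
proof -
  let ?n = "frac_sobolev_norm \<alpha> v"
  have n: "0 \<le> ?n" by (rule frac_sobolev_norm_nonneg)
  have "\<bar>L1 v - L2 v\<bar> \<le> 2 * \<epsilon> * ?n" if \<epsilon>: "0 < \<epsilon>" for \<epsilon>
  proof -
    obtain \<delta>1 where \<delta>1: "0 < \<delta>1" "\<And>h. h \<in> frac_sobolev \<alpha> \<Longrightarrow> frac_sobolev_norm \<alpha> h < \<delta>1 \<Longrightarrow>
        \<bar>J (\<lambda>x. u x + h x) - J u - L1 h\<bar> \<le> \<epsilon> * frac_sobolev_norm \<alpha> h"
      using 1 \<epsilon> unfolding has_frechet_derivative_def by blast
    obtain \<delta>2 where \<delta>2: "0 < \<delta>2" "\<And>h. h \<in> frac_sobolev \<alpha> \<Longrightarrow> frac_sobolev_norm \<alpha> h < \<delta>2 \<Longrightarrow>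
        \<bar>J (\<lambda>x. u x + h x) - J u - L2 h\<bar> \<le> \<epsilon> * frac_sobolev_norm \<alpha> h"
      using 2 \<epsilon> unfolding has_frechet_derivative_def by blast
    define t where "t = min \<delta>1 \<delta>2 / (2 * (?n + 1))"
    have t: "0 < t" using \<delta>1(1) \<delta>2(1) n by (simp add: t_def)
    have "t * ?n \<le> t * (?n + 1)" using t by (intro mult_left_mono) auto
    also have "t * (?n + 1) = min \<delta>1 \<delta>2 / 2" using n by (simp add: t_def field_simps)
    finally have small: "t * ?n < \<delta>1" "t * ?n < \<delta>2" using \<delta>1(1) \<delta>2(1) by (auto simp: min_def split: if_splits)
    let ?h = "\<lambda>x. t * v x"
    have h: "?h \<in> frac_sobolev \<alpha>" by (rule frac_sobolev_scale[OF v])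
    have hn: "frac_sobolev_norm \<alpha> ?h = t * ?n" using t by (simp add: frac_sobolev_norm_scale)
    have "L1 ?h = t * L1 v" "L2 ?h = t * L2 v"
      using 1 2 v by (auto simp: has_frechet_derivative_def)
    then have "t * \<bar>L1 v - L2 v\<bar> = \<bar>L1 ?h - L2 ?h\<bar>" using t by (simp add: abs_mult flip: right_diff_distrib)
    also have "\<dots> \<le> \<epsilon> * (t * ?n) + \<epsilon> * (t * ?n)"
      using \<delta>1(2)[OF h] \<delta>2(2)[OF h] small unfolding hn by linarith
    finally have "t * \<bar>L1 v - L2 v\<bar> \<le> t * (2 * \<epsilon> * ?n)" by (simp add: mult_ac)
    then show ?thesis using t by simp
  qed
  then have *: "\<bar>L1 v - L2 v\<bar> \<le> 2 * \<epsilon> * ?n" if "0 < \<epsilon>" for \<epsilon> using that by blast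
  have "\<bar>L1 v - L2 v\<bar> \<le> 0 + e" if e: "0 < e" for e
  proof -
    have "2 * (e / (2 * (?n + 1))) * ?n \<le> e" using n e by (simp add: field_simps)
    then show ?thesis using *[of "e / (2 * (?n + 1))"] n e by simp
  qed
  then have "\<bar>L1 v - L2 v\<bar> \<le> 0" by (rule field_le_epsilon)
  then show ?thesis by simp
qed

context hardy_problem
begin

abbreviation H where "H \<equiv> frac_sobolev \<alpha> :: (real^'n \<Rightarrow> real) set"
abbreviation nrm :: "(real^'n \<Rightarrow> real) \<Rightarrow> real" where "nrm \<equiv> frac_sobolev_norm \<alpha>"

lemma p2: "2 < p" using exps by linarith

lemma integrable_powr_p:
  assumes "u \<in> H" shows "integrable lebesgue (\<lambda>x. \<bar>u x\<bar> powr p)"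
  using sobolev_embedding[OF alpha _ exps(3), of "nrm u"] p2 assms by auto

lemma sobolev_bound: "\<exists>S\<ge>0. \<forall>u\<in>H. \<forall>s>0. nrm u \<le> s \<longrightarrow> (\<integral>x. \<bar>u x\<bar> powr p \<partial>lebesgue) \<le> S * s powr p"
proof -
  obtain S where S: "0 \<le> S" "\<And>u. u \<in> H \<Longrightarrow> nrm u \<le> 1 \<Longrightarrow> (\<integral>x. \<bar>u x\<bar> powr p \<partial>lebesgue) \<le> S"
    using sobolev_embedding[OF alpha _ exps(3), of 1] p2 by auto
  show ?thesis
  proof (intro exI[of _ S] conjI ballI allI impI S(1))
    fix u :: "real^'n \<Rightarrow> real" and s :: real
    assume u: "u \<in> H" and s: "0 < s" and us: "nrm u \<le> s"
    have le: "(\<integral>x. \<bar>1 / s * u x\<bar> powr p \<partial>lebesgue) \<le> S"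
    proof (rule S(2)[OF frac_sobolev_scale[OF u]])
      show "nrm (\<lambda>x. 1 / s * u x) \<le> 1" using s us by (simp only: frac_sobolev_norm_scale) simp
    qed
    have eq: "(\<lambda>x. \<bar>1 / s * u x\<bar> powr p) = (\<lambda>x. \<bar>u x\<bar> powr p / s powr p)"
      using s by (intro ext) (simp only: abs_mult powr_mult, simp add: powr_divide)
    have "(\<integral>x. \<bar>1 / s * u x\<bar> powr p \<partial>lebesgue) = (\<integral>x. \<bar>u x\<bar> powr p \<partial>lebesgue) / s powr p"
      unfolding eq by simp
    then have "(\<integral>x. \<bar>u x\<bar> powr p \<partial>lebesgue) / s powr p \<le> S" using le by linarith
    then show "(\<integral>x. \<bar>u x\<bar> powr p \<partial>lebesgue) \<le> S * s powr p" using s by (simp add: pos_divide_le_eq)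
  qed
qed

lemma integrable_weighted:
  assumes u: "u \<in> H" and v: "v \<in> H"
  shows "integrable lebesgue (\<lambda>y. diff_quot \<alpha> u y * diff_quot \<alpha> v y)"
    and "integrable lebesgue (\<lambda>x. u x * v x)"
    and "integrable lebesgue (\<lambda>x. V x * (u x * v x))"
    and "integrable lebesgue (\<lambda>x. u x * v x / norm x powr \<alpha>)"
proof -
  note u = frac_sobolevD[OF u] and v = frac_sobolevD[OF v] and uH = u and vH = v
  note [measurable] = u(1) v(1) V_meas
  show "integrable lebesgue (\<lambda>y. diff_quot \<alpha> u y * diff_quot \<alpha> v y)"
    using u v by (intro integrable_mult_of_squares)
  show I: "integrable lebesgue (\<lambda>x. u x * v x)"
    using u v by (intro integrable_mult_of_squares)
  show "integrable lebesgue (\<lambda>x. V x * (u x * v x))"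
  proof (rule Bochner_Integration.integrable_bound)
    show "integrable lebesgue (\<lambda>x. v1 * (u x * v x))" using I by simp
    show "AE x in lebesgue. norm (V x * (u x * v x)) \<le> norm (v1 * (u x * v x))"
      using V_bounds by eventually_elim (use v0 in \<open>auto simp: abs_mult intro!: mult_right_mono\<close>)
  qed measurable
  have nm[measurable]: "(\<lambda>x :: real^'n. norm x powr r) \<in> borel_measurable lebesgue" for r
    by (intro measurable_completion) measurable
  have sq: "(w x / norm x powr (\<alpha> / 2))\<^sup>2 = (w x)\<^sup>2 / norm x powr \<alpha>" for w :: "real^'n \<Rightarrow> real" and x
    using powr_add[of "norm x" "\<alpha> / 2" "\<alpha> / 2"] by (simp add: power_divide power2_eq_square[of "norm x powr (\<alpha> / 2)"])
  have "integrable lebesgue (\<lambda>x. (u x / norm x powr (\<alpha> / 2)) * (v x / norm x powr (\<alpha> / 2)))"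
    using hardy_inequality[OF alpha] assms by (intro integrable_mult_of_squares) (auto simp: sq)
  moreover have "(\<lambda>x. (u x / norm x powr (\<alpha> / 2)) * (v x / norm x powr (\<alpha> / 2))) = (\<lambda>x. u x * v x / norm x powr \<alpha>)"
  proof
    fix x :: "real^'n"
    show "(u x / norm x powr (\<alpha> / 2)) * (v x / norm x powr (\<alpha> / 2)) = u x * v x / norm x powr \<alpha>"
      using powr_add[of "norm x" "\<alpha> / 2" "\<alpha> / 2"] by simp
  qed
  ultimately show "integrable lebesgue (\<lambda>x. u x * v x / norm x powr \<alpha>)" by (simp only:)
qed

text \<open>
  The bilinear form of the linear operator \<open>(-\<Delta>)\<^bsup>\<alpha>/2\<^esup> + V - \<mu>/|x|\<^sup>\<alpha>\<close>.
\<close>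

definition form :: "real \<Rightarrow> (real^'n \<Rightarrow> real) \<Rightarrow> (real^'n \<Rightarrow> real) \<Rightarrow> real" where
  "form \<mu> u v = \<kappa> * (\<integral>y. diff_quot \<alpha> u y * diff_quot \<alpha> v y \<partial>lebesgue) + (\<integral>x. V x * (u x * v x) \<partial>lebesgue)
     - \<mu> * (\<integral>x. u x * v x / norm x powr \<alpha> \<partial>lebesgue)"

lemma form_add_right:
  assumes "u \<in> H" "v \<in> H" "w \<in> H"
  shows "form \<mu> u (\<lambda>x. v x + w x) = form \<mu> u v + form \<mu> u w"
  using integrable_weighted[OF assms(1,2)] integrable_weighted[OF assms(1,3)]
  by (simp add: form_def diff_quot_add distrib_left add_divide_distrib)

lemma form_scale_right: "form \<mu> u (\<lambda>x. a * v x) = a * form \<mu> u v"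
proof -
  have 1: "(\<integral>y. diff_quot \<alpha> u y * (a * diff_quot \<alpha> v y) \<partial>lebesgue) = a * (\<integral>y. diff_quot \<alpha> u y * diff_quot \<alpha> v y \<partial>lebesgue)"
    by (simp add: mult.left_commute[of _ a])
  have 2: "(\<integral>x. V x * (u x * (a * v x)) \<partial>lebesgue) = a * (\<integral>x. V x * (u x * v x) \<partial>lebesgue)"
    by (simp add: mult.left_commute[of _ a])
  have "(\<integral>x. u x * (a * v x) / norm x powr \<alpha> \<partial>lebesgue) = (\<integral>x. a * (u x * v x / norm x powr \<alpha>) \<partial>lebesgue)"
    by (intro Bochner_Integration.integral_cong) auto
  then have 3: "(\<integral>x. u x * (a * v x) / norm x powr \<alpha> \<partial>lebesgue) = a * (\<integral>x. u x * v x / norm x powr \<alpha> \<partial>lebesgue)"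
    by (simp only: integral_mult_right_zero)
  show ?thesis unfolding form_def diff_quot_scale 1 2 3 by (simp add: algebra_simps)
qed

lemma form_commute: "form \<mu> u v = form \<mu> v u"
  by (simp add: form_def mult.commute)

lemma form_square_add:
  assumes "u \<in> H" "h \<in> H"
  shows "form \<mu> (\<lambda>x. u x + h x) (\<lambda>x. u x + h x) = form \<mu> u u + 2 * form \<mu> u h + form \<mu> h h"
  using form_add_right[OF frac_sobolev_add[OF assms] assms, of \<mu>]
    form_add_right[OF assms(1) assms, of \<mu>] form_add_right[OF assms(2) assms, of \<mu>]
    form_commute[of \<mu> h u] form_commute[of \<mu> "\<lambda>x. u x + h x" u] form_commute[of \<mu> "\<lambda>x. u x + h x" h]
  by simp

lemma form_square_scale: "form \<mu> (\<lambda>x. t * u x) (\<lambda>x. t * u x) = t\<^sup>2 * form \<mu> u u"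
  using form_scale_right[of \<mu> "\<lambda>x. t * u x" t u] form_commute[of \<mu> "\<lambda>x. t * u x" u] form_scale_right[of \<mu> u t u]
  by (simp add: power2_eq_square)

lemma form_mu: "form \<mu> u v = form 0 u v - \<mu> * (\<integral>x. u x * v x / norm x powr \<alpha> \<partial>lebesgue)"
  by (simp add: form_def)

lemma form_zero_bounds:
  assumes u: "u \<in> H"
  shows "min \<kappa> v0 * (nrm u)\<^sup>2 \<le> form 0 u u" and "form 0 u u \<le> max \<kappa> v1 * (nrm u)\<^sup>2"
proof -
  let ?D = "\<integral>y. (diff_quot \<alpha> u y)\<^sup>2 \<partial>lebesgue" and ?U = "\<integral>x. (u x)\<^sup>2 \<partial>lebesgue" and ?V = "\<integral>x. V x * (u x)\<^sup>2 \<partial>lebesgue"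
  note I = frac_sobolevD[OF u] and W = integrable_weighted(3)[OF u u, folded power2_eq_square]
  have le: "v0 * ?U \<le> ?V" "?V \<le> v1 * ?U"
  proof -
    have ae: "AE x in lebesgue. v0 * (u x)\<^sup>2 \<le> V x * (u x)\<^sup>2" "AE x in lebesgue. V x * (u x)\<^sup>2 \<le> v1 * (u x)\<^sup>2"
      using V_bounds by (eventually_elim, simp add: mult_right_mono)+
    show "v0 * ?U \<le> ?V" using integral_mono_AE[OF _ W ae(1)] I by simp
    show "?V \<le> v1 * ?U" using integral_mono_AE[OF W _ ae(2)] I by simp
  qed
  have 0: "0 \<le> ?D" "0 \<le> ?U" by simp_all
  have form: "form 0 u u = \<kappa> * ?D + ?V" by (simp add: form_def power2_eq_square)
  have n: "(nrm u)\<^sup>2 = ?U + ?D" by (rule frac_sobolev_norm_sq)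
  have "min \<kappa> v0 * ?D \<le> \<kappa> * ?D" "min \<kappa> v0 * ?U \<le> v0 * ?U" using 0 by (auto intro: mult_right_mono)
  then show "min \<kappa> v0 * (nrm u)\<^sup>2 \<le> form 0 u u" using le unfolding form n by (simp add: distrib_left)
  have "\<kappa> * ?D \<le> max \<kappa> v1 * ?D" "v1 * ?U \<le> max \<kappa> v1 * ?U" using 0 by (auto intro: mult_right_mono)
  then show "form 0 u u \<le> max \<kappa> v1 * (nrm u)\<^sup>2" using le unfolding form n by (simp add: distrib_left)
qed

lemma hardy_bound:
  "\<exists>C\<ge>0. \<forall>u\<in>H. 0 \<le> (\<integral>x. u x * u x / norm x powr \<alpha> \<partial>lebesgue) \<and> (\<integral>x. u x * u x / norm x powr \<alpha> \<partial>lebesgue) \<le> C * (nrm u)\<^sup>2"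
proof -
  obtain C where C: "0 \<le> C" "\<And>u :: real^'n \<Rightarrow> real. u \<in> H \<Longrightarrow> (\<integral>x. (u x)\<^sup>2 / norm x powr \<alpha> \<partial>lebesgue) \<le> C * gagliardo \<alpha> u"
    using hardy_inequality[OF alpha] by blast
  show ?thesis
  proof (intro exI[of _ C] conjI ballI C(1))
    fix u assume u: "u \<in> H"
    have "(\<integral>x. (u x)\<^sup>2 / norm x powr \<alpha> \<partial>lebesgue) \<le> C * (nrm u)\<^sup>2"
      using C(2)[OF u] L2_le_frac_sobolev_norm(2)[OF u order_refl] mult_left_mono[OF _ C(1)] order_trans by blast
    then show "(\<integral>x. u x * u x / norm x powr \<alpha> \<partial>lebesgue) \<le> C * (nrm u)\<^sup>2" by (simp add: power2_eq_square)
  qed simp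
qed

lemma form_bounded: "\<exists>M\<ge>0. \<forall>h\<in>H. \<bar>form \<mu> h h\<bar> \<le> M * (nrm h)\<^sup>2"
proof -
  obtain C where C: "0 \<le> C" "\<And>u :: real^'n \<Rightarrow> real. u \<in> H \<Longrightarrow> 0 \<le> (\<integral>x. u x * u x / norm x powr \<alpha> \<partial>lebesgue) \<and>
     (\<integral>x. u x * u x / norm x powr \<alpha> \<partial>lebesgue) \<le> C * (nrm u)\<^sup>2"
    using hardy_bound by blast
  let ?M = "max \<kappa> v1 + \<bar>\<mu>\<bar> * C"
  show ?thesis
  proof (intro exI[of _ ?M] conjI ballI)
    show "0 \<le> ?M" using C kappa by (simp add: max_def)
    fix h assume h: "h \<in> H"
    let ?I = "\<integral>x. h x * h x / norm x powr \<alpha> \<partial>lebesgue"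
    have "\<bar>\<mu> * ?I\<bar> \<le> \<bar>\<mu>\<bar> * (C * (nrm h)\<^sup>2)"
      using C(2)[OF h] by (simp add: abs_mult mult_left_mono)
    moreover have "0 \<le> min \<kappa> v0 * (nrm h)\<^sup>2" using kappa v0 by simp
    then have "\<bar>form 0 h h\<bar> \<le> max \<kappa> v1 * (nrm h)\<^sup>2" using form_zero_bounds[OF h] by linarith
    ultimately show "\<bar>form \<mu> h h\<bar> \<le> ?M * (nrm h)\<^sup>2"
      using form_mu[of \<mu> h h] abs_triangle_ineq4[of "form 0 h h" "\<mu> * ?I"] by (simp add: distrib_right mult.assoc)
  qed
qed

lemma g_growth: "AE x in lebesgue. \<forall>s. \<bar>g x s\<bar> \<le> c * (\<bar>s\<bar> + \<bar>s\<bar> powr (p - 1))"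
  using g_lipschitz g_zero
proof eventually_elim
  case (elim x)
  show ?case
  proof
    fix s
    have "\<bar>g x s\<bar> \<le> c * \<bar>s\<bar> * (1 + \<bar>s\<bar> powr (p - 2))"
      using elim(1)[rule_format, of s 0] elim(2) by simp
    moreover have "\<bar>s\<bar> * \<bar>s\<bar> powr (p - 2) = \<bar>s\<bar> powr (p - 1)"
      using powr_add[of "\<bar>s\<bar>" "p - 2" 1] p2 by (cases "s = 0") auto
    ultimately show "\<bar>g x s\<bar> \<le> c * (\<bar>s\<bar> + \<bar>s\<bar> powr (p - 1))" by (simp add: distrib_left mult.assoc)
  qed
qed

text \<open>
  The shape required by \<open>almost_dominated_convergence\<close>: a function of \<open>b\<close> alone plus \<open>\<epsilon>\<close> times a
  function of \<open>a\<close>.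
\<close>

lemma g_times_bound:
  assumes \<epsilon>: "0 < \<epsilon>"
  shows "AE x in lebesgue. \<forall>a b. \<bar>g x a * b\<bar> \<le> c * (b\<^sup>2 / \<epsilon> + \<epsilon> powr (1 - p) * \<bar>b\<bar> powr p) + \<epsilon> * (c * (a\<^sup>2 + \<bar>a\<bar> powr p))"
  using g_growth
proof eventually_elim
  case (elim x)
  show ?case
  proof (intro allI)
    fix a b
    have "\<bar>g x a * b\<bar> \<le> c * (\<bar>a\<bar> + \<bar>a\<bar> powr (p - 1)) * \<bar>b\<bar>"
      using elim by (simp add: abs_mult mult_right_mono)
    also have "\<dots> = c * (\<bar>a\<bar> powr (2 - 1) * \<bar>b\<bar> + \<bar>a\<bar> powr (p - 1) * \<bar>b\<bar>)" by (simp add: algebra_simps)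
    also have "\<dots> \<le> c * ((\<epsilon> * \<bar>a\<bar> powr 2 + \<epsilon> powr (1 - 2) * \<bar>b\<bar> powr 2) + (\<epsilon> * \<bar>a\<bar> powr p + \<epsilon> powr (1 - p) * \<bar>b\<bar> powr p))"
      using c0 young_powr[OF \<epsilon>, of 2 a b] young_powr[OF \<epsilon>, of p a b] p2 by (intro mult_left_mono add_mono) auto
    also have "\<dots> = c * (b\<^sup>2 / \<epsilon> + \<epsilon> powr (1 - p) * \<bar>b\<bar> powr p) + \<epsilon> * (c * (a\<^sup>2 + \<bar>a\<bar> powr p))"
      using \<epsilon> by (simp add: powr_minus_divide algebra_simps)
    finally show "\<bar>g x a * b\<bar> \<le> c * (b\<^sup>2 / \<epsilon> + \<epsilon> powr (1 - p) * \<bar>b\<bar> powr p) + \<epsilon> * (c * (a\<^sup>2 + \<bar>a\<bar> powr p))" .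
  qed
qed

lemma integrable_g:
  assumes u: "u \<in> H" and v: "v \<in> H"
  shows "integrable lebesgue (\<lambda>x. g x (u x) * v x)"
proof (rule Bochner_Integration.integrable_bound)
  show "integrable lebesgue (\<lambda>x. c * ((v x)\<^sup>2 / 1 + 1 powr (1 - p) * \<bar>v x\<bar> powr p) + 1 * (c * ((u x)\<^sup>2 + \<bar>u x\<bar> powr p)))"
    using integrable_powr_p[OF u] integrable_powr_p[OF v] frac_sobolevD(2)[OF u] frac_sobolevD(2)[OF v] by simp
  show "AE x in lebesgue. norm (g x (u x) * v x) \<le> norm (c * ((v x)\<^sup>2 / 1 + 1 powr (1 - p) * \<bar>v x\<bar> powr p) + 1 * (c * ((u x)\<^sup>2 + \<bar>u x\<bar> powr p)))"
    using g_times_bound[of 1, OF zero_less_one] by eventually_elim (simp only: real_norm_def order_trans[OF _ abs_ge_self])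
  show "(\<lambda>x. g x (u x) * v x) \<in> borel_measurable lebesgue"
    using g_meas frac_sobolevD(1)[OF u] frac_sobolevD(1)[OF v] by measurable
qed

lemma integral_g_bound:
  assumes u: "u \<in> H" shows "\<exists>M. \<forall>v\<in>H. nrm v \<le> 1 \<longrightarrow> \<bar>\<integral>x. g x (u x) * v x \<partial>lebesgue\<bar> \<le> M"
proof -
  obtain S where S: "0 \<le> S" "\<And>u s. u \<in> H \<Longrightarrow> 0 < s \<Longrightarrow> nrm u \<le> s \<Longrightarrow> (\<integral>x. \<bar>u x\<bar> powr p \<partial>lebesgue) \<le> S * s powr p"
    using sobolev_bound by blast
  let ?A = "\<integral>x. c * ((u x)\<^sup>2 + \<bar>u x\<bar> powr p) \<partial>lebesgue"
  show ?thesis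
  proof (intro exI[of _ "c * (1 + S) + ?A"] ballI impI)
    fix v assume v: "v \<in> H" and n: "nrm v \<le> 1"
    note I = integrable_powr_p[OF u] integrable_powr_p[OF v] frac_sobolevD(2)[OF u] frac_sobolevD(2)[OF v]
    have "\<bar>\<integral>x. g x (u x) * v x \<partial>lebesgue\<bar> \<le> (\<integral>x. \<bar>g x (u x) * v x\<bar> \<partial>lebesgue)" by (rule integral_abs_bound)
    also have "\<dots> \<le> (\<integral>x. c * ((v x)\<^sup>2 + \<bar>v x\<bar> powr p) + c * ((u x)\<^sup>2 + \<bar>u x\<bar> powr p) \<partial>lebesgue)"
    proof (rule integral_mono_AE)
      show "AE x in lebesgue. \<bar>g x (u x) * v x\<bar> \<le> c * ((v x)\<^sup>2 + \<bar>v x\<bar> powr p) + c * ((u x)\<^sup>2 + \<bar>u x\<bar> powr p)"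
        using g_times_bound[of 1, OF zero_less_one] by eventually_elim simp
    qed (use integrable_g[OF u v] I in auto)
    also have "\<dots> = c * ((\<integral>x. (v x)\<^sup>2 \<partial>lebesgue) + (\<integral>x. \<bar>v x\<bar> powr p \<partial>lebesgue)) + ?A"
      using I by simp
    also have "\<dots> \<le> c * (1 + S) + ?A"
      using L2_le_frac_sobolev_norm(1)[OF v n] S(2)[OF v zero_less_one n] c0
      by (intro add_mono mult_left_mono) auto
    finally show "\<bar>\<integral>x. g x (u x) * v x \<partial>lebesgue\<bar> \<le> c * (1 + S) + ?A" .
  qed
qed

text \<open>
  The growth of the Lipschitz constant of \<open>g\<close> makes the Taylor remainder quadratic in \<open>b\<close>, up to the
  mixed term \<open>b\<^sup>2 |a|\<^bsup>p-2\<^esup>\<close>. The parameter \<open>s\<close> splits it by Young's inequality; with \<open>s\<close> equal to the norm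
  of the increment both resulting integrals are \<open>O(s\<^sup>2)\<close>.
\<close>

lemma G_remainder:
  defines "C \<equiv> c * (1 + 2 powr (p - 2))"
  shows "AE x in lebesgue. \<forall>s>0. \<forall>a b. \<bar>G x (a + b) - G x a - g x a * b\<bar>
    \<le> C * (b\<^sup>2 + \<bar>b\<bar> powr p + s\<^sup>2 * \<bar>a\<bar> powr p + s powr (2 - p) * \<bar>b\<bar> powr p)"
  using G_deriv g_lipschitz
proof eventually_elim
  case (elim x)
  show ?case
  proof (intro allI impI)
    fix s a b :: real assume s: "0 < s"
    have C0: "0 \<le> C" using c0 by (simp add: C_def)
    obtain z where z: "\<bar>z - a\<bar> \<le> \<bar>b\<bar>" "G x (a + b) - G x a = b * g x z"
    proof (cases b "0::real" rule: linorder_cases)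
      case equal then show thesis by (intro that[of a]) auto
    next
      case greater
      then obtain z where "a < z" "z < a + b" "G x (a + b) - G x a = (a + b - a) * g x z"
        using MVT2[of a "a + b" "G x" "g x"] elim(1) by auto
      then show thesis using greater by (intro that[of z]) auto
    next
      case less
      then obtain z where z: "a + b < z" "z < a" "G x a - G x (a + b) = (a - (a + b)) * g x z"
        using MVT2[of "a + b" a "G x" "g x"] elim(1) by auto
      then have "G x (a + b) - G x a = b * g x z" by (simp add: algebra_simps)
      then show thesis using z less by (intro that[of z]) auto
    qed
    have zp: "\<bar>z\<bar> powr (p - 2) \<le> 2 powr (p - 2) * (\<bar>a\<bar> powr (p - 2) + \<bar>b\<bar> powr (p - 2))"
    proof -
      have "\<bar>z\<bar> \<le> 2 * max \<bar>a\<bar> \<bar>b\<bar>" using z(1) by linarith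
      then have "\<bar>z\<bar> powr (p - 2) \<le> (2 * max \<bar>a\<bar> \<bar>b\<bar>) powr (p - 2)" using p2 by (intro powr_mono2) auto
      also have "\<dots> = 2 powr (p - 2) * (max \<bar>a\<bar> \<bar>b\<bar>) powr (p - 2)" by (simp add: powr_mult)
      also have "(max \<bar>a\<bar> \<bar>b\<bar>) powr (p - 2) \<le> \<bar>a\<bar> powr (p - 2) + \<bar>b\<bar> powr (p - 2)" by (simp add: max_def)
      finally show ?thesis by simp
    qed
    have "G x (a + b) - G x a - g x a * b = (g x z - g x a) * b" using z(2) by (simp add: algebra_simps)
    then have "\<bar>G x (a + b) - G x a - g x a * b\<bar> = \<bar>g x z - g x a\<bar> * \<bar>b\<bar>" by (simp add: abs_mult)
    also have "\<dots> \<le> c * \<bar>z - a\<bar> * (1 + \<bar>z\<bar> powr (p - 2) + \<bar>a\<bar> powr (p - 2)) * \<bar>b\<bar>"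
      using elim(2) by (intro mult_right_mono) auto
    also have "\<dots> \<le> c * \<bar>b\<bar> * (1 + 2 powr (p - 2) * (\<bar>a\<bar> powr (p - 2) + \<bar>b\<bar> powr (p - 2)) + \<bar>a\<bar> powr (p - 2)) * \<bar>b\<bar>"
      using z(1) zp c0 by (intro mult_right_mono mult_mono mult_left_mono add_mono) auto
    also have "\<dots> = c * ((b\<^sup>2 + 2 powr (p - 2) * (b\<^sup>2 * \<bar>b\<bar> powr (p - 2))) + (1 + 2 powr (p - 2)) * (b\<^sup>2 * \<bar>a\<bar> powr (p - 2)))"
    proof -
      have "c * \<bar>b\<bar> * X * \<bar>b\<bar> = c * ((\<bar>b\<bar> * \<bar>b\<bar>) * X)" for X by (simp only: mult_ac)
      moreover have "\<bar>b\<bar> * \<bar>b\<bar> = b\<^sup>2" by (simp add: power2_eq_square)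
      ultimately have *: "c * \<bar>b\<bar> * X * \<bar>b\<bar> = c * (b\<^sup>2 * X)" for X by (simp only:)
      show ?thesis unfolding * by (simp add: algebra_simps)
    qed
    also have "b\<^sup>2 * \<bar>b\<bar> powr (p - 2) = \<bar>b\<bar> powr p"
      using powr_add[of "\<bar>b\<bar>" "p - 2" 2] p2 by (cases "b = 0") (auto simp: mult.commute)
    also have "c * ((b\<^sup>2 + 2 powr (p - 2) * \<bar>b\<bar> powr p) + (1 + 2 powr (p - 2)) * (b\<^sup>2 * \<bar>a\<bar> powr (p - 2)))
        \<le> c * ((1 + 2 powr (p - 2)) * (b\<^sup>2 + \<bar>b\<bar> powr p) + (1 + 2 powr (p - 2)) * (s\<^sup>2 * \<bar>a\<bar> powr p + s powr (2 - p) * \<bar>b\<bar> powr p))"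
    proof (intro mult_left_mono[OF _ c0] add_mono)
      show "b\<^sup>2 + 2 powr (p - 2) * \<bar>b\<bar> powr p \<le> (1 + 2 powr (p - 2)) * (b\<^sup>2 + \<bar>b\<bar> powr p)"
        by (simp add: distrib_left distrib_right)
      show "(1 + 2 powr (p - 2)) * (b\<^sup>2 * \<bar>a\<bar> powr (p - 2)) \<le> (1 + 2 powr (p - 2)) * (s\<^sup>2 * \<bar>a\<bar> powr p + s powr (2 - p) * \<bar>b\<bar> powr p)"
        using young_powr_square[OF s, of p b a] p2 by (intro mult_left_mono) auto
    qed
    finally show "\<bar>G x (a + b) - G x a - g x a * b\<bar>
        \<le> C * (b\<^sup>2 + \<bar>b\<bar> powr p + s\<^sup>2 * \<bar>a\<bar> powr p + s powr (2 - p) * \<bar>b\<bar> powr p)"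
      by (simp add: C_def algebra_simps)
  qed
qed

lemma integrable_G:
  assumes u: "u \<in> H" shows "integrable lebesgue (\<lambda>x. G x (u x))"
proof (rule Bochner_Integration.integrable_bound)
  let ?C = "c * (1 + 2 powr (p - 2))"
  show "integrable lebesgue (\<lambda>x. ?C * ((u x)\<^sup>2 + 2 * \<bar>u x\<bar> powr p))"
    using integrable_powr_p[OF u] frac_sobolevD(2)[OF u] by simp
  show "AE x in lebesgue. norm (G x (u x)) \<le> norm (?C * ((u x)\<^sup>2 + 2 * \<bar>u x\<bar> powr p))"
    using G_remainder g_zero
  proof eventually_elim
    case (elim x)
    have "\<bar>G x (u x)\<bar> \<le> ?C * ((u x)\<^sup>2 + 2 * \<bar>u x\<bar> powr p)"
      using elim(1)[rule_format, of 1 0 "u x"] elim(2) p2 by (simp add: G_zero add.commute)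
    then show ?case by simp
  qed
  show "(\<lambda>x. G x (u x)) \<in> borel_measurable lebesgue" using G_meas frac_sobolevD(1)[OF u] .
qed

definition J :: "real \<Rightarrow> (real^'n \<Rightarrow> real) \<Rightarrow> real" where
  "J \<mu> u = 1 / 2 * form \<mu> u u - (\<integral>x. G x (u x) \<partial>lebesgue)"

definition dJ :: "real \<Rightarrow> (real^'n \<Rightarrow> real) \<Rightarrow> (real^'n \<Rightarrow> real) \<Rightarrow> real" where
  "dJ \<mu> u v = form \<mu> u v - (\<integral>x. g x (u x) * v x \<partial>lebesgue)"

lemma dJ_add: "u \<in> H \<Longrightarrow> v \<in> H \<Longrightarrow> w \<in> H \<Longrightarrow> dJ \<mu> u (\<lambda>x. v x + w x) = dJ \<mu> u v + dJ \<mu> u w"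
  using integrable_g[of u v] integrable_g[of u w] by (simp add: dJ_def form_add_right distrib_left)

lemma dJ_scale: "dJ \<mu> u (\<lambda>x. a * v x) = a * dJ \<mu> u v"
  by (simp add: dJ_def form_scale_right right_diff_distrib mult.left_commute[of _ a])

text \<open>
  The bound is stated for all \<open>s\<close> above the norm of \<open>h\<close>, since \<open>h\<close> may have norm zero.
\<close>

lemma J_remainder:
  assumes u: "u \<in> H"
  shows "\<exists>M\<ge>0. \<forall>h\<in>H. \<forall>s. 0 < s \<longrightarrow> s \<le> 1 \<longrightarrow> nrm h \<le> s \<longrightarrow> \<bar>J \<mu> (\<lambda>x. u x + h x) - J \<mu> u - dJ \<mu> u h\<bar> \<le> M * s\<^sup>2"
proof -
  obtain S where S: "0 \<le> S" "\<And>u s. u \<in> H \<Longrightarrow> 0 < s \<Longrightarrow> nrm u \<le> s \<Longrightarrow> (\<integral>x. \<bar>u x\<bar> powr p \<partial>lebesgue) \<le> S * s powr p"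
    using sobolev_bound by blast
  obtain M where M: "0 \<le> M" "\<And>h. h \<in> H \<Longrightarrow> \<bar>form \<mu> h h\<bar> \<le> M * (nrm h)\<^sup>2" using form_bounded by blast
  define C where "C = c * (1 + 2 powr (p - 2))"
  have C0: "0 \<le> C" using c0 by (simp add: C_def)
  let ?U = "\<integral>x. \<bar>u x\<bar> powr p \<partial>lebesgue"
  have U0: "0 \<le> ?U" by simp
  show ?thesis
  proof (intro exI[of _ "M + C * (1 + S + ?U + S)"] conjI ballI allI impI)
    show "0 \<le> M + C * (1 + S + ?U + S)" using M S C0 U0 by simp
    fix h :: "real^'n \<Rightarrow> real" and s :: real
    assume h: "h \<in> H" and s: "0 < s" "s \<le> 1" "nrm h \<le> s"
    note I = integrable_powr_p[OF u] integrable_powr_p[OF h] frac_sobolevD(2)[OF u] frac_sobolevD(2)[OF h]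
      integrable_G[OF u] integrable_G[OF frac_sobolev_add[OF u h]] integrable_g[OF u h]
    let ?R = "\<integral>x. G x (u x + h x) - G x (u x) - g x (u x) * h x \<partial>lebesgue"
    have eq: "J \<mu> (\<lambda>x. u x + h x) - J \<mu> u - dJ \<mu> u h = 1 / 2 * form \<mu> h h - ?R"
    proof -
      have "J \<mu> (\<lambda>x. u x + h x) = 1 / 2 * (form \<mu> u u + 2 * form \<mu> u h + form \<mu> h h) - (\<integral>x. G x (u x + h x) \<partial>lebesgue)"
        by (simp only: J_def form_square_add[OF u h])
      moreover have "?R = (\<integral>x. G x (u x + h x) \<partial>lebesgue) - (\<integral>x. G x (u x) \<partial>lebesgue) - (\<integral>x. g x (u x) * h x \<partial>lebesgue)"
        using I by simp
      ultimately show ?thesis by (simp add: J_def dJ_def field_simps)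
    qed
    have "\<bar>?R\<bar> \<le> (\<integral>x. \<bar>G x (u x + h x) - G x (u x) - g x (u x) * h x\<bar> \<partial>lebesgue)" by (rule integral_abs_bound)
    also have "\<dots> \<le> (\<integral>x. C * ((h x)\<^sup>2 + \<bar>h x\<bar> powr p + s\<^sup>2 * \<bar>u x\<bar> powr p + s powr (2 - p) * \<bar>h x\<bar> powr p) \<partial>lebesgue)"
    proof (rule integral_mono_AE)
      show "AE x in lebesgue. \<bar>G x (u x + h x) - G x (u x) - g x (u x) * h x\<bar>
          \<le> C * ((h x)\<^sup>2 + \<bar>h x\<bar> powr p + s\<^sup>2 * \<bar>u x\<bar> powr p + s powr (2 - p) * \<bar>h x\<bar> powr p)"
        using G_remainder by eventually_elim (use s in \<open>simp add: C_def\<close>)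
    qed (use I in auto)
    also have "\<dots> = C * ((\<integral>x. (h x)\<^sup>2 \<partial>lebesgue) + (\<integral>x. \<bar>h x\<bar> powr p \<partial>lebesgue) + s\<^sup>2 * ?U + s powr (2 - p) * (\<integral>x. \<bar>h x\<bar> powr p \<partial>lebesgue))"
      using I by simp
    also have "\<dots> \<le> C * (s\<^sup>2 + S * s\<^sup>2 + s\<^sup>2 * ?U + S * s\<^sup>2)"
    proof (intro mult_left_mono[OF _ C0] add_mono order_refl)
      show "(\<integral>x. (h x)\<^sup>2 \<partial>lebesgue) \<le> s\<^sup>2" using L2_le_frac_sobolev_norm(1)[OF h s(3)] .
      have hp: "(\<integral>x. \<bar>h x\<bar> powr p \<partial>lebesgue) \<le> S * s powr p" using S(2)[OF h s(1) s(3)] .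
      also have "s powr p \<le> s powr 2" using s p2 by (intro powr_mono') auto
      also have "s powr 2 = s\<^sup>2" using s by simp
      finally show "(\<integral>x. \<bar>h x\<bar> powr p \<partial>lebesgue) \<le> S * s\<^sup>2" using S(1) by (simp add: mult_left_mono)
      have "s powr (2 - p) * (\<integral>x. \<bar>h x\<bar> powr p \<partial>lebesgue) \<le> s powr (2 - p) * (S * s powr p)"
        using hp by (intro mult_left_mono) auto
      also have "\<dots> = S * (s powr (2 - p) * s powr p)" by simp
      also have "s powr (2 - p) * s powr p = s\<^sup>2" using s by (simp flip: powr_add)
      finally show "s powr (2 - p) * (\<integral>x. \<bar>h x\<bar> powr p \<partial>lebesgue) \<le> S * s\<^sup>2" .
    qed
    finally have R: "\<bar>?R\<bar> \<le> C * (1 + S + ?U + S) * s\<^sup>2" by (simp add: algebra_simps)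
    have "(nrm h)\<^sup>2 \<le> s\<^sup>2" using s frac_sobolev_norm_nonneg by (intro power_mono)
    then have "M * (nrm h)\<^sup>2 \<le> M * s\<^sup>2" using M(1) by (rule mult_left_mono)
    then have F: "\<bar>form \<mu> h h\<bar> \<le> M * s\<^sup>2" using M(2)[OF h] by linarith
    have "\<bar>1 / 2 * form \<mu> h h - ?R\<bar> \<le> \<bar>form \<mu> h h\<bar> + \<bar>?R\<bar>" by linarith
    then show "\<bar>J \<mu> (\<lambda>x. u x + h x) - J \<mu> u - dJ \<mu> u h\<bar> \<le> (M + C * (1 + S + ?U + S)) * s\<^sup>2"
      unfolding eq using R F by (simp add: distrib_right)
  qed
qed

lemma J_frechet:
  assumes u: "u \<in> H" shows "has_frechet_derivative \<alpha> (J \<mu>) (dJ \<mu> u) u"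
  unfolding has_frechet_derivative_def
proof (intro conjI ballI allI impI)
  show "dJ \<mu> u (\<lambda>x. v x + w x) = dJ \<mu> u v + dJ \<mu> u w" if "v \<in> H" "w \<in> H" for v w
    using dJ_add[OF u that] .
  show "dJ \<mu> u (\<lambda>x. a * v x) = a * dJ \<mu> u v" for a v by (rule dJ_scale)
  obtain M where M: "0 \<le> M" "\<And>h s. h \<in> H \<Longrightarrow> 0 < s \<Longrightarrow> s \<le> 1 \<Longrightarrow> nrm h \<le> s \<Longrightarrow> \<bar>J \<mu> (\<lambda>x. u x + h x) - J \<mu> u - dJ \<mu> u h\<bar> \<le> M * s\<^sup>2"
    using J_remainder[OF u, of \<mu>] by blast
  obtain B where B: "\<And>v. v \<in> H \<Longrightarrow> nrm v \<le> 1 \<Longrightarrow> \<bar>\<integral>x. g x (u x) * v x \<partial>lebesgue\<bar> \<le> B"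
    using integral_g_bound[OF u] by blast
  obtain F where F: "0 \<le> F" "\<And>h. h \<in> H \<Longrightarrow> \<bar>form \<mu> h h\<bar> \<le> F * (nrm h)\<^sup>2" using form_bounded by blast
  have K: "\<bar>dJ \<mu> u v\<bar> \<le> F * (3 * (nrm u)\<^sup>2 + 3) + B" if v: "v \<in> H" "nrm v \<le> 1" for v
  proof -
    let ?s = "\<lambda>x. u x + v x"
    have v1: "(nrm v)\<^sup>2 \<le> 1" using v(2) frac_sobolev_norm_nonneg[of \<alpha> v] by (simp add: power_le_one)
    have "(nrm ?s)\<^sup>2 + (nrm u)\<^sup>2 + (nrm v)\<^sup>2 \<le> 3 * (nrm u)\<^sup>2 + 3"
      using frac_sobolev_norm_sq_add[OF u v(1)] v1 by linarith
    then have "F * ((nrm ?s)\<^sup>2 + (nrm u)\<^sup>2 + (nrm v)\<^sup>2) \<le> F * (3 * (nrm u)\<^sup>2 + 3)"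
      using F(1) by (rule mult_left_mono)
    then have "\<bar>form \<mu> ?s ?s\<bar> + \<bar>form \<mu> u u\<bar> + \<bar>form \<mu> v v\<bar> \<le> F * (3 * (nrm u)\<^sup>2 + 3)"
      using F(2)[OF frac_sobolev_add[OF u v(1)]] F(2)[OF u] F(2)[OF v(1)] by (simp only: distrib_left)
    moreover have "2 * form \<mu> u v = form \<mu> ?s ?s - form \<mu> u u - form \<mu> v v"
      using form_square_add[OF u v(1), of \<mu>] by simp
    ultimately have "\<bar>form \<mu> u v\<bar> \<le> F * (3 * (nrm u)\<^sup>2 + 3)" by linarith
    then show ?thesis using B[OF v] unfolding dJ_def by linarith
  qed
  show "\<exists>C. \<forall>v\<in>H. \<bar>dJ \<mu> u v\<bar> \<le> C * nrm v"
    using homogeneous_bounded[of \<alpha> "dJ \<mu> u", OF K dJ_scale] by blast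
  fix \<epsilon> :: real assume \<epsilon>: "0 < \<epsilon>"
  show "\<exists>\<delta>>0. \<forall>h\<in>H. nrm h < \<delta> \<longrightarrow> \<bar>J \<mu> (\<lambda>x. u x + h x) - J \<mu> u - dJ \<mu> u h\<bar> \<le> \<epsilon> * nrm h"
  proof (intro exI[of _ "min 1 (\<epsilon> / (M + 1))"] conjI ballI impI)
    show "0 < min 1 (\<epsilon> / (M + 1))" using \<epsilon> M(1) by simp
    fix h assume h: "h \<in> H" and n: "nrm h < min 1 (\<epsilon> / (M + 1))"
    let ?r = "\<bar>J \<mu> (\<lambda>x. u x + h x) - J \<mu> u - dJ \<mu> u h\<bar>"
    show "?r \<le> \<epsilon> * nrm h"
    proof (cases "nrm h = 0")
      case True
      have "?r \<le> 0 + e" if e: "0 < e" for e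
      proof -
        define s where "s = min 1 (e / (M + 1))"
        have s: "0 < s" "s \<le> 1" "s \<le> e / (M + 1)" using e M(1) by (auto simp: s_def)
        have "?r \<le> M * s\<^sup>2" using M(2)[OF h s(1,2)] True s by simp
        also have "\<dots> \<le> (M + 1) * s" using s M(1) by (intro mult_mono) (auto simp: power2_eq_square mult_left_le)
        also have "\<dots> \<le> e" using s(3) M(1) by (simp add: field_simps)
        finally show ?thesis by simp
      qed
      then have "?r \<le> 0" by (rule field_le_epsilon)
      then show ?thesis using True by simp
    next
      case False
      then have s: "0 < nrm h" using frac_sobolev_norm_nonneg[of \<alpha> h] by simp
      have "?r \<le> M * (nrm h)\<^sup>2" using M(2)[OF h s] n by simp
      also have "\<dots> = (M * nrm h) * nrm h" by (simp add: power2_eq_square)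
      also have "\<dots> \<le> \<epsilon> * nrm h"
      proof (intro mult_right_mono)
        have "(M + 1) * nrm h \<le> \<epsilon>" using n M(1) by (simp add: field_simps)
        then show "M * nrm h \<le> \<epsilon>" using s by (simp add: distrib_right)
      qed (use s in simp)
      finally show ?thesis .
    qed
  qed
qed

lemma J_frechet_unique:
  assumes "u \<in> H" "has_frechet_derivative \<alpha> (J \<mu>) L u" "v \<in> H"
  shows "L v = dJ \<mu> u v"
  using frechet_derivative_unique[OF assms(2) J_frechet[OF assms(1)] assms(3)] .

definition nehari_set :: "real \<Rightarrow> (real^'n \<Rightarrow> real) set" where
  "nehari_set \<mu> = {u \<in> H. \<not> (AE x in lebesgue. u x = 0) \<and> dJ \<mu> u u = 0}"


section \<open>The Nehari manifold\<close>

text \<open>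
  For small \<open>\<mu>\<close> the Hardy term takes away at most half of the lower bound for the rest of the form.
\<close>

lemma coercive: "\<exists>\<mu>'>0. \<exists>\<theta>>0. \<forall>\<mu>. 0 \<le> \<mu> \<longrightarrow> \<mu> \<le> \<mu>' \<longrightarrow> (\<forall>u\<in>H. \<theta> * (nrm u)\<^sup>2 \<le> form \<mu> u u)"
proof -
  obtain C where C: "0 \<le> C" "\<And>u :: real^'n \<Rightarrow> real. u \<in> H \<Longrightarrow> (\<integral>x. u x * u x / norm x powr \<alpha> \<partial>lebesgue) \<le> C * (nrm u)\<^sup>2"
    using hardy_bound by blast
  define k where "k = min \<kappa> v0"
  have k: "0 < k" using kappa v0 by (simp add: k_def)
  define m where "m = k / (2 * (C + 1))"
  have m: "0 < m" using k C(1) by (simp add: m_def)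
  show ?thesis
  proof (rule exI[of _ m], rule conjI[OF m], rule exI[of _ "k / 2"], intro conjI allI impI ballI)
    show "0 < k / 2" using k by simp
    fix \<mu> :: real and u :: "real^'n \<Rightarrow> real"
    assume \<mu>: "0 \<le> \<mu>" "\<mu> \<le> m" and u: "u \<in> H"
    let ?I = "\<integral>x. u x * u x / norm x powr \<alpha> \<partial>lebesgue"
    have "\<mu> * ?I \<le> \<mu> * (C * (nrm u)\<^sup>2)" using \<mu> C(2)[OF u] by (intro mult_left_mono)
    also have "\<dots> \<le> m * (C * (nrm u)\<^sup>2)" using \<mu> C(1) by (intro mult_right_mono) auto
    also have "\<dots> = (m * C) * (nrm u)\<^sup>2" by simp
    also have "\<dots> \<le> (k / 2) * (nrm u)\<^sup>2"
      using k C(1) by (intro mult_right_mono) (simp_all add: m_def field_simps)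
    finally show "k / 2 * (nrm u)\<^sup>2 \<le> form \<mu> u u"
      using form_zero_bounds(1)[OF u] form_mu[of \<mu> u u] by (simp add: k_def)
  qed
qed

text \<open>
  On the Nehari manifold \<open>\<integral> g(x,u) u\<close> equals the quadratic form. Since \<open>g\<close> is superlinear at \<open>0\<close>, half of
  the lower bound \<open>\<theta> (nrm u)\<^sup>2\<close> is at most a multiple of \<open>\<integral> |u|\<^sup>p\<close>, which is at most a multiple of the \<open>p\<close>-th power of the
  norm; as \<open>p > 2\<close>, the norm cannot be small, and then neither can \<open>\<integral> |u|\<^sup>p\<close>.
\<close>

lemma nehari_lower_bound:
  assumes \<theta>: "0 < \<theta>"
  shows "\<exists>\<rho>>0. \<forall>\<mu>. \<forall>u\<in>nehari_set \<mu>. \<theta> * (nrm u)\<^sup>2 \<le> form \<mu> u u \<longrightarrow> \<rho> \<le> (\<integral>x. \<bar>u x\<bar> powr p \<partial>lebesgue)"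
proof -
  obtain S where S: "0 \<le> S" "\<And>u s. u \<in> H \<Longrightarrow> 0 < s \<Longrightarrow> nrm u \<le> s \<Longrightarrow> (\<integral>x. \<bar>u x\<bar> powr p \<partial>lebesgue) \<le> S * s powr p"
    using sobolev_bound by blast
  obtain C where C: "0 \<le> C" "AE x in lebesgue. \<forall>s. g x s * s \<le> (\<theta> / 2) * s\<^sup>2 + C * \<bar>s\<bar> powr p"
    using g_subcritical[of "\<theta> / 2"] \<theta> by auto
  define n0 where "n0 = (\<theta> / (2 * (C * S + 1))) powr (1 / (p - 2))"
  have CS: "0 < C * S + 1" using C S by (simp add: add_nonneg_pos)
  have n0: "0 < n0" using \<theta> CS by (simp add: n0_def)
  have n0p: "n0 powr (p - 2) = \<theta> / (2 * (C * S + 1))" using \<theta> CS p2 by (simp add: n0_def powr_powr)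
  define \<rho> where "\<rho> = \<theta> / 2 * n0\<^sup>2 / (C + 1)"
  show ?thesis
  proof (intro exI[of _ \<rho>] conjI allI ballI impI)
    show "0 < \<rho>" using \<theta> n0 C(1) by (simp add: \<rho>_def)
    fix \<mu> u assume uN: "u \<in> nehari_set \<mu>" and co: "\<theta> * (nrm u)\<^sup>2 \<le> form \<mu> u u"
    have u: "u \<in> H" and ne: "\<not> (AE x in lebesgue. u x = 0)" and d: "dJ \<mu> u u = 0"
      using uN by (auto simp: nehari_set_def)
    have n: "0 < nrm u" using frac_sobolev_norm_eq_0[OF u] ne frac_sobolev_norm_nonneg[of \<alpha> u] by fastforce
    let ?P = "\<integral>x. \<bar>u x\<bar> powr p \<partial>lebesgue"
    have P0: "0 \<le> ?P" by simp
    have "\<theta> * (nrm u)\<^sup>2 \<le> (\<integral>x. g x (u x) * u x \<partial>lebesgue)" using co d by (simp add: dJ_def)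
    also have "\<dots> \<le> (\<integral>x. \<theta> / 2 * (u x)\<^sup>2 + C * \<bar>u x\<bar> powr p \<partial>lebesgue)"
      using integrable_g[OF u u] integrable_powr_p[OF u] frac_sobolevD(2)[OF u] C(2)
      by (intro integral_mono_AE) (auto elim!: eventually_mono)
    also have "\<dots> = \<theta> / 2 * (\<integral>x. (u x)\<^sup>2 \<partial>lebesgue) + C * ?P"
      using integrable_powr_p[OF u] frac_sobolevD(2)[OF u] by simp
    also have "\<dots> \<le> \<theta> / 2 * (nrm u)\<^sup>2 + C * ?P"
      using L2_le_frac_sobolev_norm(1)[OF u order_refl] \<theta> by simp
    finally have main: "\<theta> / 2 * (nrm u)\<^sup>2 \<le> C * ?P" by simp
    also have "C * ?P \<le> C * (S * nrm u powr p)" using S(2)[OF u n order_refl] C(1) by (rule mult_left_mono)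
    also have "nrm u powr p = nrm u powr (p - 2) * (nrm u)\<^sup>2" using n powr_add[of "nrm u" "p - 2" 2] by simp
    finally have "\<theta> / 2 * (nrm u)\<^sup>2 \<le> (C * S * nrm u powr (p - 2)) * (nrm u)\<^sup>2" by (simp add: mult_ac)
    then have le: "\<theta> / 2 \<le> C * S * nrm u powr (p - 2)" using n by simp
    have "n0 \<le> nrm u"
    proof (rule ccontr)
      assume "\<not> ?thesis"
      then have "nrm u powr (p - 2) \<le> n0 powr (p - 2)" using n p2 by (intro powr_mono2) auto
      then have "C * S * nrm u powr (p - 2) \<le> C * S * (\<theta> / (2 * (C * S + 1)))"
        unfolding n0p using C(1) S(1) by (intro mult_left_mono) auto
      moreover have "X * (\<theta> / (2 * (X + 1))) < \<theta> / 2" if "0 < X + 1" for X using that \<theta> by (simp add: field_simps)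
      from this[OF CS] have "C * S * (\<theta> / (2 * (C * S + 1))) < \<theta> / 2" .
      ultimately show False using le by linarith
    qed
    then have "n0\<^sup>2 \<le> (nrm u)\<^sup>2" using n0 by (intro power_mono) auto
    then have "\<theta> / 2 * n0\<^sup>2 \<le> \<theta> / 2 * (nrm u)\<^sup>2" using \<theta> by simp
    also have "\<dots> \<le> (C + 1) * ?P"
    proof -
      have "(C + 1) * ?P = C * ?P + ?P" by (simp add: distrib_right)
      then show ?thesis using main P0 by linarith
    qed
    also have "\<theta> / 2 * n0\<^sup>2 = (C + 1) * \<rho>"
    proof -
      have "X = Y * (X / Y)" if "0 < Y" for X Y :: real using that by simp
      then show ?thesis unfolding \<rho>_def using C(1) by (simp only: add_nonneg_pos zero_less_one)
    qed
    finally show "\<rho> \<le> ?P" using C(1) by (intro mult_left_le_imp_le[of "C + 1" \<rho> ?P]) auto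
  qed
qed

text \<open>
  The defect in the Ambrosetti-Rabinowitz inequality \<open>G(x,u) \<le> g(x,u) u / q\<close>.
\<close>

definition ar_defect :: "(real^'n \<Rightarrow> real) \<Rightarrow> real^'n \<Rightarrow> real" where
  "ar_defect u x = 1 / q * (g x (u x) * u x) - G x (u x)"

lemma ar_defect_nonneg: "AE x in lebesgue. \<forall>u. 0 \<le> ar_defect u x"
  using G_ray
proof eventually_elim
  case (elim x)
  show ?case
  proof
    fix u :: "real^'n \<Rightarrow> real"
    have "(0 powr q - 1) / q * (g x (u x) * u x) \<le> G x (0 * u x) - G x (u x)"
      using elim by blast
    then show "0 \<le> ar_defect u x" using G_zero exps by (simp add: ar_defect_def)
  qed
qed

lemma integrable_ar_defect: "u \<in> H \<Longrightarrow> integrable lebesgue (ar_defect u)"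
  unfolding ar_defect_def[abs_def] using integrable_g integrable_G by auto

text \<open>
  This is \<open>J \<mu> u - dJ \<mu> u u / q\<close>.
\<close>

lemma J_on_nehari:
  assumes u: "u \<in> H" and d: "dJ \<mu> u u = 0"
  shows "J \<mu> u = (1 / 2 - 1 / q) * form \<mu> u u + (\<integral>x. ar_defect u x \<partial>lebesgue)"
proof -
  have "(\<integral>x. ar_defect u x \<partial>lebesgue) = 1 / q * (\<integral>x. g x (u x) * u x \<partial>lebesgue) - (\<integral>x. G x (u x) \<partial>lebesgue)"
    unfolding ar_defect_def using integrable_g[OF u u] integrable_G[OF u] by simp
  moreover have "(\<integral>x. g x (u x) * u x \<partial>lebesgue) = form \<mu> u u" using d by (simp add: dJ_def)
  ultimately show ?thesis by (simp add: J_def algebra_simps)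
qed

lemma J_antimono_mu:
  assumes "0 \<le> \<mu>" "u \<in> H" shows "J \<mu> u \<le> J 0 u"
proof -
  have "0 \<le> \<mu> * (\<integral>x. u x * u x / norm x powr \<alpha> \<partial>lebesgue)"
    using assms by (intro mult_nonneg_nonneg) auto
  then show ?thesis using form_mu[of \<mu> u u] by (simp add: J_def)
qed

text \<open>
  Along the ray, \<open>G\<close> grows at least like \<open>(t\<^sup>q - 1)/q\<close> times \<open>g(x,v) v\<close>, whose integral is the quadratic
  form on the Nehari manifold. So the energy changes by at most \<open>(t\<^sup>2 - 1)/2 - (t\<^sup>q - 1)/q\<close> times the form,
  and this factor is nonpositive by Young's inequality.
\<close>

lemma J_ray_le:
  assumes v: "v \<in> nehari_set 0" and t: "0 \<le> t"
  shows "J 0 (\<lambda>x. t * v x) \<le> J 0 v"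
proof -
  have vH: "v \<in> H" and d: "dJ 0 v v = 0" using v by (auto simp: nehari_set_def)
  have tv: "(\<lambda>x. t * v x) \<in> H" by (rule frac_sobolev_scale[OF vH])
  have F: "(\<integral>x. g x (v x) * v x \<partial>lebesgue) = form 0 v v" using d by (simp add: dJ_def)
  have F0: "0 \<le> form 0 v v"
  proof -
    have "0 \<le> min \<kappa> v0 * (nrm v)\<^sup>2" using kappa v0 by simp
    then show ?thesis using form_zero_bounds(1)[OF vH] by linarith
  qed
  have "(t powr q - 1) / q * form 0 v v = (\<integral>x. (t powr q - 1) / q * (g x (v x) * v x) \<partial>lebesgue)"
    by (simp add: F)
  also have "\<dots> \<le> (\<integral>x. G x (t * v x) - G x (v x) \<partial>lebesgue)"
  proof (rule integral_mono_AE)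
    show "AE x in lebesgue. (t powr q - 1) / q * (g x (v x) * v x) \<le> G x (t * v x) - G x (v x)"
      using G_ray by eventually_elim (use t in blast)
  qed (use integrable_g[OF vH vH] integrable_G[OF vH] integrable_G[OF tv] in auto)
  also have "\<dots> = (\<integral>x. G x (t * v x) \<partial>lebesgue) - (\<integral>x. G x (v x) \<partial>lebesgue)"
    using integrable_G[OF vH] integrable_G[OF tv] by simp
  finally have 1: "(t powr q - 1) / q * form 0 v v \<le> (\<integral>x. G x (t * v x) \<partial>lebesgue) - (\<integral>x. G x (v x) \<partial>lebesgue)" .
  have "t\<^sup>2 / 2 - 1 / 2 \<le> (t powr q - 1) / q"
  proof (cases "t = 0")
    case True
    have "1 / q \<le> 1 / 2" using exps by (intro divide_left_mono) auto
    then show ?thesis using True exps by simp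
  next
    case False
    then have t0: "0 < t" using t by simp
    have "(t powr q) powr (2 / q) * 1 powr (1 - 2 / q) \<le> 2 / q * t powr q + (1 - 2 / q) * 1"
      using t0 exps by (intro Youngs_inequality_0) auto
    then have "t\<^sup>2 \<le> 2 / q * t powr q + (1 - 2 / q)" using t0 exps by (simp add: powr_powr)
    moreover have "(t powr q - 1) / q = t powr q / q - 1 / q" by (rule diff_divide_distrib)
    ultimately show ?thesis by simp
  qed
  then have "(t\<^sup>2 / 2 - 1 / 2) * form 0 v v \<le> (t powr q - 1) / q * form 0 v v" using F0 by (rule mult_right_mono)
  with 1 have "(t\<^sup>2 / 2 - 1 / 2) * form 0 v v \<le> (\<integral>x. G x (t * v x) \<partial>lebesgue) - (\<integral>x. G x (v x) \<partial>lebesgue)"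
    by linarith
  then show ?thesis by (simp add: J_def form_square_scale left_diff_distrib)
qed

text \<open>
  The superlinear growth of \<open>G\<close> holds for large arguments; for small ones the quadratic bound on \<open>G\<close>
  costs a multiple of \<open>s\<^sup>2\<close>, which is of lower order along the ray.
\<close>

lemma J_ray_negative:
  assumes v: "v \<in> H" and ne: "\<not> (AE x in lebesgue. v x = 0)"
  shows "\<exists>T>0. J 0 (\<lambda>x. T * v x) < 0"
proof -
  obtain R where R: "0 < R" "AE x in lebesgue. \<forall>s. R \<le> \<bar>s\<bar> \<longrightarrow> \<bar>s\<bar> powr q \<le> G x s"
    using G_superlinear by blast
  define C where "C = c * (1 + 2 powr (p - 2))"
  have C0: "0 \<le> C" using c0 by (simp add: C_def)
  define A where "A = C * (1 + 2 * R powr (p - 2)) + R powr (q - 2)"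
  have A0: "0 \<le> A" using C0 by (simp add: A_def)
  have low: "AE x in lebesgue. \<forall>s. \<bar>s\<bar> powr q - A * s\<^sup>2 \<le> G x s"
    using R(2) G_remainder g_zero
  proof eventually_elim
    case (elim x)
    show ?case
    proof
      fix s
      show "\<bar>s\<bar> powr q - A * s\<^sup>2 \<le> G x s"
      proof (cases "R \<le> \<bar>s\<bar>")
        case True
        then have "\<bar>s\<bar> powr q \<le> G x s" using elim(1) by blast
        moreover have "0 \<le> A * s\<^sup>2" using A0 by simp
        ultimately show ?thesis by linarith
      next
        case False
        have pw: "\<bar>s\<bar> powr r \<le> R powr (r - 2) * s\<^sup>2" if "2 \<le> r" for r
        proof (cases "s = 0")
          case s: False
          have "\<bar>s\<bar> powr r = \<bar>s\<bar> powr (r - 2) * s\<^sup>2" using s powr_add[of "\<bar>s\<bar>" "r - 2" 2] by simp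
          also have "\<dots> \<le> R powr (r - 2) * s\<^sup>2" using False that by (intro mult_right_mono powr_mono2) auto
          finally show ?thesis .
        qed simp
        have "\<bar>G x s\<bar> \<le> C * (s\<^sup>2 + 2 * \<bar>s\<bar> powr p)"
          using elim(2)[rule_format, of 1 0 s] elim(3) p2 by (simp add: G_zero C_def add.commute)
        also have "\<dots> \<le> C * (s\<^sup>2 + 2 * (R powr (p - 2) * s\<^sup>2))"
          using pw[of p] p2 C0 by (intro mult_left_mono add_mono) auto
        finally have "- G x s \<le> C * (1 + 2 * R powr (p - 2)) * s\<^sup>2" by (simp add: algebra_simps)
        moreover have "\<bar>s\<bar> powr q \<le> R powr (q - 2) * s\<^sup>2" using pw[of q] exps by simp
        ultimately show ?thesis by (simp add: A_def distrib_right)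
      qed
    qed
  qed
  have Iq: "integrable lebesgue (\<lambda>x. \<bar>v x\<bar> powr q)"
    using sobolev_embedding[OF alpha, of q "nrm v"] exps v by auto
  let ?B = "\<integral>x. \<bar>v x\<bar> powr q \<partial>lebesgue"
  have B: "0 < ?B"
  proof -
    have "?B \<noteq> 0"
    proof
      assume "?B = 0"
      then have "AE x in lebesgue. \<bar>v x\<bar> powr q = 0"
        using integral_nonneg_eq_0_iff_AE[OF Iq] by simp
      then show False using ne by simp
    qed
    moreover have "0 \<le> ?B" by simp
    ultimately show ?thesis by linarith
  qed
  let ?U = "\<integral>x. (v x)\<^sup>2 \<partial>lebesgue"
  let ?D = "form 0 v v / 2 + A * ?U"
  have le: "J 0 (\<lambda>x. t * v x) \<le> t\<^sup>2 * (?D - t powr (q - 2) * ?B)" if t: "0 < t" for t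
  proof -
    have tv: "(\<lambda>x. t * v x) \<in> H" by (rule frac_sobolev_scale[OF v])
    have "(\<integral>x. t powr q * \<bar>v x\<bar> powr q - A * (t\<^sup>2 * (v x)\<^sup>2) \<partial>lebesgue) \<le> (\<integral>x. G x (t * v x) \<partial>lebesgue)"
    proof (rule integral_mono_AE)
      show "AE x in lebesgue. t powr q * \<bar>v x\<bar> powr q - A * (t\<^sup>2 * (v x)\<^sup>2) \<le> G x (t * v x)"
        using low
      proof eventually_elim
        case (elim x)
        from elim[rule_format, of "t * v x"] show ?case
          using t by (simp add: abs_mult powr_mult power_mult_distrib)
      qed
    qed (use Iq frac_sobolevD(2)[OF v] integrable_G[OF tv] in auto)
    moreover have "(\<integral>x. t powr q * \<bar>v x\<bar> powr q - A * (t\<^sup>2 * (v x)\<^sup>2) \<partial>lebesgue) = t powr q * ?B - A * (t\<^sup>2 * ?U)"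
      using Iq frac_sobolevD(2)[OF v] by simp
    moreover have "t powr q = t\<^sup>2 * t powr (q - 2)" using t powr_add[of t 2 "q - 2"] by simp
    ultimately show ?thesis by (simp add: J_def form_square_scale algebra_simps)
  qed
  define T where "T = ((\<bar>?D\<bar> + 1) / ?B) powr (1 / (q - 2))"
  have T: "0 < T" using B by (simp add: T_def)
  have "T powr (q - 2) * ?B = \<bar>?D\<bar> + 1" using B exps by (simp add: T_def powr_powr)
  then have "?D - T powr (q - 2) * ?B < 0" by linarith
  then have "T\<^sup>2 * (?D - T powr (q - 2) * ?B) < 0" using T by (intro mult_pos_neg) auto
  then show ?thesis using le[OF T] T by (intro exI[of _ T]) auto
qed

lemma J_zero: "J \<mu> (\<lambda>x. 0) = 0"
  using form_square_scale[of \<mu> 0 "\<lambda>x. 0"] by (simp add: J_def G_zero)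

lemma J_ray_DERIV:
  assumes v: "v \<in> H"
  shows "((\<lambda>t. J \<mu> (\<lambda>x. t * v x)) has_real_derivative dJ \<mu> (\<lambda>x. t * v x) v) (at t)"
proof -
  let ?u = "\<lambda>x. t * v x"
  have u: "?u \<in> H" by (rule frac_sobolev_scale[OF v])
  obtain M where M: "0 \<le> M" "\<And>h s. h \<in> H \<Longrightarrow> 0 < s \<Longrightarrow> s \<le> 1 \<Longrightarrow> nrm h \<le> s \<Longrightarrow>
      \<bar>J \<mu> (\<lambda>x. ?u x + h x) - J \<mu> ?u - dJ \<mu> ?u h\<bar> \<le> M * s\<^sup>2"
    using J_remainder[OF u, of \<mu>] by blast
  define n where "n = nrm v + 1"
  have n: "0 < n" using frac_sobolev_norm_nonneg[of \<alpha> v] by (simp add: n_def)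
  have "((\<lambda>h. (J \<mu> (\<lambda>x. (t + h) * v x) - J \<mu> ?u) / h) \<longlongrightarrow> dJ \<mu> ?u v) (at 0)"
  proof (rule LIM_zero_cancel, rule Lim_null_comparison)
    show "\<forall>\<^sub>F h in at 0. norm ((J \<mu> (\<lambda>x. (t + h) * v x) - J \<mu> ?u) / h - dJ \<mu> ?u v) \<le> M * n\<^sup>2 * \<bar>h\<bar>"
      unfolding eventually_at
    proof (intro exI[of _ "1 / n"] conjI ballI impI)
      show "0 < 1 / n" using n by simp
      fix h :: real assume h: "h \<noteq> 0 \<and> dist h 0 < 1 / n"
      define s where "s = \<bar>h\<bar> * n"
      have s: "0 < s" "s \<le> 1" using h n by (auto simp: s_def field_simps)
      have hn: "nrm (\<lambda>x. h * v x) \<le> s" using frac_sobolev_norm_nonneg[of \<alpha> v]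
        by (simp add: frac_sobolev_norm_scale s_def n_def mult_left_mono)
      have rem: "\<bar>J \<mu> (\<lambda>x. ?u x + h * v x) - J \<mu> ?u - dJ \<mu> ?u (\<lambda>x. h * v x)\<bar> \<le> M * s\<^sup>2"
        by (rule M(2)[OF frac_sobolev_scale[OF v] s hn])
      have *: "\<bar>J \<mu> (\<lambda>x. (t + h) * v x) - J \<mu> ?u - h * dJ \<mu> ?u v\<bar> \<le> M * n\<^sup>2 * \<bar>h\<bar> * \<bar>h\<bar>"
      proof -
        have "(\<lambda>x. (t + h) * v x) = (\<lambda>x. t * v x + h * v x)" by (simp add: distrib_right)
        moreover have "M * s\<^sup>2 = M * n\<^sup>2 * \<bar>h\<bar> * \<bar>h\<bar>" by (simp add: s_def power2_eq_square)
        ultimately show ?thesis using rem by (simp only: dJ_scale)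
      qed
      have "(J \<mu> (\<lambda>x. (t + h) * v x) - J \<mu> ?u) / h - dJ \<mu> ?u v =
        (J \<mu> (\<lambda>x. (t + h) * v x) - J \<mu> ?u - h * dJ \<mu> ?u v) / h"
        using h by (simp add: diff_divide_distrib)
      then have "norm ((J \<mu> (\<lambda>x. (t + h) * v x) - J \<mu> ?u) / h - dJ \<mu> ?u v) =
        \<bar>J \<mu> (\<lambda>x. (t + h) * v x) - J \<mu> ?u - h * dJ \<mu> ?u v\<bar> / \<bar>h\<bar>"
        by (simp only: real_norm_def abs_divide)
      also have "\<dots> \<le> M * n\<^sup>2 * \<bar>h\<bar>" using * h by (simp add: pos_divide_le_eq)
      finally show "norm ((J \<mu> (\<lambda>x. (t + h) * v x) - J \<mu> ?u) / h - dJ \<mu> ?u v) \<le> M * n\<^sup>2 * \<bar>h\<bar>" .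
    qed
    have "((\<lambda>h. M * n\<^sup>2 * \<bar>h\<bar>) \<longlongrightarrow> M * n\<^sup>2 * \<bar>0\<bar>) (at (0::real))" by (intro tendsto_intros)
    then show "((\<lambda>h. M * n\<^sup>2 * \<bar>h\<bar>) \<longlongrightarrow> 0) (at (0::real))" by simp
  qed
  then show ?thesis by (simp add: DERIV_def)
qed

text \<open>
  Near \<open>0\<close> the quadratic form dominates: the subcritical bound on \<open>g\<close> with \<open>\<epsilon> = \<theta>/2\<close> uses up at most half
  of it, and the remaining term is of order \<open>t\<^sup>p\<close>.
\<close>

lemma J_ray_positive:
  assumes v: "v \<in> H" and ne: "\<not> (AE x in lebesgue. v x = 0)" and \<theta>: "0 < \<theta>" "\<theta> * (nrm v)\<^sup>2 \<le> form \<mu> v v" and T: "0 < T"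
  shows "\<exists>t>0. t < T \<and> 0 < J \<mu> (\<lambda>x. t * v x)"
proof -
  have n: "0 < nrm v" using frac_sobolev_norm_eq_0[OF v] ne frac_sobolev_norm_nonneg[of \<alpha> v] by fastforce
  obtain C where C: "0 \<le> C" "AE x in lebesgue. \<forall>s. g x s * s \<le> (\<theta> / 2) * s\<^sup>2 + C * \<bar>s\<bar> powr p"
    using g_subcritical[of "\<theta> / 2"] \<theta> by auto
  let ?P = "\<integral>x. \<bar>v x\<bar> powr p \<partial>lebesgue" and ?U = "\<integral>x. (v x)\<^sup>2 \<partial>lebesgue"
  have P0: "0 \<le> ?P" by simp
  have Gle: "AE x in lebesgue. \<forall>s. G x s \<le> \<theta> / 4 * s\<^sup>2 + C * \<bar>s\<bar> powr p"
    using C(2) G_ray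
  proof eventually_elim
    case (elim x)
    show ?case
    proof
      fix s
      have "(0 powr q - 1) / q * (g x s * s) \<le> G x (0 * s) - G x s" using elim(2) by blast
      then have "G x s \<le> g x s * s / q" using G_zero exps by simp
      also have "\<dots> \<le> (\<theta> / 2 * s\<^sup>2 + C * \<bar>s\<bar> powr p) / q" using elim(1) exps by (intro divide_right_mono) auto
      also have "\<dots> \<le> (\<theta> / 2 * s\<^sup>2 + C * \<bar>s\<bar> powr p) / 2"
        using exps \<theta> C(1) by (intro divide_left_mono) auto
      also have "\<dots> \<le> \<theta> / 4 * s\<^sup>2 + C * \<bar>s\<bar> powr p" using C(1) by (simp add: add_divide_distrib)
      finally show "G x s \<le> \<theta> / 4 * s\<^sup>2 + C * \<bar>s\<bar> powr p" .
    qed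
  qed
  have le: "t\<^sup>2 * (\<theta> / 4 * (nrm v)\<^sup>2 - t powr (p - 2) * (C * ?P)) \<le> J \<mu> (\<lambda>x. t * v x)" if t: "0 < t" for t
  proof -
    have tv: "(\<lambda>x. t * v x) \<in> H" by (rule frac_sobolev_scale[OF v])
    have "(\<integral>x. G x (t * v x) \<partial>lebesgue) \<le> (\<integral>x. \<theta> / 4 * (t\<^sup>2 * (v x)\<^sup>2) + C * (t powr p * \<bar>v x\<bar> powr p) \<partial>lebesgue)"
    proof (rule integral_mono_AE)
      show "AE x in lebesgue. G x (t * v x) \<le> \<theta> / 4 * (t\<^sup>2 * (v x)\<^sup>2) + C * (t powr p * \<bar>v x\<bar> powr p)"
        using Gle
      proof eventually_elim
        case (elim x)
        from elim[rule_format, of "t * v x"] show ?case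
          using t by (simp add: abs_mult powr_mult power_mult_distrib)
      qed
    qed (use integrable_powr_p[OF v] frac_sobolevD(2)[OF v] integrable_G[OF tv] in auto)
    also have "\<dots> = \<theta> / 4 * (t\<^sup>2 * ?U) + C * (t powr p * ?P)"
      using integrable_powr_p[OF v] frac_sobolevD(2)[OF v] by simp
    also have "\<theta> / 4 * (t\<^sup>2 * ?U) \<le> \<theta> / 4 * (t\<^sup>2 * (nrm v)\<^sup>2)"
      using L2_le_frac_sobolev_norm(1)[OF v order_refl] \<theta> by (intro mult_left_mono) auto
    finally have 1: "(\<integral>x. G x (t * v x) \<partial>lebesgue) \<le> \<theta> / 4 * (t\<^sup>2 * (nrm v)\<^sup>2) + C * (t powr p * ?P)" by simp
    have 2: "t\<^sup>2 * (\<theta> * (nrm v)\<^sup>2) \<le> t\<^sup>2 * form \<mu> v v" using \<theta>(2) by (rule mult_left_mono) simp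
    have 3: "t powr p = t\<^sup>2 * t powr (p - 2)" using t powr_add[of t 2 "p - 2"] by simp
    have 0: "0 \<le> t\<^sup>2 * (\<theta> * (nrm v)\<^sup>2)" using \<theta> by simp
    have eq: "t\<^sup>2 * (\<theta> / 4 * (nrm v)\<^sup>2 - t powr (p - 2) * (C * ?P)) = (t\<^sup>2 * (\<theta> * (nrm v)\<^sup>2)) / 4 - C * (t powr p * ?P)"
      by (simp add: 3 algebra_simps)
    have "\<theta> / 4 * (t\<^sup>2 * (nrm v)\<^sup>2) = (t\<^sup>2 * (\<theta> * (nrm v)\<^sup>2)) / 4" by simp
    with 1 2 0 show ?thesis unfolding eq J_def form_square_scale by linarith
  qed
  define r where "r = (\<theta> / 8 * (nrm v)\<^sup>2 / (C * ?P + 1)) powr (1 / (p - 2))"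
  have CP: "0 < C * ?P + 1" using C P0 by (simp add: add_nonneg_pos)
  have r: "0 < r" using \<theta> n CP by (simp add: r_def)
  have rp: "r powr (p - 2) = \<theta> / 8 * (nrm v)\<^sup>2 / (C * ?P + 1)" using \<theta> n CP p2 by (simp add: r_def powr_powr)
  define t where "t = min r (T / 2)"
  have t: "0 < t" "t < T" "t \<le> r" using r T by (auto simp: t_def)
  have "t powr (p - 2) * (C * ?P) \<le> r powr (p - 2) * (C * ?P + 1)"
    using t p2 C P0 by (intro mult_mono powr_mono2) auto
  also have "\<dots> = \<theta> / 8 * (nrm v)\<^sup>2"
  proof -
    have "X / Y * Y = X" if "0 < Y" for X Y :: real using that by simp
    from this[OF CP] show ?thesis unfolding rp .
  qed
  also have "\<dots> < \<theta> / 4 * (nrm v)\<^sup>2" using \<theta> n by simp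
  finally have "0 < t\<^sup>2 * (\<theta> / 4 * (nrm v)\<^sup>2 - t powr (p - 2) * (C * ?P))" using t by simp
  then show ?thesis using le[OF t(1)] t by (intro exI[of _ t]) auto
qed

text \<open>
  The energy along the ray vanishes at \<open>0\<close>, is positive for small \<open>t\<close> and negative at \<open>T\<close>, so its maximum
  on \<open>[0, T]\<close> is attained inside, where the derivative along the ray vanishes.
\<close>

lemma nehari_projection:
  assumes v: "v \<in> H" and ne: "\<not> (AE x in lebesgue. v x = 0)" and \<theta>: "0 < \<theta>" "\<theta> * (nrm v)\<^sup>2 \<le> form \<mu> v v"
    and T: "0 < T" "J \<mu> (\<lambda>x. T * v x) < 0"
  shows "\<exists>t>0. t < T \<and> (\<lambda>x. t * v x) \<in> nehari_set \<mu>"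
proof -
  let ?\<phi> = "\<lambda>t. J \<mu> (\<lambda>x. t * v x)"
  note D = J_ray_DERIV[OF v, of \<mu>]
  have cont: "continuous_on {0..T} ?\<phi>"
    by (intro continuous_at_imp_continuous_on ballI DERIV_isCont[OF D])
  then obtain t where t: "t \<in> {0..T}" "\<And>s. s \<in> {0..T} \<Longrightarrow> ?\<phi> s \<le> ?\<phi> t"
    using continuous_attains_sup[of "{0..T}" ?\<phi>] T by auto
  obtain s where s: "0 < s" "s < T" "0 < ?\<phi> s" using J_ray_positive[OF v ne \<theta> T(1)] by blast
  have pos: "0 < ?\<phi> t" using t(2)[of s] s by simp
  have "t \<noteq> 0" "t \<noteq> T" using pos T J_zero[of \<mu>] by auto
  then have tt: "0 < t" "t < T" using t(1) by auto
  have "dJ \<mu> (\<lambda>x. t * v x) v = 0"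
  proof (rule DERIV_local_max[OF D])
    show "0 < min t (T - t)" using tt by simp
    show "\<forall>y. \<bar>t - y\<bar> < min t (T - t) \<longrightarrow> ?\<phi> y \<le> ?\<phi> t" using t(2) by (auto simp: abs_less_iff)
  qed
  then have "dJ \<mu> (\<lambda>x. t * v x) (\<lambda>x. t * v x) = 0" by (simp add: dJ_scale)
  moreover have "\<not> (AE x in lebesgue. t * v x = 0)" using ne tt by simp
  ultimately have "(\<lambda>x. t * v x) \<in> nehari_set \<mu>" by (simp add: nehari_set_def frac_sobolev_scale[OF v])
  then show ?thesis using tt by blast
qed


section \<open>Translations and weak limits\<close>

lemma form_translation:
  assumes u: "u \<in> H" and v: "v \<in> H" and z: "z \<in> int_lattice"
  shows "form 0 (\<lambda>x. u (x + z)) (\<lambda>x. v (x + z)) = form 0 u v"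
proof -
  note [measurable] = V_meas frac_sobolevD(1)[OF u] frac_sobolevD(1)[OF v] frac_sobolevD(4)[OF u] frac_sobolevD(4)[OF v]
  have 1: "(\<integral>p. diff_quot \<alpha> (\<lambda>x. u (x + z)) p * diff_quot \<alpha> (\<lambda>x. v (x + z)) p \<partial>lebesgue)
      = (\<integral>p. diff_quot \<alpha> u p * diff_quot \<alpha> v p \<partial>lebesgue)"
    unfolding diff_quot_translation
    by (rule integral_translation[where f="\<lambda>p. diff_quot \<alpha> u p * diff_quot \<alpha> v p"]) measurable
  have [measurable]: "(\<lambda>x. u (x + z)) \<in> borel_measurable lebesgue" "(\<lambda>x. v (x + z)) \<in> borel_measurable lebesgue"
    "(\<lambda>x. V (x + z)) \<in> borel_measurable lebesgue"
    using borel_measurable_translation by measurable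
  have "(\<integral>x. V x * (u (x + z) * v (x + z)) \<partial>lebesgue) = (\<integral>x. V (x + z) * (u (x + z) * v (x + z)) \<partial>lebesgue)"
    using V_periodic[OF z] by (intro integral_cong_AE) auto
  also have "\<dots> = (\<integral>x. V x * (u x * v x) \<partial>lebesgue)"
    by (rule integral_translation[where f="\<lambda>x. V x * (u x * v x)"]) measurable
  finally show ?thesis using 1 by (simp add: form_def)
qed

lemma integral_g_translation:
  assumes u: "u \<in> H" and v: "v \<in> H" and z: "z \<in> int_lattice"
  shows "(\<integral>x. g x (u (x + z)) * v (x + z) \<partial>lebesgue) = (\<integral>x. g x (u x) * v x \<partial>lebesgue)"
proof -
  have uz: "(\<lambda>x. u (x + z)) \<in> borel_measurable lebesgue" "(\<lambda>x. v (x + z)) \<in> borel_measurable lebesgue"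
    using frac_sobolevD(1)[OF u] frac_sobolevD(1)[OF v] by (auto intro: borel_measurable_translation)
  have gm: "(\<lambda>x. g x (u x) * v x) \<in> borel_measurable lebesgue"
    using integrable_g[OF u v] by (rule borel_measurable_integrable)
  have "(\<integral>x. g x (u (x + z)) * v (x + z) \<partial>lebesgue) = (\<integral>x. g (x + z) (u (x + z)) * v (x + z) \<partial>lebesgue)"
  proof (rule integral_cong_AE)
    show "(\<lambda>x. g x (u (x + z)) * v (x + z)) \<in> borel_measurable lebesgue"
      using g_meas[OF uz(1)] uz(2) by measurable
    show "(\<lambda>x. g (x + z) (u (x + z)) * v (x + z)) \<in> borel_measurable lebesgue"
      using borel_measurable_translation[OF gm, of z] .
    show "AE x in lebesgue. g x (u (x + z)) * v (x + z) = g (x + z) (u (x + z)) * v (x + z)"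
      using gG_periodic[OF z] by eventually_elim simp
  qed
  also have "\<dots> = (\<integral>x. g x (u x) * v x \<partial>lebesgue)"
    by (rule integral_translation[where f="\<lambda>x. g x (u x) * v x"]) (rule gm)
  finally show ?thesis .
qed

lemma integral_ar_defect_translation:
  assumes u: "u \<in> H" and z: "z \<in> int_lattice"
  shows "(\<integral>x. ar_defect (\<lambda>x. u (x + z)) x \<partial>lebesgue) = (\<integral>x. ar_defect u x \<partial>lebesgue)"
proof -
  have m: "ar_defect u \<in> borel_measurable lebesgue"
    using integrable_ar_defect[OF u] by (rule borel_measurable_integrable)
  have "(\<integral>x. ar_defect (\<lambda>x. u (x + z)) x \<partial>lebesgue) = (\<integral>x. ar_defect u (x + z) \<partial>lebesgue)"
  proof (rule integral_cong_AE)
    show "ar_defect (\<lambda>x. u (x + z)) \<in> borel_measurable lebesgue"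
      using integrable_ar_defect[OF frac_sobolev_translation[OF u]] by (rule borel_measurable_integrable)
    show "(\<lambda>x. ar_defect u (x + z)) \<in> borel_measurable lebesgue"
      using borel_measurable_translation[OF m] .
    show "AE x in lebesgue. ar_defect (\<lambda>x. u (x + z)) x = ar_defect u (x + z)"
      using gG_periodic[OF z] by eventually_elim (simp add: ar_defect_def)
  qed
  also have "\<dots> = (\<integral>x. ar_defect u x \<partial>lebesgue)" by (rule integral_translation[OF m])
  finally show ?thesis .
qed

text \<open>
  Lions' lemma yields arbitrary centres; moving them to lattice points costs a bounded enlargement of
  the ball.
\<close>

lemma lattice_point_near:
  fixes x :: "real^'n"
  shows "\<exists>y\<in>int_lattice. norm (x - y) \<le> real CARD('n)"
proof (intro bexI)
  let ?y = "\<chi> i. real_of_int \<lfloor>x $ i\<rfloor>"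
  have "norm (x - ?y) \<le> (\<Sum>i\<in>UNIV. \<bar>(x - ?y) $ i\<bar>)" by (rule norm_le_l1_cart)
  also have "\<dots> \<le> (\<Sum>i\<in>(UNIV :: 'n set). 1)"
  proof (rule sum_mono)
    fix i
    show "\<bar>(x - ?y) $ i\<bar> \<le> 1" by (simp add: abs_le_iff) linarith
  qed
  finally show "norm (x - ?y) \<le> real CARD('n)" by simp
  show "?y \<in> int_lattice" by (simp add: int_lattice_def)
qed

lemma lattice_uminus: "z \<in> int_lattice \<Longrightarrow> - z \<in> int_lattice"
  by (simp add: int_lattice_def)

lemma g_continuous: "AE x in lebesgue. \<forall>a s. a \<longlonglongrightarrow> s \<longrightarrow> (\<lambda>n. g x (a n)) \<longlonglongrightarrow> g x s"
  using g_lipschitz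
proof eventually_elim
  case (elim x)
  show ?case
  proof (intro allI impI)
    fix a :: "nat \<Rightarrow> real" and s assume a: "a \<longlonglongrightarrow> s"
    show "(\<lambda>n. g x (a n)) \<longlonglongrightarrow> g x s"
    proof (rule LIM_zero_cancel, rule Lim_null_comparison)
      show "\<forall>\<^sub>F n in sequentially. norm (g x (a n) - g x s) \<le> c * \<bar>a n - s\<bar> * (1 + \<bar>a n\<bar> powr (p - 2) + \<bar>s\<bar> powr (p - 2))"
        using elim by simp
      have pw: "(\<lambda>n. \<bar>a n\<bar> powr (p - 2)) \<longlonglongrightarrow> \<bar>s\<bar> powr (p - 2)"
        using p2 by (intro tendsto_powr2 tendsto_rabs a tendsto_const always_eventually) auto
      have "(\<lambda>n. c * \<bar>a n - s\<bar> * (1 + \<bar>a n\<bar> powr (p - 2) + \<bar>s\<bar> powr (p - 2)))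
          \<longlonglongrightarrow> c * \<bar>s - s\<bar> * (1 + \<bar>s\<bar> powr (p - 2) + \<bar>s\<bar> powr (p - 2))"
        by (intro tendsto_intros a pw)
      then show "(\<lambda>n. c * \<bar>a n - s\<bar> * (1 + \<bar>a n\<bar> powr (p - 2) + \<bar>s\<bar> powr (p - 2))) \<longlonglongrightarrow> 0" by simp
    qed
  qed
qed

lemma form_weak_limit:
  assumes b: "\<And>k. b k \<in> H" and R: "\<And>k. nrm (b k) \<le> R" and u: "u \<in> H" and \<psi>: "\<psi> \<in> H"
    and lim: "AE x in lebesgue. (\<lambda>k. b k x) \<longlonglongrightarrow> u x"
    and dlim: "AE y in lebesgue. (\<lambda>k. diff_quot \<alpha> (b k) y) \<longlonglongrightarrow> diff_quot \<alpha> u y"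
  shows "(\<lambda>k. form 0 (b k) \<psi>) \<longlonglongrightarrow> form 0 u \<psi>"
proof -
  note bD = frac_sobolevD[OF b] and uD = frac_sobolevD[OF u] and \<psi>D = frac_sobolevD[OF \<psi>]
  have 1: "(\<lambda>k. \<integral>y. diff_quot \<alpha> (b k) y * diff_quot \<alpha> \<psi> y \<partial>lebesgue) \<longlonglongrightarrow> (\<integral>y. diff_quot \<alpha> u y * diff_quot \<alpha> \<psi> y \<partial>lebesgue)"
    using L2_le_frac_sobolev_norm(2)[OF b R] by (intro bounded_square_weak_limit[where C="R\<^sup>2"] bD uD \<psi>D dlim) (simp add: gagliardo_eq)
  have V\<psi>: "integrable lebesgue (\<lambda>x. (V x * \<psi> x)\<^sup>2)"
  proof (rule Bochner_Integration.integrable_bound)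
    show "integrable lebesgue (\<lambda>x. v1\<^sup>2 * (\<psi> x)\<^sup>2)" using \<psi>D by simp
    show "AE x in lebesgue. norm ((V x * \<psi> x)\<^sup>2) \<le> norm (v1\<^sup>2 * (\<psi> x)\<^sup>2)"
      using V_bounds by eventually_elim (use v0 in \<open>auto simp: power_mult_distrib intro!: mult_right_mono power_mono\<close>)
    show "(\<lambda>x. (V x * \<psi> x)\<^sup>2) \<in> borel_measurable lebesgue" using V_meas \<psi>D(1) by measurable
  qed
  have V\<psi>m: "(\<lambda>x. V x * \<psi> x) \<in> borel_measurable lebesgue" using V_meas \<psi>D(1) by measurable
  have "(\<lambda>k. \<integral>x. b k x * (V x * \<psi> x) \<partial>lebesgue) \<longlonglongrightarrow> (\<integral>x. u x * (V x * \<psi> x) \<partial>lebesgue)"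
    using L2_le_frac_sobolev_norm(1)[OF b R] by (intro bounded_square_weak_limit[where C="R\<^sup>2"] bD uD V\<psi> V\<psi>m lim)
  then have 2: "(\<lambda>k. \<integral>x. V x * (b k x * \<psi> x) \<partial>lebesgue) \<longlonglongrightarrow> (\<integral>x. V x * (u x * \<psi> x) \<partial>lebesgue)"
    by (simp add: mult_ac)
  show ?thesis unfolding form_def using 1 2 by (auto intro!: tendsto_intros)
qed

lemma integral_g_weak_limit:
  assumes b: "\<And>k. b k \<in> H" and R: "\<And>k. nrm (b k) \<le> R" and u: "u \<in> H" and \<psi>: "\<psi> \<in> H"
    and lim: "AE x in lebesgue. (\<lambda>k. b k x) \<longlonglongrightarrow> u x"
  shows "(\<lambda>k. \<integral>x. g x (b k x) * \<psi> x \<partial>lebesgue) \<longlonglongrightarrow> (\<integral>x. g x (u x) * \<psi> x \<partial>lebesgue)"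
proof -
  obtain S where S: "\<And>u. u \<in> H \<Longrightarrow> nrm u \<le> R \<Longrightarrow> (\<integral>x. \<bar>u x\<bar> powr p \<partial>lebesgue) \<le> S"
    using sobolev_embedding[OF alpha _ exps(3), of R] p2 by auto
  show ?thesis
  proof (rule almost_dominated_convergence_integral[where Y="\<lambda>k x. c * ((b k x)\<^sup>2 + \<bar>b k x\<bar> powr p)" and C="c * (R\<^sup>2 + S)"])
    show "integrable lebesgue (\<lambda>x. g x (b k x) * \<psi> x)" for k by (rule integrable_g[OF b \<psi>])
    show "integrable lebesgue (\<lambda>x. g x (u x) * \<psi> x)" by (rule integrable_g[OF u \<psi>])
    show "AE x in lebesgue. (\<lambda>k. g x (b k x) * \<psi> x) \<longlonglongrightarrow> g x (u x) * \<psi> x"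
      using lim g_continuous
    proof eventually_elim
      case (elim x)
      then have "(\<lambda>k. g x (b k x)) \<longlonglongrightarrow> g x (u x)" by blast
      then show ?case by (intro tendsto_intros)
    qed
    show "integrable lebesgue (\<lambda>x. c * ((b k x)\<^sup>2 + \<bar>b k x\<bar> powr p))" for k
      using frac_sobolevD(2)[OF b] integrable_powr_p[OF b] by simp
    show "0 \<le> c * ((b k x)\<^sup>2 + \<bar>b k x\<bar> powr p)" for k x using c0 by simp
    show "(\<integral>x. c * ((b k x)\<^sup>2 + \<bar>b k x\<bar> powr p) \<partial>lebesgue) \<le> c * (R\<^sup>2 + S)" for k
      using frac_sobolevD(2)[OF b] integrable_powr_p[OF b] c0 L2_le_frac_sobolev_norm(1)[OF b R] S[OF b R]
      by (simp add: mult_left_mono add_mono)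
    fix \<epsilon> :: real assume \<epsilon>: "0 < \<epsilon>"
    show "\<exists>D. integrable lebesgue D \<and> (\<forall>k. AE x in lebesgue. \<bar>g x (b k x) * \<psi> x\<bar> \<le> D x + \<epsilon> * (c * ((b k x)\<^sup>2 + \<bar>b k x\<bar> powr p)))"
    proof (intro exI conjI allI)
      show "integrable lebesgue (\<lambda>x. c * ((\<psi> x)\<^sup>2 / \<epsilon> + \<epsilon> powr (1 - p) * \<bar>\<psi> x\<bar> powr p))"
        using frac_sobolevD(2)[OF \<psi>] integrable_powr_p[OF \<psi>] by simp
      show "AE x in lebesgue. \<bar>g x (b k x) * \<psi> x\<bar> \<le> c * ((\<psi> x)\<^sup>2 / \<epsilon> + \<epsilon> powr (1 - p) * \<bar>\<psi> x\<bar> powr p) + \<epsilon> * (c * ((b k x)\<^sup>2 + \<bar>b k x\<bar> powr p))" for k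
        using g_times_bound[OF \<epsilon>] by eventually_elim blast
    qed
  qed
qed

text \<open>No mass is lost on bounded sets, as the \<open>L\<^sup>p\<close> bound with \<open>p > 2\<close> makes the squares uniformly integrable there.\<close>

lemma mass_in_ball_passes_to_limit:
  assumes b: "\<And>k. b k \<in> H" and R: "\<And>k. nrm (b k) \<le> R"
    and lim: "AE x in lebesgue. (\<lambda>k. b k x) \<longlonglongrightarrow> 0"
  shows "(\<lambda>k. \<integral>x. indicator (ball 0 r) x * (b k x)\<^sup>2 \<partial>lebesgue) \<longlonglongrightarrow> 0"
proof -
  obtain S where S: "\<And>u. u \<in> H \<Longrightarrow> nrm u \<le> R \<Longrightarrow> (\<integral>x. \<bar>u x\<bar> powr p \<partial>lebesgue) \<le> S"
    using sobolev_embedding[OF alpha _ exps(3), of R] p2 by auto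
  let ?B = "ball (0 :: real^'n) r"
  have Bm[measurable]: "?B \<in> sets lebesgue" by simp
  have Bfin: "integrable lebesgue (indicator ?B :: _ \<Rightarrow> real)"
    using emeasure_bounded_finite[OF bounded_ball, of "0 :: real^'n" r] by simp
  have "(\<lambda>k. \<integral>x. indicator ?B x * (b k x)\<^sup>2 \<partial>lebesgue) \<longlonglongrightarrow> (\<integral>x. (0 :: real) \<partial>(lebesgue :: (real^'n) measure))"
  proof (rule almost_dominated_convergence_integral[where Y="\<lambda>k x. \<bar>b k x\<bar> powr p" and C=S])
    show "integrable lebesgue (\<lambda>x. indicator ?B x * (b k x)\<^sup>2)" for k
    proof (rule Bochner_Integration.integrable_bound[OF frac_sobolevD(2)[OF b[of k]]])
      show "(\<lambda>x. indicator ?B x * (b k x)\<^sup>2) \<in> borel_measurable lebesgue"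
        using frac_sobolevD(1)[OF b[of k]] by measurable
    qed (auto simp: indicator_def)
    show "AE x in lebesgue. (\<lambda>k. indicator ?B x * (b k x)\<^sup>2) \<longlonglongrightarrow> 0"
      using lim
    proof eventually_elim
      case (elim x)
      have "(\<lambda>k. indicator ?B x * (b k x)\<^sup>2) \<longlonglongrightarrow> indicator ?B x * 0\<^sup>2" by (intro tendsto_intros elim)
      then show ?case by simp
    qed
    show "integrable lebesgue (\<lambda>x. \<bar>b k x\<bar> powr p)" for k by (rule integrable_powr_p[OF b])
    show "(\<integral>x. \<bar>b k x\<bar> powr p \<partial>lebesgue) \<le> S" for k by (rule S[OF b R])
    fix \<epsilon> :: real assume \<epsilon>: "0 < \<epsilon>"
    \<comment> \<open>The level above which \<open>t\<^sup>2 \<le> \<epsilon> t\<^sup>p\<close>.\<close>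
    define s where "s = \<epsilon> powr (1 / (2 - p))"
    have s: "0 < s" using \<epsilon> by (simp add: s_def)
    have sp: "s powr (2 - p) = \<epsilon>" using \<epsilon> p2 by (simp add: s_def powr_powr)
    show "\<exists>D. integrable lebesgue D \<and> (\<forall>k. AE x in lebesgue. \<bar>indicator ?B x * (b k x)\<^sup>2\<bar> \<le> D x + \<epsilon> * \<bar>b k x\<bar> powr p)"
    proof (intro exI conjI allI AE_I2)
      show "integrable lebesgue (\<lambda>x. indicator ?B x * s\<^sup>2)" using Bfin by simp
      fix k x
      have "(b k x)\<^sup>2 \<le> s\<^sup>2 + \<epsilon> * \<bar>b k x\<bar> powr p"
        using young_powr_square[OF s, of p "b k x" 1] p2 sp by (cases "\<bar>b k x\<bar> \<le> s") (auto simp: powr_interpolation power_mono abs_le_square_iff)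
      then show "\<bar>indicator ?B x * (b k x)\<^sup>2\<bar> \<le> indicator ?B x * s\<^sup>2 + \<epsilon> * \<bar>b k x\<bar> powr p"
        using \<epsilon> by (auto simp: indicator_def)
    qed
  qed auto
  then show ?thesis by simp
qed


section \<open>Convergence of ground states\<close>

text \<open>
  The energy for \<open>\<mu> = 0\<close> on a bounded piece of a fixed ray is an upper bound for all \<open>\<mu> \<ge> 0\<close>, and the
  piece can be chosen long enough to meet every Nehari manifold involved.
\<close>

lemma ground_levels_bounded:
  assumes v: "v \<in> H" and ne: "\<not> (AE x in lebesgue. v x = 0)"
    and \<theta>: "0 < \<theta>" "\<And>\<mu>. 0 \<le> \<mu> \<Longrightarrow> \<mu> \<le> \<mu>' \<Longrightarrow> \<theta> * (nrm v)\<^sup>2 \<le> form \<mu> v v"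
  shows "\<exists>C. \<forall>\<mu>. 0 \<le> \<mu> \<longrightarrow> \<mu> \<le> \<mu>' \<longrightarrow> (\<exists>w\<in>nehari_set \<mu>. J \<mu> w \<le> C)"
proof -
  obtain T where T: "0 < T" "J 0 (\<lambda>x. T * v x) < 0" using J_ray_negative[OF v ne] by auto
  have "continuous_on {0..T} (\<lambda>t. J 0 (\<lambda>x. t * v x))"
    by (intro continuous_at_imp_continuous_on ballI DERIV_isCont[OF J_ray_DERIV[OF v]])
  then have "\<exists>t0\<in>{0..T}. \<forall>t\<in>{0..T}. J 0 (\<lambda>x. t * v x) \<le> J 0 (\<lambda>x. t0 * v x)"
    using T by (intro continuous_attains_sup) auto
  then obtain t0 where t0: "\<And>t. t \<in> {0..T} \<Longrightarrow> J 0 (\<lambda>x. t * v x) \<le> J 0 (\<lambda>x. t0 * v x)"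
    by blast
  show ?thesis
  proof (intro exI allI impI)
    fix \<mu> :: real assume \<mu>: "0 \<le> \<mu>" "\<mu> \<le> \<mu>'"
    have "J \<mu> (\<lambda>x. T * v x) < 0"
      using J_antimono_mu[OF \<mu>(1) frac_sobolev_scale[OF v], of T] T(2) by linarith
    then obtain t where t: "0 < t" "t < T" "(\<lambda>x. t * v x) \<in> nehari_set \<mu>"
      using nehari_projection[OF v ne \<theta>(1) \<theta>(2)[OF \<mu>] T(1)] by auto
    have "J \<mu> (\<lambda>x. t * v x) \<le> J 0 (\<lambda>x. t0 * v x)"
      using J_antimono_mu[OF \<mu>(1) frac_sobolev_scale[OF v], of t] t0[of t] t by auto
    then show "\<exists>w\<in>nehari_set \<mu>. J \<mu> w \<le> J 0 (\<lambda>x. t0 * v x)" using t(3) by blast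
  qed
qed

text \<open>
  At the point where the ray through \<open>v\<close> meets the manifold for \<open>\<mu>\<close>, the energy for \<open>\<mu>\<close> is at most the
  energy for \<open>0\<close>, which on this ray is largest at \<open>v\<close>.
\<close>

lemma ground_level_le:
  assumes v: "v \<in> nehari_set 0" and \<mu>: "0 \<le> \<mu>" and \<theta>: "0 < \<theta>" "\<theta> * (nrm v)\<^sup>2 \<le> form \<mu> v v"
  shows "\<exists>w\<in>nehari_set \<mu>. J \<mu> w \<le> J 0 v"
proof -
  have vH: "v \<in> H" and ne: "\<not> (AE x in lebesgue. v x = 0)" using v by (auto simp: nehari_set_def)
  obtain T where T: "0 < T" "J 0 (\<lambda>x. T * v x) < 0" using J_ray_negative[OF vH ne] by auto
  have "J \<mu> (\<lambda>x. T * v x) < 0"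
    using J_antimono_mu[OF \<mu> frac_sobolev_scale[OF vH], of T] T(2) by linarith
  then obtain t where t: "0 < t" "(\<lambda>x. t * v x) \<in> nehari_set \<mu>"
    using nehari_projection[OF vH ne \<theta> T(1)] by auto
  have "J \<mu> (\<lambda>x. t * v x) \<le> J 0 v"
    using J_antimono_mu[OF \<mu> frac_sobolev_scale[OF vH], of t] J_ray_le[OF v, of t] t(1) by linarith
  then show ?thesis using t(2) by blast
qed

lemma ground_states_converge:
  fixes \<mu> :: "nat \<Rightarrow> real" and u :: "nat \<Rightarrow> real^'n \<Rightarrow> real"
  assumes \<mu>0: "\<And>n. 0 \<le> \<mu> n" and \<mu>lim: "\<mu> \<longlonglongrightarrow> 0"
    and uN: "\<And>n. u n \<in> nehari_set (\<mu> n)"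
    and crit: "\<And>n v. v \<in> H \<Longrightarrow> dJ (\<mu> n) (u n) v = 0"
    and ground: "\<And>n w. w \<in> nehari_set (\<mu> n) \<Longrightarrow> J (\<mu> n) (u n) \<le> J (\<mu> n) w"
  shows "\<exists>z r u0. (\<forall>n. z n \<in> int_lattice) \<and> strict_mono r \<and> u0 \<in> nehari_set 0 \<and>
      (\<forall>v\<in>H. dJ 0 u0 v = 0) \<and> (\<forall>w\<in>nehari_set 0. J 0 u0 \<le> J 0 w) \<and>
      (\<lambda>k. nrm (\<lambda>x. u (r k) (x - z (r k)) - u0 x)) \<longlonglongrightarrow> 0"
proof -
  obtain \<mu>' \<theta> where \<mu>': "0 < \<mu>'" and \<theta>: "0 < \<theta>"
    and co: "\<And>\<nu> u. 0 \<le> \<nu> \<Longrightarrow> \<nu> \<le> \<mu>' \<Longrightarrow> u \<in> H \<Longrightarrow> \<theta> * (nrm u)\<^sup>2 \<le> form \<nu> u u"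
    using coercive by blast
  have "\<forall>\<^sub>F n in sequentially. \<mu> n < \<mu>'" using order_tendstoD(2)[OF \<mu>lim \<mu>'] .
  then obtain N where N: "\<And>n. N \<le> n \<Longrightarrow> \<mu> n \<le> \<mu>'" by (auto simp: eventually_sequentially intro: less_imp_le)
  \<comment> \<open>Finitely many terms are dropped, for which the form need not be coercive with constant \<open>\<theta>\<close>.\<close>
  define m where "m n = \<mu> (n + N)" for n
  define a where "a n = u (n + N)" for n
  have m: "0 \<le> m n" "m n \<le> \<mu>'" for n using \<mu>0 N by (auto simp: m_def)
  have mlim: "m \<longlonglongrightarrow> 0" unfolding m_def using \<mu>lim by (rule LIMSEQ_ignore_initial_segment)
  have aN: "a n \<in> nehari_set (m n)" for n using uN by (simp add: a_def m_def)
  have aH: "a n \<in> H" for n using aN by (simp add: nehari_set_def)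
  have acrit: "dJ (m n) (a n) v = 0" if "v \<in> H" for n v using crit[OF that] by (simp add: a_def m_def)
  have aground: "J (m n) (a n) \<le> J (m n) w" if "w \<in> nehari_set (m n)" for n w
    using ground[of w "n + N"] that by (simp add: a_def m_def)
  define \<eta> where "\<eta> = 1 / 2 - 1 / q"
  have \<eta>: "0 < \<eta>" using exps by (simp add: \<eta>_def field_simps)

  \<comment> \<open>Uniform bounds from the comparison with one fixed ray.\<close>
  have "\<exists>R. \<forall>n. nrm (a n) \<le> R"
  proof -
    have ne: "\<not> (AE x in lebesgue. a 0 x = 0)" using aN by (simp add: nehari_set_def)
    obtain C where C: "\<And>\<nu>. 0 \<le> \<nu> \<Longrightarrow> \<nu> \<le> \<mu>' \<Longrightarrow> \<exists>w\<in>nehari_set \<nu>. J \<nu> w \<le> C"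
      using ground_levels_bounded[OF aH ne \<theta> co[OF _ _ aH]] by blast
    have "nrm (a n) \<le> 1 + C / (\<eta> * \<theta>)" for n
    proof -
      obtain w where "w \<in> nehari_set (m n)" "J (m n) w \<le> C" using C[OF m] by blast
      then have "J (m n) (a n) \<le> C" using aground[of w n] by linarith
      moreover have "0 \<le> (\<integral>x. ar_defect (a n) x \<partial>lebesgue)"
        using ar_defect_nonneg by (intro integral_nonneg_AE) (auto elim: eventually_mono)
      ultimately have "\<eta> * form (m n) (a n) (a n) \<le> C"
        using J_on_nehari[OF aH acrit[OF aH], of n] by (simp add: \<eta>_def)
      moreover have "\<eta> * (\<theta> * (nrm (a n))\<^sup>2) \<le> \<eta> * form (m n) (a n) (a n)"
        using co[OF m aH] \<eta> by (intro mult_left_mono) auto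
      ultimately have "(\<eta> * \<theta>) * (nrm (a n))\<^sup>2 \<le> C" by (simp add: mult.assoc)
      then have "(nrm (a n))\<^sup>2 \<le> C / (\<eta> * \<theta>)" using \<eta> \<theta> by (simp add: pos_le_divide_eq mult.commute)
      moreover have "nrm (a n) \<le> 1 + (nrm (a n))\<^sup>2" using abs_le_plus_powr[of 1 2 "nrm (a n)"] by simp
      ultimately show ?thesis by linarith
    qed
    then show ?thesis by blast
  qed
  then obtain R where R: "\<And>n. nrm (a n) \<le> R" by blast

  \<comment> \<open>The sequence does not vanish, so lattice translations keep mass in a fixed ball.\<close>
  obtain \<rho> where \<rho>: "0 < \<rho>" "\<And>n. \<rho> \<le> (\<integral>x. \<bar>a n x\<bar> powr p \<partial>lebesgue)"
    using nehari_lower_bound[OF \<theta>] co[OF m aH] aN by blast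
  obtain \<delta> where \<delta>: "0 < \<delta>" and conc: "\<And>n. \<exists>x. \<delta> \<le> (\<integral>y. indicator (ball x 1) y * (a n y)\<^sup>2 \<partial>lebesgue)"
    using concentration_on_unit_ball[OF alpha p2 exps(3) \<rho>(1), of R] aH R \<rho>(2) by blast
  let ?r = "real CARD('n) + 1"
  have ex: "\<exists>y. y \<in> int_lattice \<and> \<delta> \<le> (\<integral>x. indicator (ball 0 ?r) x * (a n (x + y))\<^sup>2 \<partial>lebesgue)" for n
  proof -
    obtain x where x: "\<delta> \<le> (\<integral>y. indicator (ball x 1) y * (a n y)\<^sup>2 \<partial>lebesgue)" using conc by blast
    obtain y where y: "y \<in> int_lattice" "norm (x - y) \<le> real CARD('n)" using lattice_point_near by blast
    have [measurable]: "a n \<in> borel_measurable lebesgue" using frac_sobolevD(1)[OF aH] .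
    have [measurable]: "ball x 1 \<in> sets lebesgue" by simp
    have B: "integrable lebesgue (\<lambda>t. indicator A t * (w t)\<^sup>2)" if "w \<in> H" "A \<in> sets lebesgue" for w and A :: "(real^'n) set"
    proof (rule Bochner_Integration.integrable_bound[OF frac_sobolevD(2)[OF that(1)]])
      show "(\<lambda>t. indicator A t * (w t)\<^sup>2) \<in> borel_measurable lebesgue"
        using frac_sobolevD(1)[OF that(1)] that(2) by measurable
    qed (auto simp: indicator_def)
    have "(\<integral>t. indicator (ball x 1) t * (a n t)\<^sup>2 \<partial>lebesgue) = (\<integral>t. indicator (ball x 1) (t + y) * (a n (t + y))\<^sup>2 \<partial>lebesgue)"
      by (rule integral_translation[where f="\<lambda>t. indicator (ball x 1) t * (a n t)\<^sup>2", symmetric]) measurable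
    also have "\<dots> \<le> (\<integral>t. indicator (ball 0 ?r) t * (a n (t + y))\<^sup>2 \<partial>lebesgue)"
    proof (rule integral_mono)
      show "integrable lebesgue (\<lambda>t. indicator (ball x 1) (t + y) * (a n (t + y))\<^sup>2)"
        using integrable_translation[OF B[OF aH, of "ball x 1"], of y] by simp
      show "integrable lebesgue (\<lambda>t. indicator (ball 0 ?r) t * (a n (t + y))\<^sup>2)"
        by (rule B[OF frac_sobolev_translation[OF aH]]) simp
      fix t
      have "norm t < ?r" if "norm (x - (t + y)) < 1"
      proof -
        have "norm t \<le> norm (x - y) + norm (x - (t + y))"
          using norm_triangle_ineq4[of "x - y" "x - (t + y)"] by (simp add: algebra_simps)
        then show ?thesis using that y(2) by linarith
      qed
      then show "indicator (ball x 1) (t + y) * (a n (t + y))\<^sup>2 \<le> indicator (ball 0 ?r) t * (a n (t + y))\<^sup>2"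
        by (auto simp: indicator_def dist_norm)
    qed
    finally show ?thesis using x y(1) by (intro exI[of _ y]) linarith
  qed
  have "\<exists>y. \<forall>n. y n \<in> int_lattice \<and> \<delta> \<le> (\<integral>x. indicator (ball 0 ?r) x * (a n (x + y n))\<^sup>2 \<partial>lebesgue)"
    by (rule choice, rule allI, rule ex)
  then obtain y where "\<forall>n. y n \<in> int_lattice \<and> \<delta> \<le> (\<integral>x. indicator (ball 0 ?r) x * (a n (x + y n))\<^sup>2 \<partial>lebesgue)"
    by (elim exE)
  then have y: "y n \<in> int_lattice" and mass: "\<delta> \<le> (\<integral>x. indicator (ball 0 ?r) x * (a n (x + y n))\<^sup>2 \<partial>lebesgue)" for n
    by simp_all
  define w where "w n x = a n (x + y n)" for n x
  have wH: "w n \<in> H" for n unfolding w_def by (rule frac_sobolev_translation[OF aH])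
  have wR: "nrm (w n) \<le> R" for n unfolding w_def using R frac_sobolev_norm_translation[OF aH] by simp
  obtain s u0 where s: "strict_mono s" and u0: "u0 \<in> H" and lim: "AE x in lebesgue. (\<lambda>k. w (s k) x) \<longlonglongrightarrow> u0 x"
    and dlim: "AE t in lebesgue. (\<lambda>k. diff_quot \<alpha> (w (s k)) t) \<longlonglongrightarrow> diff_quot \<alpha> u0 t"
    using bounded_AE_convergent_subsequence[where u=w, OF alpha(1) wH wR] by (elim exE conjE) (rule that)
  have mslim: "(\<lambda>k. m (s k)) \<longlonglongrightarrow> 0" using LIMSEQ_subseq_LIMSEQ[OF mlim s] by (simp add: o_def)
  have ne0: "\<not> (AE x in lebesgue. u0 x = 0)"
  proof
    assume "AE x in lebesgue. u0 x = 0"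
    with lim have "AE x in lebesgue. (\<lambda>k. w (s k) x) \<longlonglongrightarrow> 0" by eventually_elim simp
    then have to0: "(\<lambda>k. \<integral>x. indicator (ball 0 ?r) x * (w (s k) x)\<^sup>2 \<partial>lebesgue) \<longlonglongrightarrow> 0"
      by (intro mass_in_ball_passes_to_limit[where R=R] wH wR)
    have "\<delta> \<le> (\<integral>x. indicator (ball 0 ?r) x * (w (s k) x)\<^sup>2 \<partial>lebesgue)" for k
      using mass[of "s k"] by (simp add: w_def)
    then have "\<delta> \<le> 0" by (intro LIMSEQ_le_const[OF to0]) blast
    then show False using \<delta> by simp
  qed

  \<comment> \<open>The Hardy term is not translation invariant, but it carries the factor that tends to zero.\<close>
  obtain CH where CH: "0 \<le> CH" "\<And>u :: real^'n \<Rightarrow> real. u \<in> H \<Longrightarrow> 0 \<le> (\<integral>x. u x * u x / norm x powr \<alpha> \<partial>lebesgue) \<and>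
     (\<integral>x. u x * u x / norm x powr \<alpha> \<partial>lebesgue) \<le> CH * (nrm u)\<^sup>2"
    using hardy_bound by blast
  have R0: "0 \<le> R" using R[of 0] frac_sobolev_norm_nonneg[of \<alpha> "a 0"] by linarith
  have HR: "(\<integral>x. a n x * a n x / norm x powr \<alpha> \<partial>lebesgue) \<le> CH * R\<^sup>2" for n
  proof -
    have "(nrm (a n))\<^sup>2 \<le> R\<^sup>2" using R frac_sobolev_norm_nonneg by (intro power_mono)
    then have "CH * (nrm (a n))\<^sup>2 \<le> CH * R\<^sup>2" using CH(1) by (rule mult_left_mono)
    then show ?thesis using CH(2)[OF aH, of n] by linarith
  qed
  have crit0: "dJ 0 u0 \<psi> = 0" if \<psi>: "\<psi> \<in> H" for \<psi>
  proof -
    have bound: "\<bar>dJ 0 (w n) \<psi>\<bar> \<le> m n * (CH * R\<^sup>2 + CH * (nrm \<psi>)\<^sup>2)" for n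
    proof -
      define \<phi> where "\<phi> x = \<psi> (x - y n)" for x
      have \<phi>: "\<phi> \<in> H" unfolding \<phi>_def using frac_sobolev_translation[OF \<psi>, of "- y n"] by simp
      have \<phi>n: "nrm \<phi> = nrm \<psi>" unfolding \<phi>_def using frac_sobolev_norm_translation[OF \<psi>, of "- y n"] by simp
      have \<psi>\<phi>: "\<psi> = (\<lambda>x. \<phi> (x + y n))" by (simp add: \<phi>_def)
      have "dJ 0 (w n) \<psi> = dJ 0 (a n) \<phi>"
        unfolding dJ_def w_def \<psi>\<phi> using form_translation[OF aH \<phi> y] integral_g_translation[OF aH \<phi> y] by simp
      also have "\<dots> = dJ (m n) (a n) \<phi> + m n * (\<integral>x. a n x * \<phi> x / norm x powr \<alpha> \<partial>lebesgue)"
        using form_mu[of "m n" "a n" \<phi>] by (simp add: dJ_def)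
      also have "\<dots> = m n * (\<integral>x. a n x * \<phi> x / norm x powr \<alpha> \<partial>lebesgue)" using acrit[OF \<phi>] by simp
      finally have eq: "dJ 0 (w n) \<psi> = m n * (\<integral>x. a n x * \<phi> x / norm x powr \<alpha> \<partial>lebesgue)" .
      have "\<bar>\<integral>x. a n x * \<phi> x / norm x powr \<alpha> \<partial>lebesgue\<bar> \<le> (\<integral>x. \<bar>a n x * \<phi> x / norm x powr \<alpha>\<bar> \<partial>lebesgue)" by (rule integral_abs_bound)
      also have "\<dots> \<le> (\<integral>x. a n x * a n x / norm x powr \<alpha> + \<phi> x * \<phi> x / norm x powr \<alpha> \<partial>lebesgue)"
      proof (rule integral_mono)
        fix x
        have "\<bar>A * B\<bar> \<le> A * A + B * B" for A B :: real
        proof -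
          have "0 \<le> (\<bar>A\<bar> - \<bar>B\<bar>)\<^sup>2 + A\<^sup>2 + B\<^sup>2" by simp
          then have "\<bar>A * B\<bar> \<le> A\<^sup>2 + B\<^sup>2" by (simp add: power2_diff abs_mult)
          then show ?thesis by (simp add: power2_eq_square)
        qed
        then have "\<bar>a n x * \<phi> x\<bar> / norm x powr \<alpha> \<le> (a n x * a n x + \<phi> x * \<phi> x) / norm x powr \<alpha>"
          by (intro divide_right_mono) auto
        then show "\<bar>a n x * \<phi> x / norm x powr \<alpha>\<bar> \<le> a n x * a n x / norm x powr \<alpha> + \<phi> x * \<phi> x / norm x powr \<alpha>"
          by (simp add: abs_divide add_divide_distrib)
      qed (use integrable_abs[OF integrable_weighted(4)[OF aH \<phi>]] integrable_weighted(4)[OF aH aH] integrable_weighted(4)[OF \<phi> \<phi>] in auto)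
      also have "\<dots> = (\<integral>x. a n x * a n x / norm x powr \<alpha> \<partial>lebesgue) + (\<integral>x. \<phi> x * \<phi> x / norm x powr \<alpha> \<partial>lebesgue)"
        using integrable_weighted(4)[OF aH aH] integrable_weighted(4)[OF \<phi> \<phi>] by (rule Bochner_Integration.integral_add)
      also have "\<dots> \<le> CH * R\<^sup>2 + CH * (nrm \<psi>)\<^sup>2" using HR[of n] CH(2)[OF \<phi>] by (simp add: \<phi>n)
      finally show ?thesis unfolding eq using m(1)[of n] by (simp add: abs_mult mult_left_mono)
    qed
    have "(\<lambda>k. dJ 0 (w (s k)) \<psi>) \<longlonglongrightarrow> dJ 0 u0 \<psi>"
      unfolding dJ_def
      by (intro tendsto_diff form_weak_limit[where R=R] integral_g_weak_limit[where R=R] wH wR u0 \<psi> lim dlim)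
    moreover have "(\<lambda>k. dJ 0 (w (s k)) \<psi>) \<longlonglongrightarrow> 0"
    proof (rule Lim_null_comparison)
      show "\<forall>\<^sub>F k in sequentially. norm (dJ 0 (w (s k)) \<psi>) \<le> m (s k) * (CH * R\<^sup>2 + CH * (nrm \<psi>)\<^sup>2)"
        using bound by simp
      show "(\<lambda>k. m (s k) * (CH * R\<^sup>2 + CH * (nrm \<psi>)\<^sup>2)) \<longlonglongrightarrow> 0"
        using tendsto_mult_left_zero[OF mslim] .
    qed
    ultimately show ?thesis by (rule LIMSEQ_unique)
  qed
  have u0N: "u0 \<in> nehari_set 0" using u0 ne0 crit0[OF u0] by (simp add: nehari_set_def)

  \<comment> \<open>The energy splits into a quadratic part and a nonnegative defect, both lower semicontinuous.\<close>
  define W where "W v = (\<integral>x. ar_defect v x \<partial>lebesgue)" for v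
  \<comment> \<open>The error \<open>e\<close> collects the Hardy term and the mixed term of the quadratic expansion around \<open>u0\<close>.\<close>
  define e where "e k = \<eta> * (m (s k) * (CH * R\<^sup>2)) - 2 * \<eta> * (form 0 (w (s k)) u0 - form 0 u0 u0)" for k
  have elim0: "e \<longlonglongrightarrow> 0"
  proof -
    have "(\<lambda>k. form 0 (w (s k)) u0) \<longlonglongrightarrow> form 0 u0 u0"
      by (intro form_weak_limit[where R=R] wH wR u0 lim dlim)
    then have "(\<lambda>k. \<eta> * (m (s k) * (CH * R\<^sup>2)) - 2 * \<eta> * (form 0 (w (s k)) u0 - form 0 u0 u0))
        \<longlonglongrightarrow> \<eta> * (0 * (CH * R\<^sup>2)) - 2 * \<eta> * (form 0 u0 u0 - form 0 u0 u0)"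
      by (intro tendsto_intros mslim)
    then show ?thesis by (simp add: e_def[abs_def])
  qed
  define D where "D k = form 0 (\<lambda>x. w (s k) x - u0 x) (\<lambda>x. w (s k) x - u0 x)" for k
  have key: "\<eta> * D k + \<eta> * form 0 u0 u0 + W (w (s k)) \<le> J 0 v + e k" if v: "v \<in> nehari_set 0" for v k
  proof -
    let ?a = "a (s k)" and ?m = "m (s k)" and ?w = "w (s k)"
    have vH: "v \<in> H" using v by (simp add: nehari_set_def)
    obtain v' where "v' \<in> nehari_set ?m" "J ?m v' \<le> J 0 v"
      using ground_level_le[OF v m(1) \<theta> co[OF m vH]] by blast
    then have le: "J ?m ?a \<le> J 0 v" using aground[of v' "s k"] by linarith
    have "J ?m ?a = \<eta> * form ?m ?a ?a + W ?a" using J_on_nehari[OF aH acrit[OF aH]] by (simp add: \<eta>_def W_def)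
    moreover have "form ?m ?a ?a = form 0 ?w ?w - ?m * (\<integral>x. ?a x * ?a x / norm x powr \<alpha> \<partial>lebesgue)"
      using form_mu[of ?m ?a ?a] form_translation[OF aH aH y[of "s k"], of "s k" "s k"] by (simp add: w_def[abs_def])
    moreover have "W ?a = W ?w" using integral_ar_defect_translation[OF aH y[of "s k"], of "s k"] by (simp add: W_def w_def[abs_def])
    ultimately have J: "J ?m ?a = \<eta> * form 0 ?w ?w - \<eta> * (?m * (\<integral>x. ?a x * ?a x / norm x powr \<alpha> \<partial>lebesgue)) + W ?w"
      by (simp add: right_diff_distrib)
    have "?m * (\<integral>x. ?a x * ?a x / norm x powr \<alpha> \<partial>lebesgue) \<le> ?m * (CH * R\<^sup>2)"
      using HR m(1) by (intro mult_left_mono)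
    then have "\<eta> * (?m * (\<integral>x. ?a x * ?a x / norm x powr \<alpha> \<partial>lebesgue)) \<le> \<eta> * (?m * (CH * R\<^sup>2))"
      by (rule mult_left_mono) (use \<eta> in simp)
    moreover have "form 0 ?w ?w = D k + form 0 u0 u0 + 2 * (form 0 ?w u0 - form 0 u0 u0)"
    proof -
      have d: "(\<lambda>x. ?w x - u0 x) \<in> H" by (rule frac_sobolev_diff[OF wH u0])
      have "form 0 ?w ?w = D k + 2 * form 0 (\<lambda>x. ?w x - u0 x) u0 + form 0 u0 u0"
        using form_square_add[OF d u0, of 0] by (simp add: D_def)
      moreover have "form 0 ?w u0 = form 0 (\<lambda>x. ?w x - u0 x) u0 + form 0 u0 u0"
      proof -
        have "form 0 u0 ?w = form 0 u0 (\<lambda>x. ?w x - u0 x) + form 0 u0 u0"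
          using form_add_right[OF u0 d u0, of 0] by simp
        then show ?thesis by (simp only: form_commute[of 0 u0 ?w] form_commute[of 0 u0 "\<lambda>x. ?w x - u0 x"])
      qed
      ultimately show ?thesis by simp
    qed
    then have "\<eta> * form 0 ?w ?w = \<eta> * (D k + form 0 u0 u0 + 2 * (form 0 ?w u0 - form 0 u0 u0))"
      by (simp only:)
    then have "\<eta> * form 0 ?w ?w = \<eta> * D k + \<eta> * form 0 u0 u0 + 2 * \<eta> * (form 0 ?w u0 - form 0 u0 u0)"
      by (simp only: distrib_left)
    ultimately show ?thesis using le J unfolding e_def by linarith
  qed
  have D_ge: "min \<kappa> v0 * (nrm (\<lambda>x. w (s k) x - u0 x))\<^sup>2 \<le> D k" for k
    unfolding D_def by (rule form_zero_bounds(1)[OF frac_sobolev_diff[OF wH u0]])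
  have \<kappa>0: "0 < min \<kappa> v0" using kappa v0 by simp
  have D0: "0 \<le> D k" for k
  proof -
    have "0 \<le> min \<kappa> v0 * (nrm (\<lambda>x. w (s k) x - u0 x))\<^sup>2" using \<kappa>0 by simp
    then show ?thesis using D_ge[of k] by linarith
  qed
  have W_lsc: "\<forall>\<^sub>F k in sequentially. W u0 - \<epsilon> < W (w (s k))" if "0 < \<epsilon>" for \<epsilon>
    unfolding W_def
  proof (rule fatou_lower_bound[OF _ _ _ _ _ that])
    show "integrable lebesgue (ar_defect (w (s k)))" for k by (rule integrable_ar_defect[OF wH])
    show "integrable lebesgue (ar_defect u0)" by (rule integrable_ar_defect[OF u0])
    show "AE x in lebesgue. 0 \<le> ar_defect (w (s k)) x" for k using ar_defect_nonneg by eventually_elim blast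
    show "AE x in lebesgue. 0 \<le> ar_defect u0 x" using ar_defect_nonneg by eventually_elim blast
    show "AE x in lebesgue. (\<lambda>k. ar_defect (w (s k)) x) \<longlonglongrightarrow> ar_defect u0 x"
      using lim g_continuous G_deriv
    proof eventually_elim
      case (elim x)
      have 1: "(\<lambda>k. g x (w (s k) x)) \<longlonglongrightarrow> g x (u0 x)" using elim by blast
      have "isCont (G x) (u0 x)" using elim(3) DERIV_isCont by blast
      then have 2: "(\<lambda>k. G x (w (s k) x)) \<longlonglongrightarrow> G x (u0 x)" using elim(1) by (rule isCont_tendsto_compose)
      show ?case unfolding ar_defect_def by (intro tendsto_intros elim(1) 1 2)
    qed
  qed
  have J0: "J 0 u0 = \<eta> * form 0 u0 u0 + W u0"
    using J_on_nehari[OF u0 crit0[OF u0]] by (simp add: \<eta>_def W_def)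
  have minimal: "J 0 u0 \<le> J 0 v" if v: "v \<in> nehari_set 0" for v
  proof (rule field_le_epsilon)
    fix \<epsilon> :: real assume \<epsilon>: "0 < \<epsilon>"
    have "\<forall>\<^sub>F k in sequentially. e k < \<epsilon> / 2" using order_tendstoD(2)[OF elim0, of "\<epsilon> / 2"] \<epsilon> by simp
    moreover have "\<forall>\<^sub>F k in sequentially. W u0 - \<epsilon> / 2 < W (w (s k))" using W_lsc[of "\<epsilon> / 2"] \<epsilon> by simp
    ultimately have "\<forall>\<^sub>F k in sequentially. J 0 u0 \<le> J 0 v + \<epsilon>"
    proof eventually_elim
      case (elim k)
      have "0 \<le> \<eta> * D k" using \<eta> D0 by simp
      then show ?case using key[OF v, of k] elim J0 by linarith
    qed
    then show "J 0 u0 \<le> J 0 v + \<epsilon>" by simp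
  qed
  have Dlim: "D \<longlonglongrightarrow> 0"
  proof (rule LIMSEQ_I)
    fix \<epsilon> :: real assume \<epsilon>: "0 < \<epsilon>"
    have he: "0 < \<eta> * \<epsilon> / 2" using \<eta> \<epsilon> by simp
    have "\<forall>\<^sub>F k in sequentially. e k < \<eta> * \<epsilon> / 2" using order_tendstoD(2)[OF elim0 he] .
    moreover have "\<forall>\<^sub>F k in sequentially. W u0 - \<eta> * \<epsilon> / 2 < W (w (s k))" using W_lsc[OF he] .
    ultimately have "\<forall>\<^sub>F k in sequentially. norm (D k - 0) < \<epsilon>"
    proof eventually_elim
      case (elim k)
      have "\<eta> * D k < \<eta> * \<epsilon>" using key[OF u0N, of k] elim J0 by linarith
      then show ?case using \<eta> D0[of k] by simp
    qed
    then show "\<exists>no. \<forall>k\<ge>no. norm (D k - 0) < \<epsilon>" by (simp add: eventually_sequentially)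
  qed
  have conv: "(\<lambda>k. nrm (\<lambda>x. w (s k) x - u0 x)) \<longlonglongrightarrow> 0"
  proof -
    have "(\<lambda>k. (nrm (\<lambda>x. w (s k) x - u0 x))\<^sup>2) \<longlonglongrightarrow> 0"
    proof (rule Lim_null_comparison)
      show "\<forall>\<^sub>F k in sequentially. norm ((nrm (\<lambda>x. w (s k) x - u0 x))\<^sup>2) \<le> D k / min \<kappa> v0"
        using D_ge \<kappa>0 by (intro always_eventually allI) (simp add: pos_le_divide_eq mult.commute del: min_less_iff_conj)
      show "(\<lambda>k. D k / min \<kappa> v0) \<longlonglongrightarrow> 0" using tendsto_divide_zero[OF Dlim] .
    qed
    then have "(\<lambda>k. sqrt ((nrm (\<lambda>x. w (s k) x - u0 x))\<^sup>2)) \<longlonglongrightarrow> sqrt 0" by (rule tendsto_real_sqrt)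
    then show ?thesis by (simp add: frac_sobolev_norm_nonneg)
  qed
  \<comment> \<open>The dropped terms do not occur along \<open>r\<close>; they get the lattice point \<open>0\<close>.\<close>
  define z where "z n = (if N \<le> n then - y (n - N) else 0)" for n
  define r where "r k = s k + N" for k
  have "z n \<in> int_lattice" for n using lattice_uminus[OF y] by (simp add: z_def int_lattice_def)
  moreover have "strict_mono r" using s by (simp add: r_def strict_mono_def)
  moreover have "(\<lambda>x. u (r k) (x - z (r k)) - u0 x) = (\<lambda>x. w (s k) x - u0 x)" for k
    by (simp add: r_def z_def w_def a_def)
  ultimately show ?thesis using u0N crit0 minimal conv
    by (intro exI[of _ z] exI[of _ r] exI[of _ u0]) simp
qed

end

section \<open>From the hypotheses on the data to the variational setting\<close>

text \<open>
  \<open>Gamma\<close> has the default value \<open>0\<close> at its poles; for \<open>0 < \<alpha> < 2\<close> the argument \<open>-\<alpha>/2\<close> lies strictly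
  between two of them.
\<close>

lemma frac_const_pos:
  assumes "0 < \<alpha>" "\<alpha> < 2" "0 < real N"
  shows "0 < frac_const N \<alpha>"
proof -
  have "Gamma (- \<alpha> / 2) \<noteq> 0"
  proof
    assume "Gamma (- \<alpha> / 2) = 0"
    then have "- \<alpha> / 2 \<in> \<int>\<^sub>\<le>\<^sub>0" by (simp add: Gamma_eq_zero_iff)
    then obtain n where "- \<alpha> / 2 = - real n" by (auto elim!: nonpos_Ints_cases')
    then have "\<alpha> / 2 = real n" by simp
    then have "0 < real n" "real n < 1" using assms by linarith+
    then show False by simp
  qed
  moreover have "0 < Gamma ((real N + \<alpha>) / 2)" using assms by (intro Gamma_real_pos) simp
  ultimately show ?thesis by (simp add: frac_const_def)
qed

lemma essinf_pos:
  assumes "V \<in> borel_measurable lebesgue" "0 < essinf V"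
  shows "\<exists>v>0. AE x in lebesgue. v \<le> V x"
proof -
  obtain r where r: "0 < ereal r" "ereal r < essinf V" using ereal_dense2[OF assms(2)] by auto
  have "AE x in lebesgue. - ereal (V x) \<le> esssup lebesgue (\<lambda>x. - ereal (V x))" by (rule esssup_AE)
  then have "AE x in lebesgue. r \<le> V x"
  proof eventually_elim
    case (elim x)
    have "essinf V \<le> ereal (V x)" unfolding essinf_def using elim by (simp add: ereal_uminus_le_reorder)
    then have "ereal r < ereal (V x)" using r(2) by (rule less_le_trans[rotated])
    then show ?case by simp
  qed
  then show ?thesis using r(1) by auto
qed

theorem theorem1p4:
  fixes \<alpha> p q :: real
    and V K :: "real^'n \<Rightarrow> real"
    and f :: "real^'n \<Rightarrow> real \<Rightarrow> real"
    and \<mu> :: "nat \<Rightarrow> real"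
    and u :: "nat \<Rightarrow> real^'n \<Rightarrow> real"
  assumes "0 < \<alpha>" and "\<alpha> < 2" and "\<alpha> < real CARD('n)"
    and "cond_V \<alpha> V (\<lambda>x. 0)"
    and "cond_K K"
    and "cond_F1 \<alpha> q p f" and "cond_F2 f" and "cond_F3 q f" and "cond_F4 q f" and "cond_F5 p f"
    and "\<And>n. 0 \<le> \<mu> n" and "\<And>n. \<mu> n < mu_star CARD('n) \<alpha>"
    and "\<mu> \<longlonglongrightarrow> 0"
    and "\<And>n. ground_state \<alpha> V (\<mu> n) f K q (u n)"
  shows "\<exists>z r u0. (\<forall>n. z n \<in> int_lattice) \<and> strict_mono r \<and>
           ground_state \<alpha> V 0 f K q u0 \<and>
           (\<lambda>k. frac_sobolev_norm \<alpha> (\<lambda>x. u (r k) (x - z (r k)) - u0 x)) \<longlonglongrightarrow> 0"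
proof -
  note F1 = assms(6) and F2 = assms(7) and F3 = assms(8) and F4 = assms(9) and F5 = assms(10) and K = assms(5)
  have q: "2 < q" "q < p" "p < crit_exp CARD('n) \<alpha>" using F1 by (auto simp: cond_F1_def)
  have Vm: "V \<in> borel_measurable lebesgue" using assms(4) by (auto simp: cond_V_def Linfty_def)
  obtain v1 where v1: "AE x in lebesgue. \<bar>V x\<bar> \<le> v1" using assms(4) by (auto simp: cond_V_def Linfty_def)
  obtain v0 where v0: "0 < v0" "AE x in lebesgue. v0 \<le> V x"
    using essinf_pos[OF Vm] assms(4) by (auto simp: cond_V_def)
  obtain Vper where Vper: "ae_periodic Vper" "AE x in lebesgue. V x = Vper x"
    using assms(4) by (auto simp: cond_V_def)
  have cont: "AE x in lebesgue. continuous_on UNIV (f x)" and fm: "(\<lambda>(x, u). f x u) \<in> borel_measurable lebesgue"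
    using F1 by (auto simp: cond_F1_def)
  have Km: "K \<in> borel_measurable lebesgue" using K by (auto simp: cond_K_def Linfty_def)
  obtain c where c: "0 \<le> c" "AE x in lebesgue. \<forall>a b. \<bar>total_force f K q x a - total_force f K q x b\<bar>
      \<le> c * \<bar>a - b\<bar> * (1 + \<bar>a\<bar> powr (p - 2) + \<bar>b\<bar> powr (p - 2))"
    using total_force_lipschitz[OF F1 F5 K] by blast
  interpret hardy_problem \<alpha> p q "frac_const CARD('n) \<alpha>" v0 v1 c V "total_force f K q" "total_potential f K q"
  proof
    show "0 < frac_const CARD('n) \<alpha>" using assms(1,2) by (intro frac_const_pos) auto
    show "AE x in lebesgue. v0 \<le> V x \<and> V x \<le> v1" using v0(2) v1 by eventually_elim auto
    show "AE x in lebesgue. V (x + z) = V x" if z: "z \<in> int_lattice" for z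
    proof -
      have "AE x in lebesgue. Vper (x + z) = Vper x" using Vper(1) z by (simp add: ae_periodic_def)
      then show ?thesis using Vper(2) AE_translation[OF Vper(2), of z] by eventually_elim simp
    qed
    show "(\<lambda>x. total_force f K q x (u x)) \<in> borel_measurable lebesgue" if [measurable]: "u \<in> borel_measurable lebesgue" for u
      unfolding total_force_def using nonlinearity_measurable[OF fm cont that] Km by measurable
    show "(\<lambda>x. total_potential f K q x (u x)) \<in> borel_measurable lebesgue" if [measurable]: "u \<in> borel_measurable lebesgue" for u
      unfolding total_potential_def using primitive_measurable[OF fm cont that] Km by measurable
    show "AE x in lebesgue. \<forall>s. (total_potential f K q x has_real_derivative total_force f K q x s) (at s)"
      using cont by eventually_elim (use q in \<open>auto intro!: total_potential_DERIV\<close>)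
    show "total_potential f K q x 0 = 0" for x by (rule total_potential_0)
    show "AE x in lebesgue. total_force f K q x 0 = 0"
      using cont by eventually_elim (simp add: total_force_def cond_F1_F2_zero[OF F2])
    show "\<exists>C\<ge>0. AE x in lebesgue. \<forall>s. total_force f K q x s * s \<le> \<epsilon> * s\<^sup>2 + C * \<bar>s\<bar> powr p" if "0 < \<epsilon>" for \<epsilon>
      by (rule total_force_subcritical[OF F1 F2 K that])
    show "AE x in lebesgue. \<forall>t\<ge>0. \<forall>s. (t powr q - 1) / q * (total_force f K q x s * s)
        \<le> total_potential f K q x (t * s) - total_potential f K q x s"
      using cont
    proof eventually_elim
      case (elim x)
      show ?case
        using F4 q by (intro allI impI total_potential_along_ray elim cond_F1_F2_zero[OF F2]) (auto simp: cond_F4_def)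
    qed
    show "\<exists>R>0. AE x in lebesgue. \<forall>s. R \<le> \<bar>s\<bar> \<longrightarrow> \<bar>s\<bar> powr q \<le> total_potential f K q x s"
      using q by (intro total_potential_superlinear[OF F3 K]) simp
    show "AE x in lebesgue. \<forall>s. total_force f K q (x + z) s = total_force f K q x s \<and>
        total_potential f K q (x + z) s = total_potential f K q x s" if "z \<in> int_lattice" for z
      by (rule total_periodic[OF F1 K that])
  qed (use assms(1,3) q Vm v0 c in auto)
  have E: "energy \<alpha> V \<nu> f K q = J \<nu>" for \<nu>
  proof
    fix v :: "real^'n \<Rightarrow> real"
    have "(\<integral>x. \<nu> / norm x powr \<alpha> * \<bar>v x\<bar>\<^sup>2 \<partial>lebesgue) = (\<integral>x. \<nu> * (v x * v x / norm x powr \<alpha>) \<partial>lebesgue)"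
      by (intro Bochner_Integration.integral_cong) (auto simp: power2_eq_square)
    also have "\<dots> = \<nu> * (\<integral>x. v x * v x / norm x powr \<alpha> \<partial>lebesgue)" by (rule integral_mult_right_zero)
    finally show "energy \<alpha> V \<nu> f K q v = J \<nu> v"
      by (simp add: energy_def J_def form_def gagliardo_eq total_potential_def power2_eq_square algebra_simps)
  qed
  have Nh: "nehari \<alpha> V \<nu> f K q = nehari_set \<nu>" for \<nu>
  proof -
    have "(\<exists>L. has_frechet_derivative \<alpha> (J \<nu>) L v \<and> L v = 0) \<longleftrightarrow> dJ \<nu> v v = 0" if "v \<in> H" for v
    proof
      assume "\<exists>L. has_frechet_derivative \<alpha> (J \<nu>) L v \<and> L v = 0"
      then obtain L where L: "has_frechet_derivative \<alpha> (J \<nu>) L v" "L v = 0" by blast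
      show "dJ \<nu> v v = 0" using J_frechet_unique[OF that L(1) that] L(2) by simp
    next
      assume "dJ \<nu> v v = 0"
      with J_frechet[OF that, of \<nu>] show "\<exists>L. has_frechet_derivative \<alpha> (J \<nu>) L v \<and> L v = 0" by blast
    qed
    then show ?thesis unfolding nehari_def nehari_set_def E by auto
  qed
  have gs: "u n \<in> nehari_set (\<mu> n)" "has_frechet_derivative \<alpha> (J (\<mu> n)) (\<lambda>v. 0) (u n)"
    "ereal (J (\<mu> n) (u n)) = (INF v\<in>nehari_set (\<mu> n). ereal (J (\<mu> n) v))" for n
    using assms(14)[of n] unfolding ground_state_def E Nh by auto
  have uH: "u n \<in> H" for n using gs(1)[of n] by (simp add: nehari_set_def)
  have crit: "dJ (\<mu> n) (u n) v = 0" if "v \<in> H" for n v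
    using J_frechet_unique[OF uH gs(2) that] by simp
  have ground: "J (\<mu> n) (u n) \<le> J (\<mu> n) w" if "w \<in> nehari_set (\<mu> n)" for n w
  proof -
    have "ereal (J (\<mu> n) (u n)) \<le> ereal (J (\<mu> n) w)" unfolding gs(3) using that by (rule INF_lower)
    then show ?thesis by simp
  qed
  have "\<exists>z r u0. (\<forall>n. z n \<in> int_lattice) \<and> strict_mono r \<and> u0 \<in> nehari_set 0 \<and>
      (\<forall>v\<in>H. dJ 0 u0 v = 0) \<and> (\<forall>w\<in>nehari_set 0. J 0 u0 \<le> J 0 w) \<and>
      (\<lambda>k. nrm (\<lambda>x. u (r k) (x - z (r k)) - u0 x)) \<longlonglongrightarrow> 0"
    by (rule ground_states_converge[where \<mu>=\<mu>]) (use assms(11,13) gs(1) crit ground in auto)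
  then obtain z r u0 where conv: "\<forall>n. z n \<in> int_lattice" "strict_mono r"
      "(\<lambda>k. frac_sobolev_norm \<alpha> (\<lambda>x. u (r k) (x - z (r k)) - u0 x)) \<longlonglongrightarrow> 0"
    and u0: "u0 \<in> nehari_set 0" "\<forall>v\<in>H. dJ 0 u0 v = 0" "\<forall>w\<in>nehari_set 0. J 0 u0 \<le> J 0 w"
    by (elim exE conjE) (rule that; assumption)
  have u0H: "u0 \<in> H" using u0(1) by (simp add: nehari_set_def)
  have "has_frechet_derivative \<alpha> (J 0) (\<lambda>v. 0) u0"
    using J_frechet[OF u0H, of 0] u0(2) by (simp add: has_frechet_derivative_def)
  moreover have "ereal (J 0 u0) = (INF v\<in>nehari_set 0. ereal (J 0 v))"
    using u0(1,3) by (intro antisym INF_greatest INF_lower) auto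
  ultimately have "ground_state \<alpha> V 0 f K q u0" unfolding ground_state_def E Nh using u0(1) by blast
  then show ?thesis using conv by blast
qed

end
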